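(* Let $B\subset\mathbb{R}^n$ be an open ball. Suppose that $g_\varepsilon\in C(B)$, $\|g_\varepsilon\|_{L^\infty}\le C$ with $C$ independent of $\varepsilon$, and that the functions $v_\varepsilon$ satisfy in the viscosity sense $$M^+_A(v_\varepsilon,x)\ge-g_\varepsilon(x)\ \text{ in } B,\qquad v_\varepsilon\le0\ \text{ on }\mathbb{R}^n\setminus B.$$ If $|\{g_\varepsilon>0\}|\to0$ as $\varepsilon\to0$, then $\|\max(v_\varepsilon,0)\|_{L^\infty}\to0$ as $\varepsilon\to0$.
   Context: Fix $\sigma\in(0,2)$ and $\lambda,\Lambda>0$. Write $\delta u(x,y)=u(x+y)+u(x-y)-2u(x)$; $|E|$ is Lebesgue measure. The extremal operator is $$M^+_A(u,x)=\sup\Big\{\int_{\mathbb{R}^n}\delta u(x,y)\frac{y^TAy}{|y|^{n+\sigma+2}}\,dy:\ A \text{ a symmetric } n\times n \text{ matrix},\ A\ge0,\ \mathrm{Tr}(A)\ge\lambda,\ A\le\Lambda\,\mathrm{Id}\Big\}.$$ Viscosity sense: a bounded $u:\mathbb{R}^n\to\mathbb{R}$, upper semicontinuous on $\overline B$, satisfies $M^+_A(u,x)\ge h(x)$ in $B$ if whenever $x\in B$, $N\subset B$ is an open neighborhood of $x$, $\psi\in C^2(\overline N)$, $\psi(x)=u(x)$ and $\psi>u$ on $N\setminus\{x\}$, the function $v$ equal to $\psi$ in $N$ and to $u$ in $\mathbb{R}^n\setminus N$ satisfies $M^+_A(v,x)\ge h(x)$. *)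

theory Defs
  imports "HOL-Analysis.Analysis" "HOL-Probability.Essential_Supremum"
begin

definition second_diff :: "('a::real_vector \<Rightarrow> real) \<Rightarrow> 'a \<Rightarrow> 'a \<Rightarrow> real" where
  "second_diff u x y = u (x + y) + u (x - y) - 2 * u x"

definition psd :: "real^'n^'n \<Rightarrow> bool" where
  "psd A \<longleftrightarrow> (\<forall>z. 0 \<le> z \<bullet> (A *v z))"

text \<open>Here \<open>mat \<Lambda>\<close> is \<open>\<Lambda>\<close> times the identity matrix.\<close>

definition admissible :: "real \<Rightarrow> real \<Rightarrow> (real^'n^'n) set" where
  "admissible lam \<Lambda> =
     {A. transpose A = A \<and> psd A \<and> lam \<le> trace A \<and> psd (mat \<Lambda> - A)}"

text \<open>The supremum is taken in the extended reals, so that it equals \<open>-\<infinity>\<close> if no matrix is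
  admissible (that is, if \<open>lam > n * \<Lambda>\<close>).  The integral is absolutely convergent if \<open>u\<close> is
  bounded, Lebesgue measurable and \<open>C\<^sup>2\<close> near \<open>x\<close>, which is the case for all functions on which
  the operator is evaluated below.\<close>

definition extremal_op ::
    "real \<Rightarrow> real \<Rightarrow> real \<Rightarrow> (real^'n \<Rightarrow> real) \<Rightarrow> real^'n \<Rightarrow> ereal" where
  "extremal_op \<sigma> lam \<Lambda> u x =
     (SUP A\<in>admissible lam \<Lambda>.
        ereal (\<integral>y. second_diff u x y *
                 ((y \<bullet> (A *v y)) / norm y powr (real CARD('n) + \<sigma> + 2)) \<partial>lebesgue))"

definition usc_on :: "'a::topological_space set \<Rightarrow> ('a \<Rightarrow> real) \<Rightarrow> bool" where
  "usc_on S u \<longleftrightarrow> (\<forall>x\<in>S. \<forall>c. u x < c \<longrightarrow> (\<forall>\<^sub>F y in at x within S. u y < c))"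

text \<open>\<open>C\<^sup>2\<close> up to the boundary of an open set \<open>N\<close>: twice continuously differentiable in \<open>N\<close>, with the
  function, its gradient \<open>G\<close> and its Hessian \<open>H\<close> extending continuously to \<open>closure N\<close>.\<close>

definition C2_closure :: "(real^'n) set \<Rightarrow> (real^'n \<Rightarrow> real) \<Rightarrow> bool" where
  "C2_closure N \<psi> \<longleftrightarrow>
     (\<exists>(G :: real^'n \<Rightarrow> real^'n) (H :: real^'n \<Rightarrow> real^'n^'n).
        continuous_on (closure N) \<psi> \<and> continuous_on (closure N) G \<and>
        continuous_on (closure N) H \<and>
        (\<forall>x\<in>N. (\<psi> has_derivative (\<lambda>h. G x \<bullet> h)) (at x) \<and>
                (G has_derivative (\<lambda>h. H x *v h)) (at x)))"

text \<open>\<open>u\<close> satisfies \<open>M\<^sup>+ u \<ge> h\<close> in \<open>B\<close> in the viscosity sense.  Lebesgue measurability of \<open>u\<close> is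
  stated explicitly because \<open>u\<close> enters the integral, and the Bochner integral of a
  non-measurable function is \<open>0\<close> by convention.\<close>

definition viscosity_subsolution ::
    "real \<Rightarrow> real \<Rightarrow> real \<Rightarrow> (real^'n) set \<Rightarrow> (real^'n \<Rightarrow> real) \<Rightarrow> (real^'n \<Rightarrow> real) \<Rightarrow> bool" where
  "viscosity_subsolution \<sigma> lam \<Lambda> B u h \<longleftrightarrow>
     bounded (range u) \<and> u \<in> borel_measurable lebesgue \<and> usc_on (closure B) u \<and>
     (\<forall>x\<in>B. \<forall>N \<psi>.
        open N \<and> x \<in> N \<and> N \<subseteq> B \<and> C2_closure N \<psi> \<and> \<psi> x = u x \<and> (\<forall>y\<in>N - {x}. u y < \<psi> y)
        \<longrightarrow> ereal (h x) \<le> extremal_op \<sigma> lam \<Lambda> (\<lambda>y. if y \<in> N then \<psi> y else u y) x)"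

text \<open>The \<open>L\<^sup>\<infinity>\<close> norm, as an essential supremum; it is \<open>\<infinity>\<close> for non-measurable functions.\<close>

definition Linf_norm :: "'a measure \<Rightarrow> ('a \<Rightarrow> real) \<Rightarrow> ereal" where
  "Linf_norm M f = esssup M (\<lambda>x. ereal \<bar>f x\<bar>)"

end

theory Submission
  imports Defs
begin

text \<open>A plane wave of frequency \<open>\<xi>\<close> is an eigenfunction of every operator in the supremum, with
  eigenvalue \<open>- \<bar>\<xi>\<bar> powr (\<sigma> - 2)\<close> times a quadratic form in \<open>\<xi>\<close> that is elliptic uniformly in the matrix.
  On the minus fractional Laplacian of order \<open>2 - \<sigma>\<close> of a function \<open>W\<close>, each operator therefore acts
  as minus a second order elliptic operator with constant coefficients applied to \<open>W\<close>.  If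
  \<open>E = {g > 0}\<close> has measure at most \<open>(2 * \<rho>) ^ n\<close>, a discrete Monge-Ampere problem with gradients in a cube of
  side \<open>2 * \<rho>\<close> has a convex solution, of size \<open>\<rho>\<close>, that is strongly curved in some direction at every
  point of \<open>E\<close>.  Periodized and mollified by a trigonometric kernel it gives \<open>W\<close> of size \<open>\<rho>\<close>, semiconvex with
  constant of order \<open>\<rho>\<close>, with Laplacian bounded below on a compact subset of \<open>E\<close>.  The resulting
  supersolution is nonnegative with mean of order \<open>\<rho>\<close>, so by comparison each \<open>v\<close> is small in measure; and
  a subsolution that is small in measure is small at its maximum, where it is touched by a constant.\<close>

section \<open>Invariance of Lebesgue measure\<close>

text \<open>The supremum over \<open>A\<close> is the obstacle: one function has to be a
  supersolution for all admissible matrices at once, and \<open>g\<close> is bounded only by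
  \<open>C\<close>, so the smallness of \<open>E\<close> must enter through its measure alone.
  Semiconvexity meets both demands. A sum of squares plus \<open>b\<close> times the Laplacian feels
  a semiconvex function through a lower Hessian bound and one direction of strong curvature,
  whatever the squares are. The size of a convex function with prescribed curvature is governed by
  the volume of its gradient image, hence the n-th root of the measure of \<open>E\<close>. The
  fractional Laplacian inherits from semiconvexity a bound on one side only and may be large on the
  other, so the supersolution is small in mean but not uniformly. This is why the argument passes
  through measure, by Chebyshev's inequality, and regains a uniform bound from the nonlocal term at
  a maximum. Finite trigonometric sums make all operator identities exact, with no convergence of
  series and no regularity theory.\<close>

lemma nn_integral_lborel_translate:
  fixes a :: "'a::euclidean_space"
  assumes [measurable]: "f \<in> borel_measurable borel"
  shows "(\<integral>\<^sup>+x. f (x + a) \<partial>lborel) = (\<integral>\<^sup>+x. f x \<partial>lborel)"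
proof -
  have "(\<integral>\<^sup>+x. f x \<partial>lborel) = (\<integral>\<^sup>+x. f x \<partial>distr lborel borel ((+) a))"
    by (simp add: lborel_distr_plus)
  also have "\<dots> = (\<integral>\<^sup>+x. f (a + x) \<partial>lborel)"
    by (rule nn_integral_distr) auto
  finally show ?thesis by (simp add: add.commute)
qed

text \<open>Weil's uniqueness argument for Haar measure: the image measure is again translation
  invariant, so a Fubini computation makes it proportional to Lebesgue measure, and the unit ball,
  which \<open>T\<close> maps onto itself, makes the constant one.\<close>

lemma lborel_distr_orthogonal:
  fixes T :: "'a::euclidean_space \<Rightarrow> 'a"
  assumes T: "orthogonal_transformation T"
  shows "distr lborel borel T = lborel"
proof -
  have lin: "linear T" using T by (rule orthogonal_transformation_linear)
  have contT: "continuous_on UNIV T"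
    using lin by (simp add: linear_continuous_on linear_conv_bounded_linear)
  have [measurable]: "T \<in> borel_measurable borel"
    using contT by (rule borel_measurable_continuous_onI)
  define \<mu> where "\<mu> = distr lborel borel T"
  have sets_\<mu>[measurable_cong]: "sets \<mu> = sets borel" by (simp add: \<mu>_def)
  have nn_\<mu>: "(\<integral>\<^sup>+x. g x \<partial>\<mu>) = (\<integral>\<^sup>+x. g (T x) \<partial>lborel)" if "g \<in> borel_measurable borel" for g
    unfolding \<mu>_def using that by (subst nn_integral_distr) auto
  have trans: "(\<integral>\<^sup>+x. g (x + a) \<partial>\<mu>) = (\<integral>\<^sup>+x. g x \<partial>\<mu>)"
    if [measurable]: "g \<in> borel_measurable borel" for g and a :: 'a
  proof -
    obtain b where b: "T b = a" using orthogonal_transformation_surj[OF T] by (metis surjD)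
    have "(\<integral>\<^sup>+x. g (x + a) \<partial>\<mu>) = (\<integral>\<^sup>+x. g (T (x + b)) \<partial>lborel)"
      by (simp add: nn_\<mu> linear_add[OF lin] b)
    also have "\<dots> = (\<integral>\<^sup>+x. g (T x) \<partial>lborel)"
      by (rule nn_integral_lborel_translate[of "\<lambda>x. g (T x)"]) simp
    finally show ?thesis by (simp add: nn_\<mu>)
  qed
  define B :: "'a set" where "B = ball 0 1"
  have [measurable]: "B \<in> sets borel" by (simp add: B_def)
  have \<mu>_ball: "emeasure \<mu> (ball 0 r) = emeasure lborel (ball (0::'a) r)" for r
  proof -
    have "T -` ball 0 r = ball 0 r"
      using T by (auto simp: orthogonal_transformation_norm)
    then show ?thesis unfolding \<mu>_def by (subst emeasure_distr) auto
  qed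
  interpret \<mu>: sigma_finite_measure \<mu>
  proof
    show "\<exists>A. countable A \<and> A \<subseteq> sets \<mu> \<and> \<Union> A = space \<mu> \<and> (\<forall>a\<in>A. emeasure \<mu> a \<noteq> \<infinity>)"
    proof (intro exI[of _ "range (\<lambda>n::nat. ball 0 (real n))"] conjI)
      show "\<Union> (range (\<lambda>n::nat. ball 0 (real n))) = space \<mu>"
        by (auto simp: \<mu>_def) (use reals_Archimedean2 in blast)
      show "\<forall>a\<in>range (\<lambda>n::nat. ball 0 (real n)). emeasure \<mu> a \<noteq> \<infinity>"
        using emeasure_lborel_ball_finite by (auto simp: \<mu>_ball less_top[symmetric])
    qed (auto simp: sets_\<mu>)
  qed
  interpret pair_sigma_finite lborel \<mu> ..
  define f :: "'a \<Rightarrow> ennreal" where "f = indicator B"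
  have [measurable]: "f \<in> borel_measurable borel" unfolding f_def by measurable
  have fm: "f (- x) = f x" for x by (simp add: f_def B_def indicator_def)
  have lf: "(\<integral>\<^sup>+x. f x \<partial>lborel) = emeasure lborel B" by (simp add: f_def)
  have mf: "(\<integral>\<^sup>+x. f x \<partial>\<mu>) = emeasure lborel B" 
    using \<mu>_ball[of 1] by (simp add: f_def sets_\<mu> B_def)
  \<comment> \<open>\<open>g (y + x) * f x\<close> is integrated against both measures; the shift of
    \<open>x\<close> by \<open>y\<close> under \<mu> and the evenness of \<open>f\<close> let the
    two variables exchange their roles.\<close>
  have key: "(\<integral>\<^sup>+y. g y \<partial>lborel) = (\<integral>\<^sup>+y. g y \<partial>\<mu>)" if [measurable]: "g \<in> borel_measurable borel" for g
  proof -
    have [measurable]: "(\<lambda>(y, x). g (y + x) * f x) \<in> borel_measurable (lborel \<Otimes>\<^sub>M \<mu>)"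
      by measurable
    have [measurable]: "(\<lambda>(y, x). g x * f (x - y)) \<in> borel_measurable (lborel \<Otimes>\<^sub>M \<mu>)"
      by measurable
    have "(\<integral>\<^sup>+y. g y \<partial>lborel) * emeasure lborel B = (\<integral>\<^sup>+x. (\<integral>\<^sup>+y. g y \<partial>lborel) * f x \<partial>\<mu>)"
      by (simp add: nn_integral_cmult mf)
    also have "\<dots> = (\<integral>\<^sup>+x. (\<integral>\<^sup>+y. g (y + x) * f x \<partial>lborel) \<partial>\<mu>)"
      by (simp add: nn_integral_multc nn_integral_lborel_translate)
    also have "\<dots> = (\<integral>\<^sup>+y. (\<integral>\<^sup>+x. g (y + x) * f x \<partial>\<mu>) \<partial>lborel)"
      using Fubini[of "\<lambda>(y, x). g (y + x) * f x"] by simp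
    also have "\<dots> = (\<integral>\<^sup>+y. (\<integral>\<^sup>+x. g x * f (x - y) \<partial>\<mu>) \<partial>lborel)"
    proof (rule nn_integral_cong)
      fix y :: 'a
      have "(\<integral>\<^sup>+x. g (x + y) * f (x + y - y) \<partial>\<mu>) = (\<integral>\<^sup>+x. g x * f (x - y) \<partial>\<mu>)"
        by (rule trans) simp
      then show "(\<integral>\<^sup>+x. g (y + x) * f x \<partial>\<mu>) = (\<integral>\<^sup>+x. g x * f (x - y) \<partial>\<mu>)"
        by (simp add: add.commute)
    qed
    also have "\<dots> = (\<integral>\<^sup>+x. (\<integral>\<^sup>+y. g x * f (x - y) \<partial>lborel) \<partial>\<mu>)"
      using Fubini[of "\<lambda>(y, x). g x * f (x - y)"] by simp
    also have "\<dots> = (\<integral>\<^sup>+x. g x * emeasure lborel B \<partial>\<mu>)"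
    proof (rule nn_integral_cong)
      fix x :: 'a
      have "(\<integral>\<^sup>+y. f (x - y) \<partial>lborel) = (\<integral>\<^sup>+y. f (y + - x) \<partial>lborel)"
        using fm by (intro nn_integral_cong) (metis minus_diff_eq uminus_add_conv_diff add.commute)
      also have "\<dots> = emeasure lborel B" by (subst nn_integral_lborel_translate) (auto simp: lf)
      finally show "(\<integral>\<^sup>+y. g x * f (x - y) \<partial>lborel) = g x * emeasure lborel B"
        by (simp add: nn_integral_cmult)
    qed
    also have "\<dots> = (\<integral>\<^sup>+y. g y \<partial>\<mu>) * emeasure lborel B" by (simp add: nn_integral_multc)
    finally have eq: "(\<integral>\<^sup>+y. g y \<partial>lborel) * emeasure lborel B = (\<integral>\<^sup>+y. g y \<partial>\<mu>) * emeasure lborel B" .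
    have "emeasure lborel B \<noteq> 0"
      using open_not_negligible[of B] by (auto simp: B_def negligible_iff_emeasure0)
    moreover have "emeasure lborel B \<noteq> \<infinity>"
      using emeasure_lborel_ball_finite[of "0::'a" 1] by (simp add: B_def)
    ultimately show ?thesis using eq by (metis ennreal_mult_cancel_left mult.commute infinity_ennreal_def)
  qed
  have "\<mu> = lborel"
  proof (rule measure_eqI)
    fix A assume "A \<in> sets \<mu>"
    then have A[measurable]: "A \<in> sets borel" by (simp add: sets_\<mu>)
    then show "emeasure \<mu> A = emeasure lborel A"
      using key[of "indicator A"] by (simp add: sets_\<mu>)
  qed (simp add: sets_\<mu>)
  then show ?thesis by (simp add: \<mu>_def)
qed

lemma lborel_integral_translate:
  fixes f :: "'a::euclidean_space \<Rightarrow> real"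
  assumes [measurable]: "f \<in> borel_measurable borel"
  shows "(\<integral>x. f (x + a) \<partial>lborel) = (\<integral>x. f x \<partial>lborel)"
proof -
  have "(\<integral>x. f x \<partial>lborel) = (\<integral>x. f x \<partial>distr lborel borel ((+) a))"
    by (simp add: lborel_distr_plus)
  also have "\<dots> = (\<integral>x. f (a + x) \<partial>lborel)"
    by (rule integral_distr) auto
  finally show ?thesis by (simp add: add.commute)
qed

lemma lborel_integral_similarity:
  fixes f :: "'a::euclidean_space \<Rightarrow> real" and T :: "'a \<Rightarrow> 'a"
  assumes T: "orthogonal_transformation T" and c: "c > 0" and [measurable]: "f \<in> borel_measurable borel"
  shows "(\<integral>y. f y \<partial>lborel) = c ^ DIM('a) * (\<integral>z. f (c *\<^sub>R T z) \<partial>lborel)"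
proof -
  have contT: "continuous_on UNIV T"
    using orthogonal_transformation_linear[OF T]
    by (simp add: linear_continuous_on linear_conv_bounded_linear)
  have [measurable]: "T \<in> borel_measurable borel"
    using contT by (rule borel_measurable_continuous_onI)
  have "(\<integral>y. f y \<partial>lborel) = (\<integral>y. f y \<partial>density (distr lborel borel (\<lambda>x. 0 + c *\<^sub>R x)) (\<lambda>_. \<bar>c\<bar>^DIM('a)))"
    using c by (subst lborel_affine[of c 0]) auto
  also have "\<dots> = c ^ DIM('a) * (\<integral>y. f (c *\<^sub>R y) \<partial>lborel)"
    using c by (subst integral_density) (auto simp: integral_distr)
  also have "(\<integral>y. f (c *\<^sub>R y) \<partial>lborel) = (\<integral>y. f (c *\<^sub>R y) \<partial>distr lborel borel T)"
    by (simp add: lborel_distr_orthogonal[OF T])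
  also have "\<dots> = (\<integral>z. f (c *\<^sub>R T z) \<partial>lborel)"
    by (subst integral_distr) auto
  finally show ?thesis .
qed

lemma lborel_integral_orthogonal:
  fixes f :: "'a::euclidean_space \<Rightarrow> real" and T :: "'a \<Rightarrow> 'a"
  assumes "orthogonal_transformation T" and "f \<in> borel_measurable borel"
  shows "(\<integral>z. f (T z) \<partial>lborel) = (\<integral>y. f y \<partial>lborel)"
  using lborel_integral_similarity[OF assms(1) _ assms(2), of 1] by simp

section \<open>Integrability of the singular kernels\<close>

lemma dyadic_bracket:
  fixes r :: real
  assumes "0 < r"
  obtains k :: int where "2 powr k \<le> r" "r < 2 powr (k + 1)"
proof -
  have "2 powr \<lfloor>log 2 r\<rfloor> \<le> 2 powr log 2 r" by (simp add: powr_mono)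
  moreover have "2 powr log 2 r < 2 powr (\<lfloor>log 2 r\<rfloor> + 1)"
    by (intro powr_less_mono) linarith+
  ultimately show ?thesis using that[of "\<lfloor>log 2 r\<rfloor>"] assms by simp
qed

text \<open>Dyadic shells: the sums over small and over large shells are geometric with ratios
  \<open>2 powr (s - 2)\<close> and \<open>2 powr (- s)\<close>, so \<open>s < 2\<close> is used at
  the origin and \<open>0 < s\<close> at infinity.\<close>

lemma integrable_min_kernel:
  fixes s :: real
  assumes s: "0 < s" "s < 2"
  shows "integrable lborel (\<lambda>y::'a::euclidean_space. min 1 ((norm y)\<^sup>2) / norm y powr (DIM('a) + s))"
proof -
  define d where "d = real DIM('a)"
  define \<omega> where "\<omega> = unit_ball_vol d"
  have \<omega>: "0 \<le> \<omega>" by (simp add: \<omega>_def d_def)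
  have d: "d \<ge> 1" using DIM_positive[where 'a='a] unfolding d_def by linarith
  define f where "f = (\<lambda>y::'a. min 1 ((norm y)\<^sup>2) / norm y powr (d + s))"
  have fm[measurable]: "f \<in> borel_measurable borel" unfolding f_def by measurable
  \<comment> \<open>\<open>a k\<close> bounds the integrand on the shell from
    \<open>2 powr (- k - 1)\<close> to \<open>2 powr (- k)\<close>, and \<open>b k\<close> on the
    shell from \<open>2 powr k\<close> to \<open>2 powr (k + 1)\<close>. Each shell is enlarged to
    the ball \<open>A k\<close> or \<open>B k\<close>, whose volume is explicit.\<close>
  define a where "a = (\<lambda>k::nat. 2 powr (d + s) * 2 powr (real k * (d + s - 2)))"
  define b where "b = (\<lambda>k::nat. 2 powr (- real k * (d + s)))"
  define A where "A = (\<lambda>k::nat. cball (0::'a) (2 powr (- real k)))"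
  define B where "B = (\<lambda>k::nat. cball (0::'a) (2 powr (real k + 1)))"
  have [measurable]: "A k \<in> sets borel" "B k \<in> sets borel" for k by (auto simp: A_def B_def)
  have eA: "ennreal (a k) * emeasure lborel (A k) = ennreal (2 powr (d + s) * \<omega> * (2 powr (s - 2)) ^ k)" for k
  proof -
    have "ennreal (a k) * emeasure lborel (A k) = ennreal (a k * (\<omega> * (2 powr (- real k)) ^ DIM('a)))"
      by (simp add: A_def emeasure_cball \<omega>_def d_def ennreal_mult a_def)
    also have "a k * (\<omega> * (2 powr (- real k)) ^ DIM('a)) = 2 powr (d + s) * \<omega> * (2 powr (s - 2)) ^ k"
      by (simp add: a_def d_def powr_powr flip: powr_realpow powr_add)
         (simp add: algebra_simps flip: powr_add)
    finally show ?thesis .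
  qed
  have eB: "ennreal (b k) * emeasure lborel (B k) = ennreal (2 powr d * \<omega> * (2 powr (- s)) ^ k)" for k
  proof -
    have "ennreal (b k) * emeasure lborel (B k) = ennreal (b k * (\<omega> * (2 powr (real k + 1)) ^ DIM('a)))"
      by (simp add: B_def emeasure_cball \<omega>_def d_def ennreal_mult b_def)
    also have "b k * (\<omega> * (2 powr (real k + 1)) ^ DIM('a)) = 2 powr d * \<omega> * (2 powr (- s)) ^ k"
      by (simp add: b_def d_def powr_powr flip: powr_realpow powr_add)
         (simp add: algebra_simps flip: powr_add)
    finally show ?thesis .
  qed
  have le: "ennreal (f y) \<le> (\<Sum>k. ennreal (a k) * indicator (A k) y) + (\<Sum>k. ennreal (b k) * indicator (B k) y)"
    (is "_ \<le> ?S + ?T") for y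
  proof (cases "y = 0")
    case True then show ?thesis by (simp add: f_def)
  next
    case False
    then have r: "0 < norm y" by simp
    obtain k :: int where k: "2 powr k \<le> norm y" "norm y < 2 powr (k + 1)" using dyadic_bracket[OF r] by blast
    show ?thesis
    proof (cases "k < 0")
      case True
      define m where "m = nat (- k - 1)"
      have km: "real_of_int k = - real m - 1" using True by (simp add: m_def)
      have "f y \<le> (norm y)\<^sup>2 / norm y powr (d + s)"
        unfolding f_def by (intro divide_right_mono) auto
      also have "\<dots> \<le> (2 powr (- real m))\<^sup>2 / (2 powr (- real m - 1)) powr (d + s)"
        using k d s km by (intro frac_le power_mono powr_mono2) (auto simp: less_imp_le)
      also have "\<dots> = a m"
        by (simp add: a_def powr_powr power2_eq_square flip: powr_add powr_diff) (simp add: algebra_simps)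
      finally have "f y \<le> a m" .
      moreover have "y \<in> A m" using k km by (simp add: A_def)
      ultimately have "ennreal (f y) \<le> ennreal (a m) * indicator (A m) y" by (simp add: ennreal_leI)
      also have "\<dots> \<le> ?S" using sum_le_suminf[of "\<lambda>k. ennreal (a k) * indicator (A k) y" "{m}"] by (simp del: sum_mult_indicator)
      finally show ?thesis by (metis add_increasing2 zero_le)
    next
      case False
      define m where "m = nat k"
      have km: "real_of_int k = real m" using False by (simp add: m_def)
      have "f y \<le> 1 / norm y powr (d + s)"
        unfolding f_def by (intro divide_right_mono) auto
      also have "\<dots> \<le> 1 / (2 powr real m) powr (d + s)"
        using k d s km by (intro frac_le powr_mono2) auto
      also have "\<dots> = b m"
        by (simp add: b_def powr_powr powr_minus_divide)
      finally have "f y \<le> b m" .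
      moreover have "y \<in> B m" using k km by (simp add: B_def)
      ultimately have "ennreal (f y) \<le> ennreal (b m) * indicator (B m) y" by (simp add: ennreal_leI)
      also have "\<dots> \<le> ?T" using sum_le_suminf[of "\<lambda>k. ennreal (b k) * indicator (B k) y" "{m}"] by (simp del: sum_mult_indicator)
      finally show ?thesis by (metis add_increasing zero_le)
    qed
  qed
  have "(\<integral>\<^sup>+y. ennreal (f y) \<partial>lborel) \<le>
      (\<integral>\<^sup>+y. (\<Sum>k. ennreal (a k) * indicator (A k) y) + (\<Sum>k. ennreal (b k) * indicator (B k) y) \<partial>lborel)"
    by (intro nn_integral_mono le)
  also have "\<dots> = (\<Sum>k. ennreal (a k) * emeasure lborel (A k)) + (\<Sum>k. ennreal (b k) * emeasure lborel (B k))"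
    by (subst nn_integral_add) (auto simp: nn_integral_suminf nn_integral_cmult_indicator)
  also have "\<dots> = (\<Sum>k. ennreal (2 powr (d + s) * \<omega> * (2 powr (s - 2)) ^ k)) + (\<Sum>k. ennreal (2 powr d * \<omega> * (2 powr (- s)) ^ k))"
    by (simp only: eA eB)
  also have "\<dots> < \<infinity>"
  proof -
    have "summable (\<lambda>k. 2 powr (d + s) * \<omega> * (2 powr (s - 2)) ^ k)"
      using s powr_less_mono[of "s - 2" 0 2] by (intro summable_mult summable_geometric) auto
    then have 1: "(\<Sum>k. ennreal (2 powr (d + s) * \<omega> * (2 powr (s - 2)) ^ k)) \<noteq> top"
      using \<omega> by (intro ennreal_suminf_neq_top) auto
    have "summable (\<lambda>k. 2 powr d * \<omega> * (2 powr (- s)) ^ k)"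
      using s powr_less_mono[of "- s" 0 2] by (intro summable_mult summable_geometric) auto
    then have 2: "(\<Sum>k. ennreal (2 powr d * \<omega> * (2 powr (- s)) ^ k)) \<noteq> top"
      using \<omega> by (intro ennreal_suminf_neq_top) auto
    show ?thesis using 1 2 by (simp add: less_top)
  qed
  finally have fin: "(\<integral>\<^sup>+y. ennreal (f y) \<partial>lborel) < \<infinity>" .
  have "integrable lborel f"
    using fin by (intro integrableI_nonneg) (auto simp: f_def)
  then show ?thesis by (simp add: f_def d_def)
qed

section \<open>Symbols of the operators\<close>

definition levy_kernel :: "real \<Rightarrow> real^'n^'n \<Rightarrow> real^'n \<Rightarrow> real" where
  "levy_kernel \<sigma> A y = (y \<bullet> (A *v y)) / norm y powr (real CARD('n) + \<sigma> + 2)"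

lemma inner_matrix_expand: "y \<bullet> (A *v y) = (\<Sum>i\<in>UNIV. \<Sum>j\<in>UNIV. A $ i $ j * (y $ i * y $ j))"
  for y :: "real^'n"
  by (simp add: inner_vec_def matrix_vector_mult_def sum_distrib_left mult_ac)

lemma borel_measurable_matrix_form [measurable]: "(\<lambda>y::real^'n. y \<bullet> (A *v y)) \<in> borel_measurable borel"
  unfolding inner_matrix_expand by measurable

lemma borel_measurable_levy_kernel [measurable]: "levy_kernel \<sigma> A \<in> borel_measurable borel"
  unfolding levy_kernel_def by measurable

lemma levy_kernel_bound:
  fixes A :: "real^'n^'n"
  obtains c where "0 \<le> c" "\<And>y. \<bar>levy_kernel \<sigma> A y\<bar> \<le> c / norm y powr (real CARD('n) + \<sigma>)"
proof
  define c where "c = onorm ((*v) A)"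
  show "0 \<le> c" unfolding c_def by (simp add: onorm_pos_le matrix_vector_mul_bounded_linear)
  fix y :: "real^'n"
  show "\<bar>levy_kernel \<sigma> A y\<bar> \<le> c / norm y powr (real CARD('n) + \<sigma>)"
  proof (cases "y = 0")
    case False
    have "\<bar>y \<bullet> (A *v y)\<bar> \<le> norm y * norm (A *v y)" by (rule Cauchy_Schwarz_ineq2)
    also have "\<dots> \<le> norm y * (c * norm y)"
      unfolding c_def by (intro mult_left_mono onorm matrix_vector_mul_bounded_linear) auto
    finally have "\<bar>y \<bullet> (A *v y)\<bar> \<le> c * (norm y)\<^sup>2" by (simp add: power2_eq_square mult_ac)
    then have "\<bar>levy_kernel \<sigma> A y\<bar> \<le> c * (norm y)\<^sup>2 / norm y powr (real CARD('n) + \<sigma> + 2)"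
      unfolding levy_kernel_def by (simp add: abs_mult divide_right_mono)
    also have "\<dots> = c / norm y powr (real CARD('n) + \<sigma>)"
      using False by (simp add: powr_add powr_numeral)
    finally show ?thesis .
  qed (simp add: levy_kernel_def)
qed

lemma integrable_levy_kernel:
  fixes f :: "real^'n \<Rightarrow> real"
  assumes "0 < \<sigma>" "\<sigma> < 2" and f: "f \<in> borel_measurable lebesgue"
    and M: "\<And>y. \<bar>f y\<bar> \<le> M * min 1 ((norm y)\<^sup>2)"
  shows "integrable lebesgue (\<lambda>y. f y * levy_kernel \<sigma> A y)"
proof -
  obtain c where c: "0 \<le> c" "\<And>y. \<bar>levy_kernel \<sigma> A y\<bar> \<le> c / norm y powr (real CARD('n) + \<sigma>)"
    using levy_kernel_bound[of \<sigma> A] by blast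
  have "integrable lborel (\<lambda>y::real^'n. min 1 ((norm y)\<^sup>2) / norm y powr (real CARD('n) + \<sigma>))"
    using integrable_min_kernel[OF assms(1,2), where 'a="real^'n"] by simp
  then have i: "integrable lebesgue (\<lambda>y::real^'n. (M * c) * (min 1 ((norm y)\<^sup>2) / norm y powr (real CARD('n) + \<sigma>)))"
    by (intro integrable_mult_right) (auto simp: integrable_completion)
  have [measurable]: "levy_kernel \<sigma> A \<in> borel_measurable lebesgue"
    by (rule borel_measurable_if_I measurable_completion) simp
  show ?thesis
  proof (rule Bochner_Integration.integrable_bound[OF i])
    show "(\<lambda>y. f y * levy_kernel \<sigma> A y) \<in> borel_measurable lebesgue" using f by measurable
    show "AE y in lebesgue. norm (f y * levy_kernel \<sigma> A y) \<le> norm (M * c * (min 1 ((norm y)\<^sup>2) / norm y powr (real CARD('n) + \<sigma>)))"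
    proof (rule AE_I2)
      fix y :: "real^'n"
      have "norm (f y * levy_kernel \<sigma> A y) \<le> (M * min 1 ((norm y)\<^sup>2)) * (c / norm y powr (real CARD('n) + \<sigma>))"
        unfolding real_norm_def abs_mult using M[of y] c(2)[of y] by (intro mult_mono) auto
      also have "\<dots> = M * c * (min 1 ((norm y)\<^sup>2) / norm y powr (real CARD('n) + \<sigma>))" by simp
      finally show "norm (f y * levy_kernel \<sigma> A y) \<le> norm (M * c * (min 1 ((norm y)\<^sup>2) / norm y powr (real CARD('n) + \<sigma>)))"
        unfolding real_norm_def by linarith
    qed
  qed
qed

lemma one_minus_cos_bound:
  fixes x :: real
  shows "2 * (1 - cos x) \<le> 4 * min 1 (x\<^sup>2)" "0 \<le> 1 - cos x"
proof -
  show "0 \<le> 1 - cos x" by simp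
  have c: "cos x = 1 - 2 * (sin (x / 2))\<^sup>2" using cos_double_sin[of "x/2"] by simp
  have "(sin (x / 2))\<^sup>2 \<le> (x / 2)\<^sup>2"
    using abs_sin_x_le_abs_x[of "x / 2"] by (simp only: abs_le_square_iff)
  also have "(x / 2)\<^sup>2 = x\<^sup>2 / 4" by (simp add: power_divide)
  finally have "2 * (1 - cos x) \<le> 4 * x\<^sup>2" using zero_le_power2[of x] unfolding c by (simp add: field_simps) (use zero_le_power2[of x] in linarith)
  moreover have "2 * (1 - cos x) \<le> 4" using cos_ge_minus_one[of x] by (simp only: right_diff_distrib)
  ultimately show "2 * (1 - cos x) \<le> 4 * min 1 (x\<^sup>2)" by (simp add: min_def)
qed

lemma one_minus_cos_inner_bound:
  fixes \<xi> y :: "'a::euclidean_space"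
  shows "\<bar>2 * (1 - cos (\<xi> \<bullet> y))\<bar> \<le> (4 * (1 + (norm \<xi>)\<^sup>2)) * min 1 ((norm y)\<^sup>2)"
proof -
  have "(\<xi> \<bullet> y)\<^sup>2 \<le> (norm \<xi>)\<^sup>2 * (norm y)\<^sup>2"
    using Cauchy_Schwarz_ineq[of \<xi> y] by (simp add: power2_norm_eq_inner)
  also have "\<dots> \<le> (1 + (norm \<xi>)\<^sup>2) * (norm y)\<^sup>2" by (intro mult_right_mono) auto
  finally have "min 1 ((\<xi> \<bullet> y)\<^sup>2) \<le> min (1 + (norm \<xi>)\<^sup>2) ((1 + (norm \<xi>)\<^sup>2) * (norm y)\<^sup>2)"
    by (intro min.mono) auto
  also have "\<dots> = (1 + (norm \<xi>)\<^sup>2) * min 1 ((norm y)\<^sup>2)"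
    by (subst min_mult_distrib_left) auto
  finally have "min 1 ((\<xi> \<bullet> y)\<^sup>2) \<le> (1 + (norm \<xi>)\<^sup>2) * min 1 ((norm y)\<^sup>2)" .
  then have "4 * min 1 ((\<xi> \<bullet> y)\<^sup>2) \<le> (4 * (1 + (norm \<xi>)\<^sup>2)) * min 1 ((norm y)\<^sup>2)"
    by (simp only: mult.assoc mult_le_cancel_left_pos zero_less_numeral)
  moreover have "\<bar>2 * (1 - cos (\<xi> \<bullet> y))\<bar> = 2 * (1 - cos (\<xi> \<bullet> y))" by simp
  ultimately show ?thesis using one_minus_cos_bound(1)[of "\<xi> \<bullet> y"] by linarith
qed

text \<open>The second difference of a plane wave of frequency \<xi> is
  \<open>- 2 * (1 - cos (\<xi> \<bullet> y))\<close> times the wave, hence this is minus the Fourier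
  multiplier of the operator with kernel \<open>levy_kernel \<sigma> A\<close>.\<close>

definition levy_symbol :: "real \<Rightarrow> real^'n^'n \<Rightarrow> real^'n \<Rightarrow> real" where
  "levy_symbol \<sigma> A \<xi> = (\<integral>y. 2 * (1 - cos (\<xi> \<bullet> y)) * levy_kernel \<sigma> A y \<partial>lborel)"

lemma integrable_levy_symbol:
  assumes "0 < \<sigma>" "\<sigma> < 2"
  shows "integrable lborel (\<lambda>y. 2 * (1 - cos (\<xi> \<bullet> y)) * levy_kernel \<sigma> A y)"
  using integrable_levy_kernel[OF assms _ one_minus_cos_inner_bound, of \<xi> A]
  by (simp add: integrable_completion measurable_completion)

section \<open>Second moments of symmetric weights\<close>

definition reflect :: "'n \<Rightarrow> real^'n \<Rightarrow> real^'n" where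
  "reflect i z = (\<chi> j. if j = i then - z $ j else z $ j)"

definition swap_coords :: "'n \<Rightarrow> 'n \<Rightarrow> real^'n \<Rightarrow> real^'n" where
  "swap_coords i k z = (\<chi> j. z $ (Transposition.transpose i k j))"

lemma orthogonal_reflect: "orthogonal_transformation (reflect i)"
  unfolding orthogonal_transformation_def
  by (auto simp: reflect_def linear_iff vec_eq_iff inner_vec_def intro!: sum.cong)

lemma orthogonal_swap_coords: "orthogonal_transformation (swap_coords i k :: real^'n \<Rightarrow> real^'n)"
  unfolding orthogonal_transformation_def
proof (intro conjI allI)
  show "linear (swap_coords i k)" by (auto simp: swap_coords_def linear_iff vec_eq_iff)
  fix v w :: "real^'n"
  show "swap_coords i k v \<bullet> swap_coords i k w = v \<bullet> w"
    unfolding swap_coords_def inner_vec_def vec_lambda_beta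
    by (rule sum.reindex_bij_betw[where h="Transposition.transpose i k" and g="\<lambda>j. v $ j \<bullet> w $ j"])
       (simp add: bij_swap_iff)
qed

lemma axis_inner: "axis i 1 \<bullet> z = z $ i" for z :: "real^'n"
  by (simp add: inner_axis' )

text \<open>Reflecting the i-th coordinate changes the sign of \<open>z $ i * z $ j\<close> and
  leaves \<open>q\<close> alone, so the off-diagonal moments vanish and only the diagonal of
  \<open>A\<close> is seen.\<close>

lemma integral_quadratic_form:
  fixes q :: "real^'n \<Rightarrow> real"
  assumes [measurable]: "q \<in> borel_measurable borel"
    and int: "\<And>i j. integrable lborel (\<lambda>z. q z * (z $ i * z $ j))"
    and refl: "\<And>i z. q (reflect i z) = q z"
  shows "integrable lborel (\<lambda>z. q z * (z \<bullet> (A *v z)))"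
    "(\<integral>z. q z * (z \<bullet> (A *v z)) \<partial>lborel) = (\<Sum>i\<in>UNIV. A $ i $ i * (\<integral>z. q z * (z $ i * z $ i) \<partial>lborel))"
proof -
  define \<nu> where "\<nu> = (\<lambda>i j. \<integral>z. q z * (z $ i * z $ j) \<partial>lborel)"
  have off: "\<nu> i j = 0" if "i \<noteq> j" for i j
  proof -
    have "\<nu> i j = (\<integral>z. q (reflect i z) * (reflect i z $ i * reflect i z $ j) \<partial>lborel)"
      unfolding \<nu>_def by (rule lborel_integral_orthogonal[OF orthogonal_reflect, symmetric]) simp
    also have "\<dots> = (\<integral>z. - (q z * (z $ i * z $ j)) \<partial>lborel)"
      using that by (simp add: refl) (simp add: reflect_def)
    also have "\<dots> = - \<nu> i j" by (simp add: \<nu>_def)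
    finally show ?thesis by simp
  qed
  have eq: "q z * (z \<bullet> (A *v z)) = (\<Sum>i\<in>UNIV. \<Sum>j\<in>UNIV. A $ i $ j * (q z * (z $ i * z $ j)))" for z
    by (simp add: inner_matrix_expand sum_distrib_left mult_ac)
  show "integrable lborel (\<lambda>z. q z * (z \<bullet> (A *v z)))"
    unfolding eq using int by simp
  have "(\<integral>z. q z * (z \<bullet> (A *v z)) \<partial>lborel) = (\<Sum>i\<in>UNIV. \<Sum>j\<in>UNIV. A $ i $ j * \<nu> i j)"
    unfolding eq using int by (simp add: \<nu>_def)
  also have "\<dots> = (\<Sum>i\<in>UNIV. A $ i $ i * \<nu> i i)"
  proof (rule sum.cong[OF HOL.refl])
    fix i
    have "(\<Sum>j\<in>UNIV. A $ i $ j * \<nu> i j) = (\<Sum>j\<in>UNIV. if j = i then A $ i $ j * \<nu> i j else 0)"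
      using off by (intro sum.cong) auto
    then show "(\<Sum>j\<in>UNIV. A $ i $ j * \<nu> i j) = A $ i $ i * \<nu> i i" by simp
  qed
  finally show "(\<integral>z. q z * (z \<bullet> (A *v z)) \<partial>lborel) = (\<Sum>i\<in>UNIV. A $ i $ i * (\<integral>z. q z * (z $ i * z $ i) \<partial>lborel))"
    by (simp add: \<nu>_def)
qed

lemma integral_square_swap:
  fixes q :: "real^'n \<Rightarrow> real"
  assumes [measurable]: "q \<in> borel_measurable borel" and q: "\<And>z. q (swap_coords j k z) = q z"
  shows "(\<integral>z. q z * (z $ j * z $ j) \<partial>lborel) = (\<integral>z. q z * (z $ k * z $ k) \<partial>lborel)"
proof -
  have "(\<integral>z. q z * (z $ j * z $ j) \<partial>lborel) = (\<integral>z. q (swap_coords j k z) * (swap_coords j k z $ j * swap_coords j k z $ j) \<partial>lborel)"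
    by (rule lborel_integral_orthogonal[OF orthogonal_swap_coords, symmetric]) simp
  also have "\<dots> = (\<integral>z. q z * (z $ k * z $ k) \<partial>lborel)" by (simp add: q) (simp add: swap_coords_def)
  finally show ?thesis .
qed

text \<open>A rotation and a dilation reduce \<xi> to a unit coordinate vector. The weight
  \<open>q\<close> of that frequency is invariant under all reflections of coordinates and under
  exchanges of the coordinates other than \<open>i0\<close>, so its moment matrix is diagonal with
  entry \<open>b1\<close> at \<open>i0\<close> and \<open>b2\<close> elsewhere; homogeneity supplies
  the power of \<open>norm \<xi>\<close>.\<close>

proposition levy_symbol_formula:
  assumes \<sigma>: "0 < \<sigma>" "\<sigma> < 2"
  obtains b1 b2 where "0 < b1" "0 < b2"
    "\<And>A (\<xi>::real^'n). levy_symbol \<sigma> A \<xi> =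
        norm \<xi> powr (\<sigma> - 2) * ((b1 - b2) * (\<xi> \<bullet> (A *v \<xi>)) + b2 * trace A * (norm \<xi>)\<^sup>2)"
proof -
  obtain i0 :: 'n where True by simp
  define p where "p = real CARD('n) + \<sigma> + 2"
  define q where "q = (\<lambda>z::real^'n. 2 * (1 - cos (z $ i0)) / norm z powr p)"
  have qm[measurable]: "q \<in> borel_measurable borel" unfolding q_def by measurable
  define \<nu> where "\<nu> = (\<lambda>i j. \<integral>z. q z * (z $ i * z $ j) \<partial>lborel)"
  have int: "integrable lborel (\<lambda>z. q z * (z $ i * z $ j))" for i j
  proof -
    \<comment> \<open>A matrix unit: it turns the mixed moment into the integral that defines a
      symbol, which is integrable for every matrix, symmetric or not.\<close>
    define E :: "real^'n^'n" where "E = (\<chi> k l. if k = i \<and> l = j then 1 else 0)"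
    have "z \<bullet> (E *v z) = z $ i * z $ j" for z
    proof -
      have "(if k = i \<and> l = j then 1 else 0) * (z $ k * z $ l) = (if l = j then if k = i then z $ k * z $ l else 0 else 0)" for k l
        by auto
      then show ?thesis unfolding inner_matrix_expand E_def by (simp add: sum.delta)
    qed
    then have "(\<lambda>z. q z * (z $ i * z $ j)) = (\<lambda>z. 2 * (1 - cos (axis i0 1 \<bullet> z)) * levy_kernel \<sigma> E z)"
      by (simp add: fun_eq_iff q_def levy_kernel_def p_def axis_inner)
    then show ?thesis using integrable_levy_symbol[OF \<sigma>] by simp
  qed
  have refl_q: "q (reflect i z) = q z" for i z
  proof -
    have "norm (reflect i z) = norm z" by (rule orthogonal_transformation_norm[OF orthogonal_reflect])
    then show ?thesis by (simp add: q_def) (simp add: reflect_def)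
  qed
  have sw: "\<nu> j j = \<nu> k k" if "j \<noteq> i0" "k \<noteq> i0" for j k
  proof -
    have q: "q (swap_coords j k z) = q z" for z
    proof -
      have "norm (swap_coords j k z) = norm z" by (rule orthogonal_transformation_norm[OF orthogonal_swap_coords])
      moreover have "swap_coords j k z $ i0 = z $ i0" using that by (simp add: swap_coords_def)
      ultimately show ?thesis by (simp add: q_def)
    qed
    show ?thesis unfolding \<nu>_def by (rule integral_square_swap[OF qm q])
  qed
  have pos: "0 < \<nu> j j" for j
  proof -
    have nn: "0 \<le> q z * (z $ j * z $ j)" for z by (simp add: q_def)
    have "\<nu> j j \<noteq> 0"
    proof
      assume "\<nu> j j = 0"
      then have "AE z in lborel. q z * (z $ j * z $ j) = 0"
        using integral_nonneg_eq_0_iff_AE[OF int[of j j]] nn by (simp add: \<nu>_def)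
      \<comment> \<open>On the open unit cube all coordinates are positive and
        \<open>cos (z $ i0) < 1\<close>, so the integrand does not vanish there; a zero integral
        would make the cube negligible.\<close>
      then have "AE z in lborel. (z::real^'n) \<notin> box 0 (\<chi> i. 1)"
      proof eventually_elim
        case (elim z)
        show ?case
        proof
        assume "z \<in> box 0 (\<chi> i. 1)"
        with elim have z: "q z * (z $ j * z $ j) = 0" "z \<in> box 0 (\<chi> i. 1)" by auto
        then have zz: "0 < z $ i" "z $ i < 1" for i by (auto simp: mem_box_cart)
        have "cos (z $ i0) < cos 0" using zz[of i0] pi_gt3 by (intro cos_monotone_0_pi) auto
        moreover have "norm z \<noteq> 0" using zz[of j] by auto
        ultimately show False using z(1) zz[of j] by (simp add: q_def)
        qed
      qed
      then have "emeasure lborel (box (0::real^'n) (\<chi> i. 1)) = 0"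
        by (subst (asm) AE_iff_measurable[OF _ refl]) (auto simp: Collect_neg_eq)
      then have "negligible (box (0::real^'n) (\<chi> i. 1))" by (simp add: negligible_iff_emeasure0)
      moreover have "(\<chi> i. 1 / 2) \<in> box (0::real^'n) (\<chi> i. 1)" by (simp add: mem_box_cart)
      ultimately show False using open_not_negligible[OF open_box] by blast
    qed
    moreover have "0 \<le> \<nu> j j" unfolding \<nu>_def using nn by (intro integral_nonneg_AE) auto
    ultimately show ?thesis by simp
  qed
  define b1 where "b1 = \<nu> i0 i0"
  \<comment> \<open>In dimension one there is no second index and the default \<open>1\<close> is
    harmless: the trace of \<open>A\<close> is its only entry, so \<open>b2\<close> cancels from the
    formula.\<close>
  define b2 where "b2 = (if \<exists>j. j \<noteq> i0 then \<nu> (SOME j. j \<noteq> i0) (SOME j. j \<noteq> i0) else 1)"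
  have b2: "\<nu> j j = b2" if "j \<noteq> i0" for j
  proof -
    have "(SOME j. j \<noteq> i0) \<noteq> i0" using that by (rule someI)
    then show ?thesis using sw[OF that] that by (auto simp: b2_def)
  qed
  have form: "(\<integral>z. q z * (z \<bullet> (A *v z)) \<partial>lborel) = (b1 - b2) * A $ i0 $ i0 + b2 * trace A" for A :: "real^'n^'n"
  proof -
    have "(\<integral>z. q z * (z \<bullet> (A *v z)) \<partial>lborel) = (\<Sum>i\<in>UNIV. A $ i $ i * \<nu> i i)"
      unfolding \<nu>_def by (rule integral_quadratic_form(2)[OF qm int refl_q])
    also have "\<dots> = (\<Sum>i\<in>UNIV. (if i = i0 then (b1 - b2) * A $ i $ i else 0) + b2 * A $ i $ i)"
      using b2 by (intro sum.cong) (auto simp: b1_def algebra_simps)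
    also have "\<dots> = (b1 - b2) * A $ i0 $ i0 + b2 * trace A"
      by (simp add: sum.distrib trace_def sum_distrib_left)
    finally show ?thesis .
  qed
  have "levy_symbol \<sigma> A \<xi> =
        norm \<xi> powr (\<sigma> - 2) * ((b1 - b2) * (\<xi> \<bullet> (A *v \<xi>)) + b2 * trace A * (norm \<xi>)\<^sup>2)" for A and \<xi> :: "real^'n"
  proof (cases "\<xi> = 0")
    case True then show ?thesis by (simp add: levy_symbol_def)
  next
    case False
    define r where "r = norm \<xi>"
    have r: "r > 0" using False by (simp add: r_def)
    obtain T :: "real^'n \<Rightarrow> real^'n" where T: "orthogonal_transformation T" "T (axis i0 1) = (1 / r) *\<^sub>R \<xi>"
      using orthogonal_transformation_exists_1[of "axis i0 1 :: real^'n" "(1 / r) *\<^sub>R \<xi>"] r r_def by auto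
    have lin: "linear T" using T(1) by (rule orthogonal_transformation_linear)
    define Q where "Q = matrix T"
    have TQ: "T z = Q *v z" for z unfolding Q_def using lin by (simp add: matrix_works)
    have Q: "orthogonal_matrix Q" using T(1) by (simp add: Q_def orthogonal_transformation_matrix)
    define A' where "A' = transpose Q ** A ** Q"
    have A': "T z \<bullet> (A *v T w) = z \<bullet> (A' *v w)" for z w
    proof -
      have "z \<bullet> (A' *v w) = z \<bullet> (transpose Q *v (A *v (Q *v w)))"
        by (simp only: A'_def matrix_vector_mul_assoc[symmetric])
      also have "\<dots> = ((A *v (Q *v w)) v* Q) \<bullet> z"
        by (simp only: transpose_matrix_vector inner_commute)
      also have "\<dots> = (A *v (Q *v w)) \<bullet> (Q *v z)" by (rule dot_lmul_matrix)
      finally show ?thesis by (simp only: TQ inner_commute)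
    qed
    have trA': "trace A' = trace A"
    proof -
      have "trace A' = trace (Q ** (transpose Q ** A))" unfolding A'_def by (rule trace_mul_sym)
      also have "\<dots> = trace A" using Q by (simp add: matrix_mul_assoc orthogonal_matrix_def)
      finally show ?thesis .
    qed
    have A'0: "A' $ i0 $ i0 = (\<xi> \<bullet> (A *v \<xi>)) / r\<^sup>2"
    proof -
      have "A' $ i0 $ i0 = axis i0 1 \<bullet> (A' *v axis i0 1)"
        by (simp add: axis_inner matrix_vector_mult_basis column_def)
      also have "\<dots> = ((1 / r) *\<^sub>R \<xi>) \<bullet> (A *v ((1 / r) *\<^sub>R \<xi>))" by (simp add: A'[symmetric] T(2))
      also have "\<dots> = (\<xi> \<bullet> (A *v \<xi>)) / r\<^sup>2"
        by (simp add: matrix_vector_mult_scaleR power2_eq_square)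
      finally show ?thesis .
    qed
    have "levy_symbol \<sigma> A \<xi> = (1 / r) ^ CARD('n) * (\<integral>z. 2 * (1 - cos (\<xi> \<bullet> ((1 / r) *\<^sub>R T z))) * levy_kernel \<sigma> A ((1 / r) *\<^sub>R T z) \<partial>lborel)"
      unfolding levy_symbol_def using r
      by (subst lborel_integral_similarity[OF T(1), of "1 / r"]) auto
    also have "(\<lambda>z. 2 * (1 - cos (\<xi> \<bullet> ((1 / r) *\<^sub>R T z))) * levy_kernel \<sigma> A ((1 / r) *\<^sub>R T z)) = 
               (\<lambda>z. (r powr p / r\<^sup>2) * (q z * (z \<bullet> (A' *v z))))"
    proof
      fix z :: "real^'n"
      have "\<xi> \<bullet> ((1 / r) *\<^sub>R T z) = T (axis i0 1) \<bullet> T z" by (simp add: T(2))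
      also have "\<dots> = z $ i0" using T(1) by (simp add: orthogonal_transformation_def axis_inner)
      finally have 1: "\<xi> \<bullet> ((1 / r) *\<^sub>R T z) = z $ i0" .
      have 2: "norm ((1 / r) *\<^sub>R T z) powr p = norm z powr p / r powr p"
        using r T(1) by (simp add: orthogonal_transformation_norm powr_divide)
      have 3: "((1 / r) *\<^sub>R T z) \<bullet> (A *v ((1 / r) *\<^sub>R T z)) = (z \<bullet> (A' *v z)) / r\<^sup>2"
        by (simp add: A' matrix_vector_mult_scaleR power2_eq_square)
      show "2 * (1 - cos (\<xi> \<bullet> ((1 / r) *\<^sub>R T z))) * levy_kernel \<sigma> A ((1 / r) *\<^sub>R T z) = (r powr p / r\<^sup>2) * (q z * (z \<bullet> (A' *v z)))"
        unfolding levy_kernel_def 1 3 p_def[symmetric] 2 q_def by simp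
    qed
    also have "(\<integral>z. (r powr p / r\<^sup>2) * (q z * (z \<bullet> (A' *v z))) \<partial>lborel) = (r powr p / r\<^sup>2) * ((b1 - b2) * A' $ i0 $ i0 + b2 * trace A')"
      by (simp add: form)
    \<comment> \<open>With \<open>n\<close> the dimension, the powers of \<open>r\<close> add up to
      \<open>- n + p - 2\<close>, which is \<sigma>.\<close>
    also have "(1 / r) ^ CARD('n) * ((r powr p / r\<^sup>2) * ((b1 - b2) * A' $ i0 $ i0 + b2 * trace A')) =
        r powr (\<sigma> - 2) * ((b1 - b2) * (\<xi> \<bullet> (A *v \<xi>)) + b2 * trace A * r\<^sup>2)"
    proof -
      have e: "(1 / r) ^ CARD('n) * (r powr p / r\<^sup>2) = r powr (\<sigma> - 2) * r\<^sup>2"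
        using r by (simp add: p_def powr_add powr_diff powr_realpow power_one_over field_simps)
      have "(1 / r) ^ CARD('n) * ((r powr p / r\<^sup>2) * ((b1 - b2) * A' $ i0 $ i0 + b2 * trace A')) =
        ((1 / r) ^ CARD('n) * (r powr p / r\<^sup>2)) * ((b1 - b2) * A' $ i0 $ i0 + b2 * trace A')" by simp
      also have "\<dots> = r powr (\<sigma> - 2) * ((b1 - b2) * (r\<^sup>2 * A' $ i0 $ i0) + b2 * trace A' * r\<^sup>2)"
        unfolding e by (simp add: algebra_simps)
      also have "r\<^sup>2 * A' $ i0 $ i0 = \<xi> \<bullet> (A *v \<xi>)" using r by (simp add: A'0)
      finally show ?thesis by (simp add: trA')
    qed
    finally show ?thesis by (simp add: r_def)
  qed
  moreover have "0 < b1" "0 < b2" using pos by (auto simp: b1_def b2_def)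
  ultimately show ?thesis using that by blast
qed

section \<open>Positive semidefinite forms as sums of squares\<close>

lemma symmetric_form_commute:
  fixes A :: "real^'n^'n"
  assumes "transpose A = A"
  shows "x \<bullet> (A *v y) = y \<bullet> (A *v x)"
  by (metis assms dot_lmul_matrix inner_commute transpose_matrix_vector)

lemma psd_Cauchy_Schwarz:
  fixes A :: "real^'n^'n"
  assumes A: "psd A" "transpose A = A"
  shows "(x \<bullet> (A *v y))\<^sup>2 \<le> (x \<bullet> (A *v x)) * (y \<bullet> (A *v y))"
proof -
  define a b c where "a = x \<bullet> (A *v x)" and "b = x \<bullet> (A *v y)" and "c = y \<bullet> (A *v y)"
  have q: "0 \<le> a + 2 * t * b + t\<^sup>2 * c" for t
  proof -
    have "0 \<le> (x + t *\<^sub>R y) \<bullet> (A *v (x + t *\<^sub>R y))" using A(1) by (simp add: psd_def)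
    also have "\<dots> = a + 2 * t * b + t\<^sup>2 * c"
      using symmetric_form_commute[OF A(2), of y x]
      by (simp add: a_def b_def c_def matrix_vector_right_distrib matrix_vector_mult_scaleR inner_add_left
          inner_add_right power2_eq_square algebra_simps)
    finally show ?thesis .
  qed
  have "b\<^sup>2 \<le> a * c"
  proof (cases "c = 0")
    case True
    have "b = 0"
    proof (rule ccontr)
      assume "b \<noteq> 0"
      then show False using q[of "- (a + 1) / (2 * b)"] True by (simp add: field_simps)
    qed
    then show ?thesis using True by simp
  next
    case False
    then have "c > 0" using A(1) by (simp add: psd_def c_def order.not_eq_order_implies_strict)
    then show ?thesis using q[of "- b / c"] by (simp add: power2_eq_square field_simps)
  qed
  then show ?thesis by (simp add: a_def b_def c_def)
qed

lemma axis_form: "axis i 1 \<bullet> (A *v axis j 1) = A $ i $ j" for A :: "real^'n^'n"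
  by (simp add: axis_inner matrix_vector_mult_basis column_def)

text \<open>Cholesky elimination: subtracting the square given by \<open>w\<close>, the normalized
  i-th column, clears the i-th diagonal entry. Cauchy-Schwarz for the form keeps the remainder
  positive semidefinite and keeps vanishing diagonal entries zero, so the number of nonzero ones
  drops.\<close>

lemma psd_sum_of_squares:
  fixes A :: "real^'n^'n"
  assumes "psd A" "transpose A = A"
  shows "\<exists>ws. \<forall>\<xi>. \<xi> \<bullet> (A *v \<xi>) = (\<Sum>w\<leftarrow>ws. (w \<bullet> \<xi>)\<^sup>2)"
  using assms
proof (induction "card {i. A $ i $ i \<noteq> 0}" arbitrary: A rule: less_induct)
  case less
  have sym: "A $ j $ i = A $ i $ j" for i j
    using less.prems(2) by (metis transpose_def vec_lambda_beta)
  show ?case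
  proof (cases "\<exists>i. A $ i $ i \<noteq> 0")
    case False
    have "A $ i $ j = 0" for i j
      using psd_Cauchy_Schwarz[OF less.prems, of "axis i 1" "axis j 1"] False by (simp add: axis_form)
    then have "A = 0" by (simp add: vec_eq_iff)
    then show ?thesis by (intro exI[of _ "[]"]) simp
  next
    case True
    then obtain i where i: "A $ i $ i \<noteq> 0" by blast
    define a where "a = A $ i $ i"
    have a: "a > 0"
      using less.prems(1) i unfolding psd_def a_def by (metis axis_form order.not_eq_order_implies_strict)
    define w where "w = (1 / sqrt a) *\<^sub>R (A *v axis i 1)"
    have wj: "w $ j = A $ j $ i / sqrt a" for j
      by (simp add: w_def matrix_vector_mult_basis column_def)
    define A' :: "real^'n^'n" where "A' = (\<chi> j k. A $ j $ k - w $ j * w $ k)"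
    have form: "\<xi> \<bullet> (A' *v \<xi>) = \<xi> \<bullet> (A *v \<xi>) - (w \<bullet> \<xi>)\<^sup>2" for \<xi>
    proof -
      have "(w \<bullet> \<xi>)\<^sup>2 = (\<Sum>i\<in>UNIV. \<Sum>j\<in>UNIV. w $ i * w $ j * (\<xi> $ i * \<xi> $ j))"
        by (simp add: power2_eq_square inner_vec_def sum_product mult_ac)
      then show ?thesis
        unfolding inner_matrix_expand by (simp add: A'_def left_diff_distrib sum_subtractf)
    qed
    have psd': "psd A'"
      unfolding psd_def
    proof
      fix z
      have "(w \<bullet> z)\<^sup>2 = (z \<bullet> (A *v axis i 1))\<^sup>2 / a"
        using a by (simp add: w_def inner_commute power_divide)
      also have "\<dots> \<le> (z \<bullet> (A *v z)) * a / a"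
        using psd_Cauchy_Schwarz[OF less.prems, of z "axis i 1"] a
        by (intro divide_right_mono) (auto simp: axis_form a_def)
      finally show "0 \<le> z \<bullet> (A' *v z)" using a by (simp add: form)
    qed
    have sym': "transpose A' = A'" by (simp add: transpose_def A'_def vec_eq_iff sym mult.commute)
    have "A' $ i $ i = 0" using a by (simp add: A'_def wj a_def[symmetric] flip: power2_eq_square)
    moreover have "A' $ j $ j = 0" if "A $ j $ j = 0" for j
    proof -
      have "A $ j $ i = 0"
        using psd_Cauchy_Schwarz[OF less.prems, of "axis j 1" "axis i 1"] that by (simp add: axis_form)
      then show ?thesis using that by (simp add: A'_def wj)
    qed
    ultimately have "{j. A' $ j $ j \<noteq> 0} \<subset> {j. A $ j $ j \<noteq> 0}" using i by blast
    then have "card {j. A' $ j $ j \<noteq> 0} < card {j. A $ j $ j \<noteq> 0}" by (intro psubset_card_mono) auto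
    from less.hyps[OF this psd' sym'] obtain ws where "\<forall>\<xi>. \<xi> \<bullet> (A' *v \<xi>) = (\<Sum>w\<leftarrow>ws. (w \<bullet> \<xi>)\<^sup>2)" by blast
    then show ?thesis using form by (intro exI[of _ "w # ws"]) (simp add: algebra_simps)
  qed
qed

lemma trace_sum_of_squares:
  fixes A :: "real^'n^'n"
  assumes "\<And>\<xi>. \<xi> \<bullet> (A *v \<xi>) = (\<Sum>w\<leftarrow>ws. (w \<bullet> \<xi>)\<^sup>2)"
  shows "trace A = (\<Sum>w\<leftarrow>ws. (norm w)\<^sup>2)"
proof -
  have "trace A = (\<Sum>i\<in>UNIV. \<Sum>w\<leftarrow>ws. (w $ i)\<^sup>2)"
    using assms[of "axis i 1" for i] unfolding trace_def axis_form by (simp add: inner_axis)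
  also have "\<dots> = (\<Sum>w\<leftarrow>ws. \<Sum>i\<in>UNIV. (w $ i)\<^sup>2)"
    by (induction ws) (simp_all add: sum.distrib)
  also have "\<dots> = (\<Sum>w\<leftarrow>ws. (norm w)\<^sup>2)"
    by (simp add: norm_vec_def L2_set_def sum_nonneg)
  finally show ?thesis .
qed

lemma mat_form: "z \<bullet> (mat c *v z) = c * (norm z)\<^sup>2" for z :: "real^'n"
proof -
  have "mat c *v z = c *\<^sub>R z"
    by (simp add: vec_eq_iff matrix_vector_mult_def mat_def if_distrib[of "\<lambda>x. x * _"] cong: if_cong)
  then show ?thesis by (simp add: power2_norm_eq_inner)
qed

lemma psd_form_le_trace:
  fixes A :: "real^'n^'n"
  assumes "psd A" "transpose A = A"
  shows "z \<bullet> (A *v z) \<le> trace A * (norm z)\<^sup>2" "0 \<le> trace A"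
proof -
  obtain ws where ws: "\<And>\<xi>. \<xi> \<bullet> (A *v \<xi>) = (\<Sum>w\<leftarrow>ws. (w \<bullet> \<xi>)\<^sup>2)" using psd_sum_of_squares[OF assms] by blast
  have "(\<Sum>w\<leftarrow>ws. (w \<bullet> z)\<^sup>2) \<le> (\<Sum>w\<leftarrow>ws. (norm w)\<^sup>2 * (norm z)\<^sup>2)"
    using Cauchy_Schwarz_ineq[of _ z] by (intro sum_list_mono) (simp add: power2_norm_eq_inner)
  then show "z \<bullet> (A *v z) \<le> trace A * (norm z)\<^sup>2"
    by (simp add: ws trace_sum_of_squares[OF ws] sum_list_mult_const)
  show "0 \<le> trace A" by (auto simp: trace_sum_of_squares[OF ws] intro!: sum_list_nonneg)
qed

lemma admissible_trace_le:
  fixes A :: "real^'n^'n"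
  assumes "A \<in> admissible lam \<Lambda>"
  shows "trace A \<le> real CARD('n) * \<Lambda>"
proof -
  have "A $ i $ i \<le> \<Lambda>" for i
  proof -
    have "0 \<le> axis i 1 \<bullet> ((mat \<Lambda> - A) *v axis i 1)" using assms by (simp add: admissible_def psd_def)
    then show ?thesis by (simp add: axis_form mat_def)
  qed
  then have "trace A \<le> (\<Sum>i\<in>(UNIV::'n set). \<Lambda>)" unfolding trace_def by (intro sum_mono)
  then show ?thesis by simp
qed

text \<open>After multiplication by \<open>norm \<xi> powr (2 - \<sigma>)\<close> the squares become
  second derivatives in the directions \<open>ws\<close>, and \<open>b\<close> becomes the
  coefficient of the Laplacian; this is the form in which ellipticity is used.\<close>

definition symbol_decomposition :: "real \<Rightarrow> real^'n^'n \<Rightarrow> real \<Rightarrow> (real^'n) list \<Rightarrow> bool" where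
  "symbol_decomposition \<sigma> A b ws \<longleftrightarrow>
     (\<forall>\<xi>. levy_symbol \<sigma> A \<xi> = norm \<xi> powr (\<sigma> - 2) * ((\<Sum>w\<leftarrow>ws. (w \<bullet> \<xi>)\<^sup>2) + b * (norm \<xi>)\<^sup>2))"

text \<open>The coefficient \<open>b\<close> comes from \<open>lam \<le> trace A\<close>, and what
  remains of the form is still positive semidefinite. If \<open>b1 < b2\<close>, the term with
  \<open>b1 - b2\<close> is negative, but the form of \<open>A\<close> is at most
  \<open>trace A\<close> times the squared norm, so \<open>b1 * trace A\<close> is left.\<close>

proposition levy_symbol_sum_of_squares:
  assumes \<sigma>: "0 < \<sigma>" "\<sigma> < 2" and lam: "0 < lam"
  obtains b C where "0 < b" "0 \<le> C"
    "\<And>A :: real^'n^'n. A \<in> admissible lam \<Lambda> \<Longrightarrow>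
       \<exists>ws. (\<Sum>w\<leftarrow>ws. (norm w)\<^sup>2) \<le> C \<and> symbol_decomposition \<sigma> A b ws"
proof -
  obtain b1 b2 where b: "0 < b1" "0 < b2" and
    sym: "\<And>A (\<xi>::real^'n). levy_symbol \<sigma> A \<xi> =
        norm \<xi> powr (\<sigma> - 2) * ((b1 - b2) * (\<xi> \<bullet> (A *v \<xi>)) + b2 * trace A * (norm \<xi>)\<^sup>2)"
    using levy_symbol_formula[OF \<sigma>] by blast
  define n where "n = real CARD('n)"
  have n: "n > 0" by (simp add: n_def)
  define C where "C = \<bar>b1 * n * \<Lambda>\<bar> + \<bar>n * b2 * n * \<Lambda>\<bar>"
  show ?thesis
  proof (rule that[of "min b1 b2 * lam" C])
    show "0 < min b1 b2 * lam" "0 \<le> C" using b lam by (auto simp: C_def)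
    fix A :: "real^'n^'n" assume A: "A \<in> admissible lam \<Lambda>"
    then have A': "psd A" "transpose A = A" "lam \<le> trace A" by (auto simp: admissible_def)
    have tr: "trace A \<le> n * \<Lambda>" using admissible_trace_le[OF A] by (simp add: n_def)
    have tr0: "0 < trace A" using A'(3) lam by simp
    \<comment> \<open>\<open>R\<close> represents the quadratic form of the symbol after the amount
      \<open>min b1 b2 * lam\<close> of the identity has been taken out.\<close>
    define e where "e = b2 * trace A - min b1 b2 * lam"
    define R where "R = (b1 - b2) *\<^sub>R A + mat e"
    have form: "z \<bullet> (R *v z) = (b1 - b2) * (z \<bullet> (A *v z)) + e * (norm z)\<^sup>2" for z
      by (simp add: R_def matrix_vector_mult_add_rdistrib inner_add_right mat_form scaleR_matrix_vector_assoc[symmetric])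
    have "psd R" unfolding psd_def
    proof
      fix z
      show "0 \<le> z \<bullet> (R *v z)"
      proof (cases "b2 \<le> b1")
        case True
        then have "b2 * lam \<le> b2 * trace A" using A'(3) b by simp
        then have "0 \<le> e" using True by (simp add: e_def min_def)
        moreover have "0 \<le> (b1 - b2) * (z \<bullet> (A *v z))" using True A'(1) by (simp add: psd_def)
        ultimately show ?thesis unfolding form by simp
      next
        case False
        have "(b1 - b2) * (trace A * (norm z)\<^sup>2) \<le> (b1 - b2) * (z \<bullet> (A *v z))"
          using False psd_form_le_trace(1)[OF A'(1,2), of z] by (intro mult_left_mono_neg) auto
        moreover have "b1 * lam \<le> b1 * trace A" using A'(3) b by simp
        then have "0 \<le> (b1 * trace A - b1 * lam) * (norm z)\<^sup>2" by simp
        ultimately show ?thesis using False unfolding form e_def by (simp add: algebra_simps min_def)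
      qed
    qed
    moreover have "transpose R = R"
    proof -
      have "A $ j $ i = A $ i $ j" for i j using A'(2) by (metis transpose_def vec_lambda_beta)
      then show ?thesis by (simp add: R_def transpose_def vec_eq_iff mat_def)
    qed
    ultimately obtain ws where ws: "\<And>\<xi>. \<xi> \<bullet> (R *v \<xi>) = (\<Sum>w\<leftarrow>ws. (w \<bullet> \<xi>)\<^sup>2)"
      using psd_sum_of_squares by blast
    have "(\<Sum>w\<leftarrow>ws. (norm w)\<^sup>2) = trace R" using trace_sum_of_squares[OF ws] by simp
    also have "\<dots> = (b1 - b2) * trace A + n * e"
      by (simp add: R_def trace_def mat_def sum.distrib sum_distrib_left n_def)
    also have "\<dots> \<le> b1 * trace A + n * (b2 * trace A)"
      using b lam n tr0 by (simp add: e_def algebra_simps)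
    also have "\<dots> \<le> b1 * (n * \<Lambda>) + n * (b2 * (n * \<Lambda>))"
      using b n tr by (intro add_mono mult_left_mono) auto
    also have "\<dots> \<le> C" unfolding C_def by (simp add: mult.assoc abs_ge_self add_mono)
    finally have 1: "(\<Sum>w\<leftarrow>ws. (norm w)\<^sup>2) \<le> C" .
    have "symbol_decomposition \<sigma> A (min b1 b2 * lam) ws"
      unfolding symbol_decomposition_def sym ws[symmetric] form e_def by (simp add: algebra_simps)
    with 1 show "\<exists>ws. (\<Sum>w\<leftarrow>ws. (norm w)\<^sup>2) \<le> C \<and> symbol_decomposition \<sigma> A (min b1 b2 * lam) ws"
      by blast
  qed
qed

text \<open>The identity matrix turns \<open>levy_kernel\<close> into the kernel of the fractional
  Laplacian of order \<alpha>, so its symbol is a special case of the general formula.\<close>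

proposition fractional_symbol:
  assumes \<alpha>: "0 < \<alpha>" "\<alpha> < 2"
  obtains c where "0 < c"
    "\<And>\<xi> :: real^'n. integrable lborel (\<lambda>z. 2 * (1 - cos (\<xi> \<bullet> z)) / norm z powr (real CARD('n) + \<alpha>))"
    "\<And>\<xi> :: real^'n. (\<integral>z. 2 * (1 - cos (\<xi> \<bullet> z)) / norm z powr (real CARD('n) + \<alpha>) \<partial>lborel) = c * norm \<xi> powr \<alpha>"
proof -
  obtain b1 b2 where b: "0 < b1" "0 < b2" and
    sym: "\<And>A (\<xi>::real^'n). levy_symbol \<alpha> A \<xi> =
        norm \<xi> powr (\<alpha> - 2) * ((b1 - b2) * (\<xi> \<bullet> (A *v \<xi>)) + b2 * trace A * (norm \<xi>)\<^sup>2)"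
    using levy_symbol_formula[OF \<alpha>] by blast
  have eq: "levy_kernel \<alpha> (mat 1) z = 1 / norm z powr (real CARD('n) + \<alpha>)" for z :: "real^'n"
  proof (cases "z = 0")
    case False
    then show ?thesis unfolding levy_kernel_def mat_form by (simp add: powr_add powr_numeral)
  qed (simp add: levy_kernel_def)
  have tr: "trace (mat 1 :: real^'n^'n) = real CARD('n)" by (simp add: trace_def mat_def)
  define c where "c = b1 + (real CARD('n) - 1) * b2"
  have "CARD('n) \<ge> 1" by (simp add: Suc_leI)
  then have c: "c > 0" unfolding c_def using b by (intro add_pos_nonneg) auto
  show ?thesis
  proof (rule that[OF c])
    fix \<xi> :: "real^'n"
    show "integrable lborel (\<lambda>z. 2 * (1 - cos (\<xi> \<bullet> z)) / norm z powr (real CARD('n) + \<alpha>))"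
      using integrable_levy_symbol[OF \<alpha>, of \<xi> "mat 1"] by (simp add: eq)
    have "(\<integral>z. 2 * (1 - cos (\<xi> \<bullet> z)) / norm z powr (real CARD('n) + \<alpha>) \<partial>lborel) = levy_symbol \<alpha> (mat 1) \<xi>"
      by (simp add: levy_symbol_def eq)
    also have "\<dots> = c * (norm \<xi> powr (\<alpha> - 2) * (norm \<xi>)\<^sup>2)"
      unfolding sym mat_form tr c_def by (simp add: algebra_simps)
    also have "norm \<xi> powr (\<alpha> - 2) * (norm \<xi>)\<^sup>2 = norm \<xi> powr \<alpha>"
      by (cases "\<xi> = 0") (auto simp: powr_diff powr_numeral)
    finally show "(\<integral>z. 2 * (1 - cos (\<xi> \<bullet> z)) / norm z powr (real CARD('n) + \<alpha>) \<partial>lborel) = c * norm \<xi> powr \<alpha>" .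
  qed
qed

section \<open>A discrete Monge-Ampere problem\<close>

text \<open>Otherwise all coordinate widths of \<open>S\<close> are below \<open>h / 3\<close>,
  \<open>S\<close> fits into a cube of side \<open>h / 3\<close>, and the volume of that cube is at
  most a third of \<open>h ^ CARD('n)\<close>.\<close>

lemma wide_in_some_direction:
  fixes S :: "(real^'n) set"
  assumes S: "S \<in> sets borel" "bounded S" "S \<noteq> {}" and h: "0 < h"
    and vol: "h ^ CARD('n) / 2 \<le> measure lborel S"
  obtains j p q where "p \<in> S" "q \<in> S" "h / 3 \<le> q $ j - p $ j"
proof (rule ccontr)
  assume neg: "\<not> thesis"
  note intro = that
  have small: "q $ j - p $ j < h / 3" if "p \<in> S" "q \<in> S" for p q j
    using neg intro[OF that, of j] by linarith
  obtain B where B: "\<And>p. p \<in> S \<Longrightarrow> norm p \<le> B" using S(2) by (auto simp: bounded_iff)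
  have bdd: "bdd_below ((\<lambda>p. p $ j) ` S)" for j
  proof (rule bdd_belowI2)
    fix p assume "p \<in> S"
    then show "- B \<le> p $ j" using B[of p] component_le_norm_cart[of p j] by simp
  qed
  define a :: "real^'n" where "a = (\<chi> j. INF p\<in>S. p $ j)"
  have lo: "a $ j \<le> p $ j" if "p \<in> S" for p j
    using cINF_lower[OF bdd that] by (simp add: a_def)
  have hi: "q $ j \<le> a $ j + h / 3" if "q \<in> S" for q j
  proof -
    have "q $ j - h / 3 \<le> (INF p\<in>S. p $ j)"
    proof (rule cINF_greatest[OF S(3)])
      fix p assume "p \<in> S"
      from small[OF this that, of j] show "q $ j - h / 3 \<le> p $ j" by simp
    qed
    then show ?thesis by (simp add: a_def)
  qed
  define b where "b = a + (\<chi> j. h / 3)"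
  have "S \<subseteq> cbox a b" using lo hi by (auto simp: mem_box_cart b_def)
  then have "measure lborel S \<le> measure lborel (cbox a b)"
    by (intro measure_mono_fmeasurable) (auto simp: S(1) fmeasurable_def emeasure_lborel_cbox_finite[unfolded infinity_ennreal_def])
  also have "\<dots> = (h / 3) ^ CARD('n)"
  proof -
    have "a \<in> cbox a b" using h by (simp add: mem_box_cart b_def)
    then show ?thesis by (subst content_cbox_cart) (auto simp: b_def)
  qed
  also have "\<dots> \<le> h ^ CARD('n) / 3"
  proof -
    have "(3::real) ^ 1 \<le> 3 ^ CARD('n)" by (intro power_increasing) (auto simp: Suc_leI)
    then show ?thesis using h unfolding power_divide by (intro divide_left_mono) auto
  qed
  also have "\<dots> < h ^ CARD('n) / 2" using h by simp
  finally show False using vol by simp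
qed

text \<open>Semi-discrete optimal transport. Every node receives a set of approximate subgradients
  of volume at least \<open>h ^ n / 2\<close>; such a set is wide in some coordinate direction, and
  two subgradients that differ by \<open>h / 3\<close> there force curvature. An almost minimizer of
  the dual functional is enough, so no minimizer has to be constructed.\<close>

proposition discrete_monge_ampere:
  fixes X :: "(real^'n) set"
  assumes X: "finite X" and h: "0 < h" and \<rho>: "0 < \<rho>"
    and vol: "real (card X) * h ^ CARD('n) \<le> (2 * \<rho>) ^ CARD('n)"
  obtains u :: "real^'n \<Rightarrow> real" where "u 0 = 0"
    "\<And>x y. \<bar>u x - u y\<bar> \<le> real CARD('n) * \<rho> * norm (x - y)"
    "\<And>x z. 0 \<le> second_diff u x z"
    "\<And>x. x \<in> X \<Longrightarrow> \<exists>j. h\<^sup>2 / 6 \<le> second_diff u x (h *\<^sub>R axis j 1)"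
proof (cases "X = {}")
  case True
  show ?thesis by (rule that[of "\<lambda>_. 0"]) (use \<rho> True in \<open>auto simp: second_diff_def\<close>)
next
  case False
  define n where "n = CARD('n)"
  have n: "n > 0" by (simp add: n_def)
  define N where "N = real (card X)"
  have N: "N > 0" using X False by (simp add: N_def card_gt_0_iff)
  \<comment> \<open>Mass balance: the cube of slopes with side \<open>2 * r\<close> has exactly the
    volume \<open>N * h ^ n\<close> that the nodes demand.\<close>
  define r where "r = h * root n N / 2"
  have r: "r > 0" using h N n by (simp add: r_def)
  have rn: "(2 * r) ^ n = N * h ^ n"
    using n N by (simp add: r_def power_mult_distrib real_root_pow_pos2)
  have r\<rho>: "r \<le> \<rho>"
  proof -
    have "(2 * r) ^ n \<le> (2 * \<rho>) ^ n" using vol by (simp only: rn) (simp only: n_def N_def)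
    then show ?thesis using n \<rho> power_le_imp_le_base[of "2 * r" "n - 1" "2 * \<rho>"] by simp
  qed
  define D :: "(real^'n) set" where "D = cbox (\<chi> i. - r) (\<chi> i. r)"
  have D: "compact D" "D \<in> sets borel" by (auto simp: D_def)
  have D0: "0 \<in> D" using r by (simp add: D_def mem_box_cart)
  have mD: "measure lborel D = N * h ^ n"
    using r D0 unfolding D_def by (subst content_cbox_cart) (auto simp: n_def[symmetric] rn[symmetric])
  have Dc: "\<bar>p $ i\<bar> \<le> r" if "p \<in> D" for p i using that by (auto simp: D_def mem_box_cart abs_le_iff) (metis minus_le_iff)
  define U where "U = (\<lambda>(\<psi>::real^'n \<Rightarrow> real) p. Max ((\<lambda>x. p \<bullet> x - \<psi> x) ` X))"
  have U_ge: "p \<bullet> x - \<psi> x \<le> U \<psi> p" if "x \<in> X" for p x \<psi>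
    unfolding U_def using X that by (intro Max_ge) auto
  have U_le: "U \<psi> p \<le> c" if "\<And>x. x \<in> X \<Longrightarrow> p \<bullet> x - \<psi> x \<le> c" for p c \<psi>
    unfolding U_def using X False that by (subst Max_le_iff) auto
  have U_cont: "continuous_on UNIV (U \<psi>)" for \<psi>
  proof -
    have "continuous_on UNIV (\<lambda>p. Max ((\<lambda>x. p \<bullet> x - \<psi> x) ` Y))" if "finite Y" "Y \<noteq> {}" for Y :: "(real^'n) set"
      using that
    proof (induction Y rule: finite_ne_induct)
      case (insert x F)
      then show ?case by (simp add: continuous_on_max continuous_intros)
    qed (auto intro!: continuous_intros)
    then show ?thesis using X False unfolding U_def by blast
  qed
  have U_int: "integrable lborel (\<lambda>p. indicator D p * U \<psi> p)" for \<psi>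
    using borel_integrable_compact[OF D(1), of "U \<psi>"] U_cont continuous_on_subset[OF U_cont, of D] by simp
  \<comment> \<open>The Kantorovich dual functional, with \<open>U \<psi>\<close> the Legendre
    transform of \<psi>; stationarity would mean that every node receives slopes of volume
    \<open>h ^ n\<close>.\<close>
  define G where "G = (\<lambda>\<psi>. (\<integral>p. indicator D p * U \<psi> p \<partial>lborel) + h ^ n * (\<Sum>x\<in>X. \<psi> x))"
  have D_int: "integrable lborel (indicator D :: _ \<Rightarrow> real)"
    using D by (intro integrable_real_indicator) (auto simp: D_def emeasure_lborel_cbox_finite[unfolded infinity_ennreal_def])
  have lin_int: "integrable lborel (\<lambda>p. indicator D p * (p \<bullet> x))" for x
    using borel_integrable_compact[OF D(1), of "\<lambda>p. p \<bullet> x"] by (simp add: continuous_intros)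
  \<comment> \<open>From summing \<open>p \<bullet> x - \<psi> x \<le> U \<psi> p\<close> over the
    nodes and integrating over \<open>D\<close>: by mass balance the terms with \<psi> cancel, which
    leaves a bound independent of \<psi>.\<close>
  define G0 where "G0 = (\<Sum>x\<in>X. \<integral>p. indicator D p * (p \<bullet> x) \<partial>lborel) / N"
  have G_bdd: "G0 \<le> G \<psi>" for \<psi>
  proof -
    have "(\<Sum>x\<in>X. (\<integral>p. indicator D p * (p \<bullet> x) \<partial>lborel) - N * h ^ n * \<psi> x) =
        (\<Sum>x\<in>X. (\<integral>p. indicator D p * (p \<bullet> x) - \<psi> x * indicator D p \<partial>lborel))"
      using lin_int D_int by (simp add: mD mult_ac D)
    also have "\<dots> \<le> (\<Sum>x\<in>X. (\<integral>p. indicator D p * U \<psi> p \<partial>lborel))"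
    proof (intro sum_mono integral_mono)
      fix x p assume "x \<in> X"
      then show "indicator D p * (p \<bullet> x) - \<psi> x * indicator D p \<le> indicator D p * U \<psi> p"
        using U_ge[of x p \<psi>] by (auto simp: indicator_def)
    qed (use lin_int D_int U_int in auto)
    also have "\<dots> = N * (\<integral>p. indicator D p * U \<psi> p \<partial>lborel)" by (simp add: N_def)
    finally have le: "(\<Sum>x\<in>X. (\<integral>p. indicator D p * (p \<bullet> x) \<partial>lborel) - N * h ^ n * \<psi> x) \<le> N * (\<integral>p. indicator D p * U \<psi> p \<partial>lborel)" .
    have "N * G0 - N * (h ^ n * (\<Sum>x\<in>X. \<psi> x)) \<le> N * (\<integral>p. indicator D p * U \<psi> p \<partial>lborel)"
    proof -
      have "N * G0 = (\<Sum>x\<in>X. \<integral>p. indicator D p * (p \<bullet> x) \<partial>lborel)" using N by (simp add: G0_def)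
      then show ?thesis using le by (simp only: sum_subtractf mult.assoc flip: sum_distrib_left)
    qed
    then have "N * G0 \<le> N * G \<psi>" by (simp add: G_def algebra_simps)
    then show ?thesis using N by simp
  qed
  \<comment> \<open>Chosen so that the gain \<open>h * (h / 3)\<close> less two errors
    \<open>t\<close> is \<open>h\<^sup>2 / 6\<close>. The slack \<tau> below costs half of the
    volume of a cell.\<close>
  define t where "t = h\<^sup>2 / 12"
  have t: "t > 0" using h by (simp add: t_def)
  define \<tau> where "\<tau> = t * h ^ n / 2"
  have \<tau>: "\<tau> > 0" using t h by (simp add: \<tau>_def)
  have bddG: "bdd_below (range G)" using G_bdd by (rule bdd_belowI2)
  obtain \<psi> where "G \<psi> < Inf (range G) + \<tau>"
    using cInf_lessD[of "range G" "Inf (range G) + \<tau>"] \<tau> by auto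
  then have min: "G \<psi> - \<tau> \<le> G \<psi>'" for \<psi>'
    using cInf_lower[OF _ bddG, of "G \<psi>'"] by fastforce
  \<comment> \<open>Slopes in \<open>D\<close> that are subgradients at \<open>x\<close> up to the
    error \<open>t\<close>; this enlargement of the cells is what lets an almost minimizer
    suffice.\<close>
  define C where "C = (\<lambda>x. {p \<in> D. U \<psi> p \<le> p \<bullet> x - \<psi> x + t})"
  have C_closed: "closed (C x)" for x
  proof -
    have "closed {p. U \<psi> p \<le> p \<bullet> x - \<psi> x + t}"
      by (intro closed_Collect_le U_cont continuous_intros)
    then show ?thesis unfolding C_def Collect_conj_eq using D(1) by (simp add: closed_Int compact_imp_closed)
  qed
  have C_bd: "bounded (C x)" for x
    using D(1) by (auto simp: C_def intro: bounded_subset compact_imp_bounded)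
  have C_int: "integrable lborel (indicator (C x) :: _ \<Rightarrow> real)" for x
    using C_closed C_bd by (intro integrable_real_indicator) (auto simp: emeasure_bounded_finite[unfolded infinity_ennreal_def])
  have C_vol: "h ^ n / 2 \<le> measure lborel (C x)" if x: "x \<in> X" for x
  proof -
    \<comment> \<open>Lowering \<psi> at one node by \<open>t\<close> raises \<open>U \<psi>\<close>
      by at most \<open>t\<close>, and only on \<open>C x\<close>, while the sum over the nodes
      drops by \<open>t\<close>. Near minimality compares the two effects.\<close>
    define \<psi>' where "\<psi>' = \<psi>(x := \<psi> x - t)"
    have "(\<Sum>y\<in>X. \<psi>' y) = (\<Sum>y\<in>X. \<psi> y - (if y = x then t else 0))"
      by (intro sum.cong) (auto simp: \<psi>'_def)
    then have s: "(\<Sum>y\<in>X. \<psi>' y) = (\<Sum>y\<in>X. \<psi> y) - t" using x X by (simp add: sum_subtractf)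
    have le: "indicator D p * U \<psi>' p \<le> indicator D p * U \<psi> p + t * indicator (C x) p" for p
    proof -
      have "U \<psi>' p \<le> U \<psi> p + t * indicator (C x) p" if "p \<in> D"
      proof (rule U_le)
        fix y assume y: "y \<in> X"
        show "p \<bullet> y - \<psi>' y \<le> U \<psi> p + t * indicator (C x) p"
        proof (cases "y = x \<and> p \<in> C x")
          case True
          then show ?thesis using U_ge[OF y, of p \<psi>] by (simp add: \<psi>'_def)
        next
          case False
          then show ?thesis using U_ge[OF y, of p \<psi>] t that
            by (cases "y = x") (auto simp: \<psi>'_def C_def indicator_def)
        qed
      qed
      then show ?thesis using t by (auto simp: indicator_def)
    qed
    have "G \<psi> - \<tau> \<le> G \<psi>'" by (rule min)
    also have "G \<psi>' \<le> (\<integral>p. indicator D p * U \<psi> p + t * indicator (C x) p \<partial>lborel) + h ^ n * (\<Sum>x\<in>X. \<psi>' x)"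
      unfolding G_def using U_int C_int by (intro add_right_mono integral_mono le) auto
    also have "\<dots> = G \<psi> + t * measure lborel (C x) - t * h ^ n"
      using U_int C_int C_closed by (simp add: G_def s algebra_simps)
    finally have "t * (h ^ n / 2) \<le> t * measure lborel (C x)" by (simp add: \<tau>_def)
    then show ?thesis using t by simp
  qed
  have "bdd_below (U \<psi> ` D)"
    using compact_continuous_image[OF continuous_on_subset[OF U_cont] D(1)]
    by (auto intro!: bounded_imp_bdd_below compact_imp_bounded)
  then obtain m where m: "\<And>p. p \<in> D \<Longrightarrow> m \<le> U \<psi> p" by (auto simp: bdd_below_def)
  have inner_bd: "p \<bullet> z \<le> real n * r * norm z" if "p \<in> D" for p z
  proof -
    have "p \<bullet> z \<le> (\<Sum>i\<in>(UNIV::'n set). r * norm z)"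
      unfolding inner_vec_def
    proof (rule sum_mono)
      fix i
      have "p $ i * z $ i \<le> \<bar>p $ i\<bar> * \<bar>z $ i\<bar>" by (metis abs_ge_self abs_mult)
      also have "\<dots> \<le> r * norm z" using Dc[OF that] component_le_norm_cart[of z i] r by (intro mult_mono) auto
      finally show "p $ i \<bullet> z $ i \<le> r * norm z" by simp
    qed
    then show ?thesis by (simp add: n_def)
  qed
  \<comment> \<open>Legendre transform back, with slopes restricted to \<open>D\<close>: convex as a
    supremum of affine functions, and Lipschitz because \<open>D\<close> is bounded.\<close>
  define u where "u = (\<lambda>y. SUP p\<in>D. p \<bullet> y - U \<psi> p)"
  have u_bdd: "bdd_above ((\<lambda>p. p \<bullet> y - U \<psi> p) ` D)" for y
  proof (rule bdd_aboveI2)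
    fix p assume "p \<in> D"
    then show "p \<bullet> y - U \<psi> p \<le> real n * r * norm y - m" using m inner_bd[of p y] by (simp add: diff_mono)
  qed
  have u_ge: "p \<bullet> y - U \<psi> p \<le> u y" if "p \<in> D" for p y
    unfolding u_def using that u_bdd by (intro cSUP_upper) auto
  have u_le: "u y \<le> c" if "\<And>p. p \<in> D \<Longrightarrow> p \<bullet> y - U \<psi> p \<le> c" for y c
    unfolding u_def using that D0 by (intro cSUP_least) auto
  have lip1: "u x \<le> u y + real n * r * norm (x - y)" for x y
  proof (rule u_le)
    fix p assume p: "p \<in> D"
    have "p \<bullet> x - U \<psi> p = (p \<bullet> y - U \<psi> p) + p \<bullet> (x - y)" by (simp add: inner_diff_right)
    also have "\<dots> \<le> u y + real n * r * norm (x - y)" using u_ge[OF p] inner_bd[OF p] by (intro add_mono)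
    finally show "p \<bullet> x - U \<psi> p \<le> u y + real n * r * norm (x - y)" .
  qed
  have lip: "\<bar>u x - u y\<bar> \<le> real n * \<rho> * norm (x - y)" for x y
  proof -
    have "\<bar>u x - u y\<bar> \<le> real n * r * norm (x - y)"
      using lip1[of x y] lip1[of y x] by (simp add: abs_le_iff norm_minus_commute)
    also have "\<dots> \<le> real n * \<rho> * norm (x - y)" using r\<rho> by (intro mult_right_mono mult_left_mono) auto
    finally show ?thesis .
  qed
  have sd: "0 \<le> second_diff u x z" for x z
  proof -
    have "u x \<le> (u (x + z) + u (x - z)) / 2"
    proof (rule u_le)
      fix p assume p: "p \<in> D"
      have "p \<bullet> (x + z) - U \<psi> p + (p \<bullet> (x - z) - U \<psi> p) \<le> u (x + z) + u (x - z)"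
        using u_ge[OF p] by (intro add_mono)
      then show "p \<bullet> x - U \<psi> p \<le> (u (x + z) + u (x - z)) / 2" by (simp add: inner_add_right inner_diff_right)
    qed
    then show ?thesis by (simp add: second_diff_def)
  qed
  have node: "\<exists>j. h\<^sup>2 / 6 \<le> second_diff u x (h *\<^sub>R axis j 1)" if x: "x \<in> X" for x
  proof -
    have "C x \<noteq> {}" using C_vol[OF x] h by (metis half_gt_zero measure_empty not_less zero_less_power)
    then obtain j p q where pq: "p \<in> C x" "q \<in> C x" "h / 3 \<le> q $ j - p $ j"
      using wide_in_some_direction[OF _ C_bd _ h C_vol[OF x, unfolded n_def]] C_closed
      by (metis borel_closed)
    have ux: "u x \<le> \<psi> x"
    proof (rule u_le)
      fix p
      show "p \<bullet> x - U \<psi> p \<le> \<psi> x" using U_ge[OF x, of p \<psi>] by simp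
    qed
    \<comment> \<open>The elements of \<open>C x\<close> are subgradients of \<open>u\<close> at
      \<open>x\<close> up to \<open>t\<close>. Used with \<open>q\<close> forwards and with
      \<open>p\<close> backwards along the axis, they bound the second difference from
      below.\<close>
    have sub: "u x + p \<bullet> z - t \<le> u (x + z)" if "p \<in> C x" for p z
    proof -
      have "p \<in> D" using that by (simp add: C_def)
      from u_ge[OF this, of "x + z"] that ux show ?thesis by (simp add: C_def inner_add_right)
    qed
    define e where "e = h *\<^sub>R (axis j 1 :: real^'n)"
    have pe: "p \<bullet> e = h * p $ j" for p by (simp add: e_def inner_axis)
    have "h * (h / 3) \<le> h * (q $ j - p $ j)" using pq(3) h by (intro mult_left_mono) auto
    then have "h\<^sup>2 / 6 \<le> h * (q $ j - p $ j) - 2 * t" by (simp add: t_def power2_eq_square)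
    also have "\<dots> \<le> second_diff u x e"
      using sub[OF pq(2), of e] sub[OF pq(1), of "- e"] by (simp add: second_diff_def pe algebra_simps)
    finally show ?thesis unfolding e_def by blast
  qed
  show ?thesis
  proof (rule that[of "\<lambda>y. u y - u 0"])
    have "second_diff (\<lambda>y. u y - u 0) x z = second_diff u x z" for x z by (simp add: second_diff_def)
    then show "0 \<le> second_diff (\<lambda>y. u y - u 0) x z"
      "x \<in> X \<Longrightarrow> \<exists>j. h\<^sup>2 / 6 \<le> second_diff (\<lambda>y. u y - u 0) x (h *\<^sub>R axis j 1)" for x z
      using sd node by auto
  qed (use lip in \<open>auto simp: n_def\<close>)
qed

section \<open>Lattices and periodization\<close>

definition lattice_vec :: "real \<Rightarrow> ('n \<Rightarrow> int) \<Rightarrow> real^'n" where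
  "lattice_vec L k = (\<chi> j. L * real_of_int (k j))"

lemma lattice_vec_nth [simp]: "lattice_vec L k $ j = L * real_of_int (k j)"
  by (simp add: lattice_vec_def)

lemma lattice_vec_add: "lattice_vec L (\<lambda>j. k j + l j) = lattice_vec L k + lattice_vec L l"
  by (simp add: vec_eq_iff distrib_left)

lemma norm_lattice_vec_ge:
  assumes "0 < L" "lattice_vec L k \<noteq> 0"
  shows "L \<le> norm (lattice_vec L k)"
proof -
  obtain j where "k j \<noteq> 0" using assms(2) by (auto simp: vec_eq_iff)
  then have "1 \<le> \<bar>k j\<bar>" by linarith
  then have "1 \<le> \<bar>real_of_int (k j)\<bar>" by linarith
  then have "L * 1 \<le> L * \<bar>real_of_int (k j)\<bar>" using assms(1) by (intro mult_left_mono) auto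
  also have "\<dots> = \<bar>lattice_vec L k $ j\<bar>" using assms(1) by (simp add: abs_mult)
  also have "\<dots> \<le> norm (lattice_vec L k)" by (rule component_le_norm_cart)
  finally show ?thesis by simp
qed

lemma norm_le_card_mult:
  fixes x :: "real^'n"
  assumes "\<And>j. \<bar>x $ j\<bar> \<le> c"
  shows "norm x \<le> real CARD('n) * c"
proof -
  have "norm x \<le> (\<Sum>j\<in>UNIV. \<bar>x $ j\<bar>)" by (rule norm_le_l1_cart)
  also have "\<dots> \<le> (\<Sum>j\<in>(UNIV::'n set). c)" by (intro sum_mono assms)
  finally show ?thesis by simp
qed

lemma lattice_round:
  fixes x :: "real^'n"
  assumes "0 < L"
  obtains k where "norm (x - lattice_vec L k) \<le> real CARD('n) * (L / 2)"
proof
  show "norm (x - lattice_vec L (\<lambda>j. round (x $ j / L))) \<le> real CARD('n) * (L / 2)"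
  proof (rule norm_le_card_mult)
    fix j
    have "\<bar>of_int (round (x $ j / L)) - x $ j / L\<bar> \<le> 1 / 2" by (rule of_int_round_abs_le)
    then have "L * \<bar>of_int (round (x $ j / L)) - x $ j / L\<bar> \<le> L * (1 / 2)" using assms by (intro mult_left_mono) auto
    also have "L * \<bar>of_int (round (x $ j / L)) - x $ j / L\<bar> = \<bar>L * (of_int (round (x $ j / L)) - x $ j / L)\<bar>"
      using assms by (simp add: abs_mult)
    finally show "\<bar>(x - lattice_vec L (\<lambda>j. round (x $ j / L))) $ j\<bar> \<le> L / 2"
      using assms by (simp add: right_diff_distrib abs_minus_commute)
  qed
qed

text \<open>Supremum over the lattice translates of \<open>u\<close> minus a parabola. A supremum
  preserves lower bounds on second differences, so only the parabola costs convexity. Near the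
  origin the trivial translate wins, hence the curvature of \<open>u\<close> survives there.\<close>

proposition periodization:
  fixes u :: "real^'n \<Rightarrow> real"
  assumes L: "0 < L" and q: "0 < q" and u0: "u 0 = 0"
    and lip: "\<And>x y. \<bar>u x - u y\<bar> \<le> q * norm (x - y)" and conv: "\<And>x z. 0 \<le> second_diff u x z"
  obtains w where "\<And>x k. w (x + lattice_vec L k) = w x"
    "\<And>x. \<bar>w x\<bar> \<le> q * L * (real CARD('n))\<^sup>2"
    "\<And>x z. - (4 * q / L) * (norm z)\<^sup>2 \<le> second_diff w x z"
    "\<And>x z. norm x \<le> L / 4 \<Longrightarrow> second_diff u x z - (4 * q / L) * (norm z)\<^sup>2 \<le> second_diff w x z"
proof -
  define n where "n = real CARD('n)"
  have n: "n \<ge> 1" by (simp add: n_def Suc_leI)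
  \<comment> \<open>Balances two effects of a translation by a lattice vector \<open>v\<close> when
    \<open>norm x \<le> L / 4\<close>: the parabola loses at least
    \<open>\<kappa> * (L / 2) * norm v\<close>, and the Lipschitz bound lets \<open>u\<close> gain
    at most \<open>q * norm v\<close>. The two are equal.\<close>
  define \<kappa> where "\<kappa> = 2 * q / L"
  have \<kappa>: "\<kappa> > 0" using q L by (simp add: \<kappa>_def)
  define f where "f = (\<lambda>y. u y - \<kappa> * (norm y)\<^sup>2)"
  define w where "w = (\<lambda>x. SUP k. f (x - lattice_vec L k))"
  have uq: "\<bar>u y\<bar> \<le> q * norm y" for y using lip[of y 0] u0 by simp
  have f_up: "f y \<le> q * L / 8" for y
  proof -
    \<comment> \<open>Completing the square: \<open>q * norm y\<close> minus the parabola is largest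
      at \<open>norm y = L / 4\<close>, with value \<open>q * L / 8\<close>.\<close>
    have "0 \<le> \<kappa> * (norm y - L / 4)\<^sup>2" using \<kappa> by simp
    moreover have "\<kappa> * (norm y - L / 4)\<^sup>2 = \<kappa> * (norm y)\<^sup>2 - q * norm y + q * L / 8"
      using L by (simp add: \<kappa>_def power2_eq_square field_simps)
    ultimately show ?thesis using uq[of y] by (simp add: f_def abs_le_iff)
  qed
  have bdd: "bdd_above (range (\<lambda>k. f (x - lattice_vec L k)))" for x
    by (rule bdd_aboveI2[OF f_up])
  have w_ge: "f (x - lattice_vec L k) \<le> w x" for x k unfolding w_def using bdd by (intro cSUP_upper) auto
  have w_le: "w x \<le> c" if "\<And>k. f (x - lattice_vec L k) \<le> c" for x c
    unfolding w_def using that by (intro cSUP_least) auto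
  have lat0: "lattice_vec L (\<lambda>_. 0) = 0" by (simp add: vec_eq_iff)
  have w_ge0: "f x \<le> w x" for x using w_ge[of x "\<lambda>_. 0"] by (simp add: lat0)
  have sdn: "(norm (x + z))\<^sup>2 + (norm (x - z))\<^sup>2 - 2 * (norm x)\<^sup>2 = 2 * (norm z)\<^sup>2" for x z :: "real^'n"
    by (simp add: power2_norm_eq_inner inner_add_left inner_add_right inner_diff_left inner_diff_right inner_commute)
  have sdf: "second_diff f x z = second_diff u x z - (4 * q / L) * (norm z)\<^sup>2" for x z
  proof -
    have "second_diff f x z = second_diff u x z - \<kappa> * ((norm (x + z))\<^sup>2 + (norm (x - z))\<^sup>2 - 2 * (norm x)\<^sup>2)"
      by (simp add: second_diff_def f_def algebra_simps)
    then show ?thesis by (simp add: sdn \<kappa>_def)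
  qed
  show ?thesis
  proof (rule that[of w])
    have le: "w (x + lattice_vec L k) \<le> w x" for x k
    proof (rule w_le)
      fix l
      have "x + lattice_vec L k - lattice_vec L l = x - lattice_vec L (\<lambda>j. l j - k j)"
        by (simp add: vec_eq_iff algebra_simps)
      then show "f (x + lattice_vec L k - lattice_vec L l) \<le> w x" by (simp only: w_ge)
    qed
    show "w (x + lattice_vec L k) = w x" for x k
    proof (rule antisym[OF le])
      have "w x = w (x + lattice_vec L k + lattice_vec L (\<lambda>j. - k j))"
        by (rule arg_cong[of _ _ w]) (simp add: vec_eq_iff)
      then show "w x \<le> w (x + lattice_vec L k)" using le by simp
    qed
    show "\<bar>w x\<bar> \<le> q * L * (real CARD('n))\<^sup>2" for x
    proof -
      have 1: "w x \<le> q * L / 8" by (rule w_le[OF f_up])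
      have nn: "1 \<le> n\<^sup>2" "n \<le> n\<^sup>2" using n by (simp_all add: power2_eq_square mult_le_cancel_left1 one_le_power[of n 2, unfolded power2_eq_square])
      have "q * L / 8 \<le> q * L * 1" using q L by simp
      also have "\<dots> \<le> q * L * n\<^sup>2" using q L nn by (intro mult_left_mono) auto
      finally have 2: "q * L / 8 \<le> q * L * n\<^sup>2" .
      obtain k where k: "norm (x - lattice_vec L k) \<le> n * (L / 2)" using lattice_round[OF L, of x] by (auto simp: n_def)
      define y where "y = x - lattice_vec L k"
      have "- (q * norm y) - \<kappa> * (norm y)\<^sup>2 \<le> f y" using uq[of y] by (simp add: f_def abs_le_iff)
      moreover have "q * norm y \<le> q * (n * (L / 2))" using k q by (intro mult_left_mono) (auto simp: y_def)
      moreover have "\<kappa> * (norm y)\<^sup>2 \<le> \<kappa> * (n * (L / 2))\<^sup>2" using k \<kappa> by (intro mult_left_mono power_mono) (auto simp: y_def)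
      moreover have "q * (n * (L / 2)) + \<kappa> * (n * (L / 2))\<^sup>2 = q * L * ((n + n\<^sup>2) / 2)"
        using L by (simp add: \<kappa>_def power2_eq_square field_simps)
      moreover have "q * L * ((n + n\<^sup>2) / 2) \<le> q * L * n\<^sup>2" using q L nn by (intro mult_left_mono) auto
      ultimately have "- (q * L * n\<^sup>2) \<le> f y" by linarith
      also have "f y \<le> w x" using w_ge by (simp add: y_def)
      finally show ?thesis using 1 2 by (simp add: n_def abs_le_iff)
    qed
    show "- (4 * q / L) * (norm z)\<^sup>2 \<le> second_diff w x z" for x z
    proof -
      have "w x \<le> (w (x + z) + w (x - z) + (4 * q / L) * (norm z)\<^sup>2) / 2"
      proof (rule w_le)
        fix k
        define y where "y = x - lattice_vec L k"
        have "f (y + z) \<le> w (x + z)" "f (y - z) \<le> w (x - z)"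
          using w_ge[of "x + z" k] w_ge[of "x - z" k] by (simp_all add: y_def algebra_simps)
        moreover have "0 \<le> second_diff f y z + (4 * q / L) * (norm z)\<^sup>2" using conv[of y z] by (simp add: sdf)
        ultimately show "f (x - lattice_vec L k) \<le> (w (x + z) + w (x - z) + (4 * q / L) * (norm z)\<^sup>2) / 2"
          by (simp add: second_diff_def y_def[symmetric])
      qed
      then show ?thesis by (simp add: second_diff_def)
    qed
    show "second_diff u x z - (4 * q / L) * (norm z)\<^sup>2 \<le> second_diff w x z" if x: "norm x \<le> L / 4" for x z
    proof -
      have "w x \<le> f x"
      proof (rule w_le)
        fix k
        define v :: "real^'n" where "v = lattice_vec L k"
        show "f (x - lattice_vec L k) \<le> f x"
        proof (cases "v = 0")
          case False
          then have v: "L \<le> norm v" unfolding v_def using L by (intro norm_lattice_vec_ge)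
          have "x \<bullet> v \<le> norm x * norm v" by (rule norm_cauchy_schwarz)
          also have "\<dots> \<le> (L / 4) * norm v" using x by (intro mult_right_mono) auto
          finally have xv: "x \<bullet> v \<le> (L / 4) * norm v" .
          have "L * norm v \<le> norm v * norm v" using v by (intro mult_right_mono) auto
          then have "(L / 2) * norm v \<le> (norm v)\<^sup>2 - 2 * (x \<bullet> v)" using xv by (simp add: power2_eq_square)
          then have "\<kappa> * ((L / 2) * norm v) \<le> \<kappa> * ((norm v)\<^sup>2 - 2 * (x \<bullet> v))" using \<kappa> by (intro mult_left_mono) auto
          moreover have "\<kappa> * ((L / 2) * norm v) = q * norm v" using L by (simp add: \<kappa>_def)
          moreover have "\<kappa> * (norm (x - v))\<^sup>2 = \<kappa> * (norm x)\<^sup>2 + \<kappa> * ((norm v)\<^sup>2 - 2 * (x \<bullet> v))"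
            unfolding distrib_left[symmetric] by (simp add: power2_norm_eq_inner inner_diff_left inner_diff_right inner_commute)
          moreover have "u (x - v) \<le> u x + q * norm v" using lip[of "x - v" x] by (simp add: abs_le_iff)
          ultimately show ?thesis unfolding f_def v_def[symmetric] by linarith
        qed (simp add: v_def[symmetric])
      qed
      then show ?thesis using w_ge0[of "x + z"] w_ge0[of "x - z"] unfolding sdf[symmetric] by (simp add: second_diff_def)
    qed
  qed
qed

text \<open>The Lipschitz constant of the discrete solution is
  \<open>real CARD('n) * \<rho>\<close>, so periodization costs curvature of order \<rho> only,
  against the fixed amount \<open>1 / 6\<close> at the nodes.\<close>

corollary periodic_monge_ampere:
  fixes X :: "(real^'n) set"
  assumes X: "finite X" "X \<subseteq> cball 0 (L / 4)" and h: "0 < h" and \<rho>: "0 < \<rho>" and L: "0 < L"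
    and vol: "real (card X) * h ^ CARD('n) \<le> (2 * \<rho>) ^ CARD('n)"
  obtains w :: "real^'n \<Rightarrow> real" where "\<And>x k. w (x + lattice_vec L k) = w x"
    "\<And>x. \<bar>w x\<bar> \<le> (L * real CARD('n) ^ 3) * \<rho>"
    "\<And>x z. - (4 * real CARD('n) / L * \<rho>) * (norm z)\<^sup>2 \<le> second_diff w x z"
    "\<And>x. x \<in> X \<Longrightarrow> \<exists>j. (1 / 6 - 4 * real CARD('n) / L * \<rho>) * h\<^sup>2 \<le> second_diff w x (h *\<^sub>R axis j 1)"
proof -
  obtain u :: "real^'n \<Rightarrow> real" where u: "u 0 = 0" "\<And>x y. \<bar>u x - u y\<bar> \<le> real CARD('n) * \<rho> * norm (x - y)"
    "\<And>x z. 0 \<le> second_diff u x z"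
    "\<And>x. x \<in> X \<Longrightarrow> \<exists>j. h\<^sup>2 / 6 \<le> second_diff u x (h *\<^sub>R axis j 1)"
    using discrete_monge_ampere[OF X(1) h \<rho> vol] by blast
  have q: "0 < real CARD('n) * \<rho>" using \<rho> by simp
  obtain w where w: "\<And>x k. w (x + lattice_vec L k) = w x"
    "\<And>x. \<bar>w x\<bar> \<le> real CARD('n) * \<rho> * L * (real CARD('n))\<^sup>2"
    "\<And>x z. - (4 * (real CARD('n) * \<rho>) / L) * (norm z)\<^sup>2 \<le> second_diff w x z"
    "\<And>x z. norm x \<le> L / 4 \<Longrightarrow> second_diff u x z - (4 * (real CARD('n) * \<rho>) / L) * (norm z)\<^sup>2 \<le> second_diff w x z"
    using periodization[OF L q u(1,2,3)] by blast
  show ?thesis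
  proof (rule that[of w])
    show "w (x + lattice_vec L k) = w x" for x k by (rule w(1))
    show "\<bar>w x\<bar> \<le> (L * real CARD('n) ^ 3) * \<rho>" for x
      using w(2)[of x] by (simp add: power2_eq_square power3_eq_cube mult_ac)
    show "- (4 * real CARD('n) / L * \<rho>) * (norm z)\<^sup>2 \<le> second_diff w x z" for x z using w(3) by (simp add: mult_ac)
    fix x assume x: "x \<in> X"
    then obtain j where j: "h\<^sup>2 / 6 \<le> second_diff u x (h *\<^sub>R axis j 1)" using u(4) by blast
    have "norm x \<le> L / 4" using X(2) x by auto
    from w(4)[OF this, of "h *\<^sub>R axis j 1"] j
    have "h\<^sup>2 / 6 - 4 * (real CARD('n) * \<rho>) / L * h\<^sup>2 \<le> second_diff w x (h *\<^sub>R axis j 1)" by simp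
    then show "\<exists>j. (1 / 6 - 4 * real CARD('n) / L * \<rho>) * h\<^sup>2 \<le> second_diff w x (h *\<^sub>R axis j 1)"
      by (intro exI[of _ j]) (simp add: algebra_simps)
  qed
qed

section \<open>Trigonometric sums and kernels\<close>

definition trig_sum :: "'i set \<Rightarrow> ('i \<Rightarrow> real) \<Rightarrow> ('i \<Rightarrow> real^'n) \<Rightarrow> ('i \<Rightarrow> real) \<Rightarrow> real^'n \<Rightarrow> real" where
  "trig_sum I c \<xi> \<theta> x = (\<Sum>i\<in>I. c i * cos (\<xi> i \<bullet> x + \<theta> i))"

text \<open>The second derivative of \<open>trig_sum\<close> at \<open>x\<close> in the direction
  \<open>v\<close>, written in coefficients so that it is available without differentiation.\<close>

definition trig_hess :: "'i set \<Rightarrow> ('i \<Rightarrow> real) \<Rightarrow> ('i \<Rightarrow> real^'n) \<Rightarrow> ('i \<Rightarrow> real) \<Rightarrow> real^'n \<Rightarrow> real^'n \<Rightarrow> real" where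
  "trig_hess I c \<xi> \<theta> x v = (\<Sum>i\<in>I. - c i * (\<xi> i \<bullet> v)\<^sup>2 * cos (\<xi> i \<bullet> x + \<theta> i))"

definition semiconvex_trig :: "'i set \<Rightarrow> ('i \<Rightarrow> real) \<Rightarrow> ('i \<Rightarrow> real^'n) \<Rightarrow> ('i \<Rightarrow> real) \<Rightarrow> real \<Rightarrow> real \<Rightarrow> bool" where
  "semiconvex_trig I c \<xi> \<theta> k1 k2 \<longleftrightarrow> finite I \<and> (\<forall>x. \<bar>trig_sum I c \<xi> \<theta> x\<bar> \<le> k1) \<and>
     (\<forall>x v. - k2 * (norm v)\<^sup>2 \<le> trig_hess I c \<xi> \<theta> x v)"

lemma second_diff_cos:
  "second_diff (\<lambda>x. cos (\<xi> \<bullet> x + \<theta>)) x z = - 2 * (1 - cos (\<xi> \<bullet> z)) * cos (\<xi> \<bullet> x + \<theta>)"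
proof -
  have "\<xi> \<bullet> (x + z) + \<theta> = (\<xi> \<bullet> x + \<theta>) + \<xi> \<bullet> z" "\<xi> \<bullet> (x - z) + \<theta> = (\<xi> \<bullet> x + \<theta>) - \<xi> \<bullet> z"
    by (simp_all add: inner_add_right inner_diff_right)
  moreover have "cos (a + b) + cos (a - b) - 2 * cos a = - 2 * (1 - cos b) * cos a" for a b :: real
    by (simp add: cos_add cos_diff algebra_simps)
  ultimately show ?thesis unfolding second_diff_def by (simp only:)
qed

lemma second_diff_sum: "second_diff (\<lambda>x. \<Sum>i\<in>I. c i * f i x) x z = (\<Sum>i\<in>I. c i * second_diff (f i) x z)"
  by (simp add: second_diff_def sum.distrib sum_subtractf sum_distrib_left algebra_simps)

lemma second_diff_trig_sum:
  "second_diff (trig_sum I c \<xi> \<theta>) x z = (\<Sum>i\<in>I. c i * (- 2 * (1 - cos (\<xi> i \<bullet> z)) * cos (\<xi> i \<bullet> x + \<theta> i)))"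
  unfolding trig_sum_def[abs_def] second_diff_sum second_diff_cos ..

lemma cos_taylor4: "\<bar>2 * cos t - 2 + t\<^sup>2\<bar> \<le> t ^ 4" for t :: real
proof -
  obtain s where "cos t = (\<Sum>m<4. cos_coeff m * t ^ m) + (cos (s + 1/2 * real 4 * pi) / fact 4) * t ^ 4"
    using Maclaurin_cos_expansion by blast
  moreover have "{..<4} = {0, 1, 2, 3::nat}" by auto
  then have "(\<Sum>m<4. cos_coeff m * t ^ m) = 1 - t\<^sup>2 / 2" by (simp add: cos_coeff_def)
  moreover have "fact 4 = (24::real)" by (simp add: fact_numeral)
  ultimately have "2 * cos t - 2 + t\<^sup>2 = (cos (s + 1/2 * real 4 * pi) / 12) * t ^ 4" by (simp add: field_simps)
  moreover have "\<bar>cos (s + 1/2 * real 4 * pi) / 12\<bar> \<le> 1"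
    unfolding abs_divide using abs_cos_le_one[of "s + 1/2 * real 4 * pi"] by linarith
  then have "\<bar>(cos (s + 1/2 * real 4 * pi) / 12) * t ^ 4\<bar> \<le> 1 * \<bar>t ^ 4\<bar>"
    unfolding abs_mult by (intro mult_right_mono) auto
  ultimately show ?thesis by simp
qed

text \<open>Taylor expansion of each cosine to fourth order. The constant depends on coefficients
  and frequencies alone, so differences over a fine grid determine the Hessian with a uniform
  error.\<close>

lemma second_diff_trig_hess:
  assumes "finite I"
  shows "\<bar>second_diff (trig_sum I c \<xi> \<theta>) x z - trig_hess I c \<xi> \<theta> x z\<bar> \<le> (\<Sum>i\<in>I. \<bar>c i\<bar> * norm (\<xi> i) ^ 4) * norm z ^ 4"
proof -
  have "second_diff (trig_sum I c \<xi> \<theta>) x z - trig_hess I c \<xi> \<theta> x z =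
      (\<Sum>i\<in>I. c i * ((2 * cos (\<xi> i \<bullet> z) - 2 + (\<xi> i \<bullet> z)\<^sup>2) * cos (\<xi> i \<bullet> x + \<theta> i)))"
    unfolding second_diff_trig_sum trig_hess_def sum_subtractf[symmetric] by (intro sum.cong) (auto simp: algebra_simps)
  also have "\<bar>\<dots>\<bar> \<le> (\<Sum>i\<in>I. \<bar>c i\<bar> * (norm (\<xi> i) ^ 4 * norm z ^ 4))"
  proof (intro order_trans[OF sum_abs] sum_mono)
    fix i
    have "\<bar>(2 * cos (\<xi> i \<bullet> z) - 2 + (\<xi> i \<bullet> z)\<^sup>2)\<bar> * \<bar>cos (\<xi> i \<bullet> x + \<theta> i)\<bar> \<le> (\<xi> i \<bullet> z) ^ 4 * 1"
      by (intro mult_mono cos_taylor4) auto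
    also have "(\<xi> i \<bullet> z) ^ 4 * 1 = \<bar>\<xi> i \<bullet> z\<bar> ^ 4" by simp
    also have "\<dots> \<le> (norm (\<xi> i) * norm z) ^ 4" by (intro power_mono Cauchy_Schwarz_ineq2) auto
    finally show "\<bar>c i * ((2 * cos (\<xi> i \<bullet> z) - 2 + (\<xi> i \<bullet> z)\<^sup>2) * cos (\<xi> i \<bullet> x + \<theta> i))\<bar> \<le> \<bar>c i\<bar> * (norm (\<xi> i) ^ 4 * norm z ^ 4)"
      unfolding abs_mult power_mult_distrib by (intro mult_left_mono) auto
  qed
  also have "\<dots> = (\<Sum>i\<in>I. \<bar>c i\<bar> * norm (\<xi> i) ^ 4) * norm z ^ 4" by (simp only: sum_distrib_right mult.assoc)
  finally show ?thesis .
qed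

lemma trig_hess_scaleR: "trig_hess I c \<xi> \<theta> x (a *\<^sub>R v) = a\<^sup>2 * trig_hess I c \<xi> \<theta> x v"
  by (simp add: trig_hess_def sum_distrib_left power_mult_distrib mult_ac)

lemma trig_hess_diff_bound:
  assumes "finite I"
  shows "\<bar>trig_hess I c \<xi> \<theta> x v - trig_hess I c \<xi> \<theta> x w\<bar> \<le> (\<Sum>i\<in>I. \<bar>c i\<bar> * norm (\<xi> i) ^ 2) * (norm (v - w) * norm (v + w))"
proof -
  have "trig_hess I c \<xi> \<theta> x v - trig_hess I c \<xi> \<theta> x w =
      (\<Sum>i\<in>I. - c i * (((\<xi> i \<bullet> (v - w)) * (\<xi> i \<bullet> (v + w))) * cos (\<xi> i \<bullet> x + \<theta> i)))"
    unfolding trig_hess_def sum_subtractf[symmetric]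
    by (intro sum.cong) (auto simp: inner_diff_right inner_add_right power2_eq_square algebra_simps)
  also have "\<bar>\<dots>\<bar> \<le> (\<Sum>i\<in>I. \<bar>c i\<bar> * (norm (\<xi> i) ^ 2 * (norm (v - w) * norm (v + w))))"
  proof (intro order_trans[OF sum_abs] sum_mono)
    fix i
    have "\<bar>\<xi> i \<bullet> (v - w)\<bar> * \<bar>\<xi> i \<bullet> (v + w)\<bar> * \<bar>cos (\<xi> i \<bullet> x + \<theta> i)\<bar> \<le> (norm (\<xi> i) * norm (v - w)) * (norm (\<xi> i) * norm (v + w)) * 1"
      by (intro mult_mono Cauchy_Schwarz_ineq2) auto
    also have "\<dots> = norm (\<xi> i) ^ 2 * (norm (v - w) * norm (v + w))" by (simp add: power2_eq_square)
    finally show "\<bar>- c i * (((\<xi> i \<bullet> (v - w)) * (\<xi> i \<bullet> (v + w))) * cos (\<xi> i \<bullet> x + \<theta> i))\<bar> \<le> \<bar>c i\<bar> * (norm (\<xi> i) ^ 2 * (norm (v - w) * norm (v + w)))"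
      unfolding abs_mult abs_minus_cancel by (intro mult_left_mono) auto
  qed
  also have "\<dots> = (\<Sum>i\<in>I. \<bar>c i\<bar> * norm (\<xi> i) ^ 2) * (norm (v - w) * norm (v + w))" by (simp only: sum_distrib_right mult.assoc)
  finally show ?thesis .
qed

text \<open>Semiconvexity along the grid directions passes to all directions, since every direction is close
  to that of a grid vector of length about \<open>P\<close>.\<close>

lemma trig_hess_ge_of_grid:
  fixes \<xi> :: "'i \<Rightarrow> real^'n"
  assumes I: "finite I" and h: "0 < h" and P: "0 < P" and \<kappa>: "0 \<le> \<kappa>"
    and grid: "\<And>e. - \<kappa> * (norm (lattice_vec h e))\<^sup>2 \<le> second_diff (trig_sum I c \<xi> \<theta>) x (lattice_vec h e)"
    and B2: "(\<Sum>i\<in>I. \<bar>c i\<bar> * norm (\<xi> i) ^ 2) \<le> B" and B4: "(\<Sum>i\<in>I. \<bar>c i\<bar> * norm (\<xi> i) ^ 4) \<le> C"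
    and n: "n = real CARD('n)"
    and small: "C * h\<^sup>2 * (P + n) ^ 4 + \<kappa> * (P + n)\<^sup>2 + B * (n * (2 * P + n)) \<le> 2 * \<kappa> * P\<^sup>2"
  shows "- (2 * \<kappa>) * (norm v)\<^sup>2 \<le> trig_hess I c \<xi> \<theta> x v"
proof -
  have n0: "n > 0" by (simp add: n)
  have B: "0 \<le> B" by (rule order_trans[OF _ B2]) (simp add: sum_nonneg)
  have C: "0 \<le> C" by (rule order_trans[OF _ B4]) (simp add: sum_nonneg)
  have lat: "lattice_vec h e = h *\<^sub>R lattice_vec 1 e" for e :: "'n \<Rightarrow> int" by (simp add: vec_eq_iff)
  have unit: "- (2 * \<kappa>) \<le> trig_hess I c \<xi> \<theta> x v" if v: "norm v = 1" for v
  proof -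
    \<comment> \<open>The integer vector \<open>a\<close> rounds \<open>P *\<^sub>R v\<close>. The
      step \<open>h *\<^sub>R a\<close> belongs to the grid, where the hypothesis applies at a
      Taylor cost with factor \<open>C\<close>; rounding back costs at most
      \<open>B * (n * (2 * P + n))\<close>, of lower order than the available
      \<open>\<kappa> * P\<^sup>2\<close> when \<open>P\<close> is large.\<close>
    obtain e where e: "norm (P *\<^sub>R v - lattice_vec 1 e) \<le> n * (1 / 2)"
      using lattice_round[of 1 "P *\<^sub>R v"] n by auto
    define a where "a = lattice_vec 1 e"
    have en: "norm (P *\<^sub>R v - a) \<le> n" using e n0 by (simp add: a_def)
    have an: "norm a \<le> P + n"
      using en norm_triangle_ineq2[of a "P *\<^sub>R v"] v P by (simp add: norm_minus_commute)
    have sn: "norm (P *\<^sub>R v + a) \<le> 2 * P + n" using an norm_triangle_ineq[of "P *\<^sub>R v" a] v P by simp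
    have "- \<kappa> * (h\<^sup>2 * (norm a)\<^sup>2) - C * (h ^ 4 * norm a ^ 4) \<le> h\<^sup>2 * trig_hess I c \<xi> \<theta> x a"
    proof -
      have "- \<kappa> * (norm (h *\<^sub>R a))\<^sup>2 \<le> second_diff (trig_sum I c \<xi> \<theta>) x (h *\<^sub>R a)"
        using grid[of e] by (simp add: lat a_def)
      moreover have "second_diff (trig_sum I c \<xi> \<theta>) x (h *\<^sub>R a) - trig_hess I c \<xi> \<theta> x (h *\<^sub>R a) \<le> C * norm (h *\<^sub>R a) ^ 4"
        using second_diff_trig_hess[OF I, of c \<xi> \<theta> x "h *\<^sub>R a"] mult_right_mono[OF B4, of "norm (h *\<^sub>R a) ^ 4"]
        by simp
      ultimately have "- \<kappa> * (norm (h *\<^sub>R a))\<^sup>2 - C * norm (h *\<^sub>R a) ^ 4 \<le> trig_hess I c \<xi> \<theta> x (h *\<^sub>R a)" by linarith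
      then show ?thesis unfolding trig_hess_scaleR using h by (simp add: power_mult_distrib)
    qed
    also have "- \<kappa> * (h\<^sup>2 * (norm a)\<^sup>2) - C * (h ^ 4 * norm a ^ 4) = h\<^sup>2 * (- \<kappa> * (norm a)\<^sup>2 - C * h\<^sup>2 * norm a ^ 4)"
      by (simp add: algebra_simps power2_eq_square power4_eq_xxxx)
    finally have "- \<kappa> * (norm a)\<^sup>2 - C * h\<^sup>2 * norm a ^ 4 \<le> trig_hess I c \<xi> \<theta> x a" using h by simp
    moreover have "\<kappa> * (norm a)\<^sup>2 \<le> \<kappa> * (P + n)\<^sup>2" using an \<kappa> by (intro mult_left_mono power_mono) auto
    moreover have "C * h\<^sup>2 * norm a ^ 4 \<le> C * h\<^sup>2 * (P + n) ^ 4" using an C by (intro mult_left_mono power_mono) auto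
    ultimately have 1: "- \<kappa> * (P + n)\<^sup>2 - C * h\<^sup>2 * (P + n) ^ 4 \<le> trig_hess I c \<xi> \<theta> x a" by linarith
    have "\<bar>trig_hess I c \<xi> \<theta> x (P *\<^sub>R v) - trig_hess I c \<xi> \<theta> x a\<bar> \<le> B * (n * (2 * P + n))"
      by (rule order_trans[OF trig_hess_diff_bound[OF I]]) (intro mult_mono B2 en sn B; simp add: n0 less_imp_le)
    then have "- (2 * \<kappa>) * P\<^sup>2 \<le> trig_hess I c \<xi> \<theta> x (P *\<^sub>R v)" using 1 small by (simp add: abs_le_iff)
    then have "P\<^sup>2 * - (2 * \<kappa>) \<le> P\<^sup>2 * trig_hess I c \<xi> \<theta> x v" unfolding trig_hess_scaleR by (simp add: mult_ac)
    moreover have "0 < P\<^sup>2" using P by simp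
    ultimately show ?thesis using mult_le_cancel_left_pos by blast
  qed
  show ?thesis
  proof (cases "v = 0")
    case True then show ?thesis by (simp add: trig_hess_def)
  next
    case False
    then have "trig_hess I c \<xi> \<theta> x v = (norm v)\<^sup>2 * trig_hess I c \<xi> \<theta> x ((1 / norm v) *\<^sub>R v)"
      unfolding trig_hess_scaleR by (simp add: power_divide)
    also have "\<dots> \<ge> (norm v)\<^sup>2 * - (2 * \<kappa>)" using unit[of "(1 / norm v) *\<^sub>R v"] False by (intro mult_left_mono) auto
    finally show ?thesis by (simp add: mult_ac)
  qed
qed

section \<open>Sums over the grid of one period\<close>

definition int_grid :: "nat \<Rightarrow> ('n \<Rightarrow> int) set" where
  "int_grid M = PiE UNIV (\<lambda>_. {- int M..<int M})"

lemma finite_int_grid [simp]: "finite (int_grid M :: ('n::finite \<Rightarrow> int) set)"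
  unfolding int_grid_def by (intro finite_PiE) auto

lemma mem_int_grid: "m \<in> int_grid M \<longleftrightarrow> (\<forall>j. - int M \<le> m j \<and> m j < int M)"
  by (auto simp: int_grid_def PiE_iff)

text \<open>The half-open box of side \<open>2 * M\<close> contains one representative of each class
  modulo \<open>2 * M\<close>, so a shift followed by reduction permutes it.\<close>

lemma sum_int_grid_shift:
  fixes f :: "('n::finite \<Rightarrow> int) \<Rightarrow> real"
  assumes M: "0 < M" and per: "\<And>m l. f (\<lambda>j. m j + 2 * int M * l j) = f m"
  shows "(\<Sum>m\<in>int_grid M. f (\<lambda>j. m j + e j)) = (\<Sum>m\<in>int_grid M. f m)"
proof -
  define r where "r = (\<lambda>e (m::'n \<Rightarrow> int) j. (m j + e j + int M) mod (2 * int M) - int M)"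
  have r_mem: "r e m \<in> int_grid M" for e m
    using M unfolding mem_int_grid r_def by (auto simp: algebra_simps)
  have r_inv: "r (\<lambda>j. - e j) (r e m) = m" if "m \<in> int_grid M" for e m
  proof
    fix j
    have "(r e m j + - e j + int M) mod (2 * int M) = ((m j + e j + int M) mod (2 * int M) + - e j) mod (2 * int M)"
      by (simp add: r_def)
    also have "\<dots> = (m j + int M) mod (2 * int M)" by (simp add: mod_diff_left_eq algebra_simps)
    also have "\<dots> = m j + int M"
    proof -
      have "- int M \<le> m j" "m j < int M" using that by (auto simp: mem_int_grid)
      then show ?thesis by (intro mod_pos_pos_trivial) auto
    qed
    finally have "(r e m j + - e j + int M) mod (2 * int M) - int M = m j" by simp
    moreover have "r (\<lambda>j. - e j) (r e m) j = (r e m j + - e j + int M) mod (2 * int M) - int M"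
      by (subst r_def) (rule refl)
    ultimately show "r (\<lambda>j. - e j) (r e m) j = m j" by simp
  qed
  have f_r: "f (r e m) = f (\<lambda>j. m j + e j)" for e m
  proof -
    have "(\<lambda>j. m j + e j) = (\<lambda>j. r e m j + 2 * int M * ((m j + e j + int M) div (2 * int M)))"
    proof
      fix j
      have "m j + e j + int M = (m j + e j + int M) mod (2 * int M) + 2 * int M * ((m j + e j + int M) div (2 * int M))"
        by simp
      then show "m j + e j = r e m j + 2 * int M * ((m j + e j + int M) div (2 * int M))" unfolding r_def by linarith
    qed
    then show ?thesis using per[of "r e m"] by simp
  qed
  show ?thesis
    by (rule sum.reindex_bij_witness[of _ "r (\<lambda>j. - e j)" "r e"])
       (use r_mem r_inv r_inv[of _ "\<lambda>j. - e j"] f_r in auto)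
qed

text \<open>Finite sums of waves with all frequency components bounded by \<open>d\<close>. The
  degree is tracked because averages over a grid are exact only below the aliasing
  threshold.\<close>

inductive trig_poly :: "real \<Rightarrow> nat \<Rightarrow> (real^'n \<Rightarrow> real) \<Rightarrow> bool" for L :: real and d :: nat where
  zero: "trig_poly L d (\<lambda>_. 0)"
| wave: "trig_poly L d u \<Longrightarrow> (\<And>j. \<bar>k j\<bar> \<le> int d) \<Longrightarrow>
    trig_poly L d (\<lambda>x. c * cos (lattice_vec (2 * pi / L) k \<bullet> x + \<theta>) + u x)"

lemma trig_poly_add:
  assumes "trig_poly L d u" "trig_poly L d v"
  shows "trig_poly L d (\<lambda>x. u x + v x)"
  using assms(1)
proof induction
  case (wave u k c \<theta>)
  then show ?case using trig_poly.wave[OF wave.IH wave.hyps(2), where c=c and \<theta>=\<theta>] by (simp add: add.assoc)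
qed (use assms(2) in simp)

lemma trig_poly_single:
  assumes "\<And>j. \<bar>k j\<bar> \<le> int d"
  shows "trig_poly L d (\<lambda>x. c * cos (lattice_vec (2 * pi / L) k \<bullet> x + \<theta>))"
  using trig_poly.wave[OF trig_poly.zero assms, where L=L and c=c and \<theta>=\<theta>] by simp

lemma lattice_vec_diff: "lattice_vec L (\<lambda>j. k j - l j) = lattice_vec L k - lattice_vec L l"
  by (simp add: vec_eq_iff right_diff_distrib)

text \<open>Product-to-sum formula: two waves multiply to waves with the sum and the difference of
  their frequencies, so degrees add.\<close>

lemma trig_poly_mult_wave:
  assumes "trig_poly L d u" and k: "\<And>j. \<bar>k j\<bar> \<le> int d'"
  shows "trig_poly L (d + d') (\<lambda>x. c * cos (lattice_vec (2 * pi / L) k \<bullet> x + \<theta>) * u x)"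
  using assms(1)
proof induction
  case zero
  then show ?case by (simp add: trig_poly.zero)
next
  case (wave u l b \<eta>)
  let ?w = "2 * pi / L"
  have "trig_poly L (d + d') (\<lambda>x. (b * c / 2) * cos (lattice_vec ?w (\<lambda>j. l j - k j) \<bullet> x + (\<eta> - \<theta>)) +
      c * cos (lattice_vec ?w k \<bullet> x + \<theta>) * u x)"
  proof (rule trig_poly.wave[OF wave.IH])
    fix j show "\<bar>l j - k j\<bar> \<le> int (d + d')" using wave.hyps(2)[of j] k[of j] by simp
  qed
  then have "trig_poly L (d + d') (\<lambda>x. (b * c / 2) * cos (lattice_vec ?w (\<lambda>j. l j + k j) \<bullet> x + (\<eta> + \<theta>)) +
      ((b * c / 2) * cos (lattice_vec ?w (\<lambda>j. l j - k j) \<bullet> x + (\<eta> - \<theta>)) +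
      c * cos (lattice_vec ?w k \<bullet> x + \<theta>) * u x))"
  proof (rule trig_poly.wave)
    fix j show "\<bar>l j + k j\<bar> \<le> int (d + d')" using wave.hyps(2)[of j] k[of j] by simp
  qed
  moreover have "(b * c / 2) * cos (lattice_vec ?w (\<lambda>j. l j + k j) \<bullet> x + (\<eta> + \<theta>)) +
      ((b * c / 2) * cos (lattice_vec ?w (\<lambda>j. l j - k j) \<bullet> x + (\<eta> - \<theta>)) +
      c * cos (lattice_vec ?w k \<bullet> x + \<theta>) * u x) =
      c * cos (lattice_vec ?w k \<bullet> x + \<theta>) * (b * cos (lattice_vec ?w l \<bullet> x + \<eta>) + u x)" for x
  proof -
    define s t where "s = lattice_vec ?w l \<bullet> x + \<eta>" and "t = lattice_vec ?w k \<bullet> x + \<theta>"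
    have 1: "lattice_vec ?w (\<lambda>j. l j + k j) \<bullet> x + (\<eta> + \<theta>) = s + t"
      "lattice_vec ?w (\<lambda>j. l j - k j) \<bullet> x + (\<eta> - \<theta>) = s - t"
      by (simp_all add: s_def t_def lattice_vec_add lattice_vec_diff inner_add_left inner_diff_left)
    have "(b * c / 2) * cos (s + t) + (b * c / 2) * cos (s - t) = c * cos t * (b * cos s)"
      by (simp add: cos_add cos_diff algebra_simps)
    then show ?thesis unfolding 1 by (simp add: s_def[symmetric] t_def[symmetric] distrib_left)
  qed
  ultimately show ?case by simp
qed

lemma trig_poly_mult:
  assumes "trig_poly L d u" "trig_poly L d' v"
  shows "trig_poly L (d + d') (\<lambda>x. u x * v x)"
  using assms(2)
proof induction
  case zero
  then show ?case by (simp add: trig_poly.zero)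
next
  case (wave v k c \<theta>)
  show ?case
    using trig_poly_add[OF trig_poly_mult_wave[OF assms(1) wave.hyps(2), where c=c and \<theta>=\<theta>] wave.IH]
    by (simp add: distrib_left mult_ac)
qed

lemma trig_poly_const: "trig_poly L d (\<lambda>_. a)"
  using trig_poly_single[of "\<lambda>_. 0" d L a 0] by (simp add: lattice_vec_def zero_vec_def[symmetric])

lemma trig_poly_power: "trig_poly L d u \<Longrightarrow> trig_poly L (N * d) (\<lambda>x. u x ^ N)"
proof (induction N)
  case 0
  then show ?case using trig_poly_const[of L 0 1] by simp
next
  case (Suc N)
  then show ?case using trig_poly_mult[of L d u "N * d" "\<lambda>x. u x ^ N"] by simp
qed

lemma trig_poly_prod:
  assumes "finite S" "\<And>j. j \<in> S \<Longrightarrow> trig_poly L d (u j)"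
  shows "trig_poly L (card S * d) (\<lambda>x. \<Prod>j\<in>S. u j x)"
  using assms
proof (induction S rule: finite_induct)
  case empty
  then show ?case using trig_poly_const[of L 0 1] by simp
next
  case (insert j S)
  then show ?case using trig_poly_mult[of L d "u j" "card S * d" "\<lambda>x. \<Prod>j\<in>S. u j x"] by simp
qed

lemma trig_poly_imp_trig_sum:
  assumes "trig_poly L d u"
  shows "\<exists>N c k \<theta>. u = trig_sum {..<N::nat} c (\<lambda>i. lattice_vec (2 * pi / L) (k i)) \<theta> \<and> (\<forall>i j. \<bar>k i j\<bar> \<le> int d)"
  using assms
proof induction
  case zero
  show ?case by (intro exI[of _ 0] exI[of _ "\<lambda>_. 0"] exI[of _ "\<lambda>_ _. 0"]) (simp add: trig_sum_def fun_eq_iff)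
next
  case (wave u k0 c0 \<theta>0)
  then obtain N c k \<theta> where u: "u = trig_sum {..<N::nat} c (\<lambda>i. lattice_vec (2 * pi / L) (k i)) \<theta>"
    and k: "\<And>i j. \<bar>k i j\<bar> \<le> int d" by blast
  have "(\<lambda>x. c0 * cos (lattice_vec (2 * pi / L) k0 \<bullet> x + \<theta>0) + u x) =
     trig_sum {..<Suc N} (c(N := c0)) (\<lambda>i. lattice_vec (2 * pi / L) ((k(N := k0)) i)) (\<theta>(N := \<theta>0))"
    by (auto simp: u trig_sum_def fun_eq_iff intro!: sum.cong)
  moreover have "\<bar>(k(N := k0)) i j\<bar> \<le> int d" for i j using k wave.hyps(2) by simp
  ultimately show ?case by blast
qed

text \<open>A shift of the grid by one unit in a direction \<open>j0\<close> with
  \<open>k j0 \<noteq> 0\<close> rotates the pair of cosine and sine sums by the angle \<beta>, yet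
  leaves both sums unchanged. Since \<open>\<bar>k j0\<bar> < 2 * int M\<close>, \<beta> is no
  multiple of \<open>2 * pi\<close>, and such a rotation fixes only the zero vector.\<close>

lemma sum_cos_int_grid:
  fixes k :: "'n::finite \<Rightarrow> int"
  assumes L: "0 < L" and M: "0 < M" and k: "k \<noteq> (\<lambda>_. 0)" and kM: "\<And>j. \<bar>k j\<bar> < 2 * int M"
    and h: "h = L / (2 * real M)"
  shows "(\<Sum>m\<in>int_grid M. cos (lattice_vec (2 * pi / L) k \<bullet> (x - lattice_vec h m) + \<theta>)) = 0"
proof -
  obtain j0 where j0: "k j0 \<noteq> 0" using k by (auto simp: fun_eq_iff)
  define a where "a = (\<lambda>m. lattice_vec (2 * pi / L) k \<bullet> (x - lattice_vec h m) + \<theta>)"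
  define e :: "'n \<Rightarrow> int" where "e = (\<lambda>j. if j = j0 then 1 else 0)"
  define \<beta> where "\<beta> = pi * k j0 / M"
  have lk: "lattice_vec (2 * pi / L) k \<bullet> lattice_vec h m = (\<Sum>j\<in>UNIV. pi * k j * m j / M)" for m
    unfolding inner_vec_def using L M by (intro sum.cong) (auto simp: h field_simps)
  have a_add: "a (\<lambda>j. m j + l j) = a m - (\<Sum>j\<in>UNIV. pi * k j * l j / M)" for m l
    unfolding a_def lattice_vec_add by (simp add: inner_diff_right inner_add_right lk)
  have a_e: "a (\<lambda>j. m j + e j) = a m - \<beta>" for m
  proof -
    have "(\<Sum>j\<in>UNIV. pi * k j * e j / M) = (\<Sum>j\<in>UNIV. if j = j0 then \<beta> else 0)"
      by (intro sum.cong) (auto simp: e_def \<beta>_def)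
    then show ?thesis unfolding a_add by simp
  qed
  have a_per: "\<exists>i::int. a (\<lambda>j. m j + 2 * int M * l j) = a m - 2 * pi * i" for m l
  proof
    have "(\<Sum>j\<in>UNIV. pi * k j * (2 * int M * l j) / M) = 2 * pi * real_of_int (\<Sum>j\<in>UNIV. k j * l j)"
      unfolding of_int_sum sum_distrib_left using M by (intro sum.cong) auto
    then show "a (\<lambda>j. m j + 2 * int M * l j) = a m - 2 * pi * (\<Sum>j\<in>UNIV. k j * l j)" unfolding a_add by simp
  qed
  have cos_per: "cos (t - 2 * pi * real_of_int i) = cos t" "sin (t - 2 * pi * real_of_int i) = sin t" for t i
    using cos_int_2pin[of i] sin_int_2pin[of i] by (simp_all add: cos_diff sin_diff mult_ac)
  define C S where "C = (\<Sum>m\<in>int_grid M. cos (a m))" and "S = (\<Sum>m\<in>int_grid M. sin (a m))"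
  have "C = (\<Sum>m\<in>int_grid M. cos (a (\<lambda>j. m j + e j)))"
    unfolding C_def by (rule sum_int_grid_shift[OF M, symmetric]) (metis a_per cos_per(1))
  also have "\<dots> = C * cos \<beta> + S * sin \<beta>"
    by (simp add: a_e cos_diff C_def S_def sum.distrib sum_distrib_right)
  finally have 1: "C = C * cos \<beta> + S * sin \<beta>" .
  have "S = (\<Sum>m\<in>int_grid M. sin (a (\<lambda>j. m j + e j)))"
    unfolding S_def by (rule sum_int_grid_shift[OF M, symmetric]) (metis a_per cos_per(2))
  also have "\<dots> = S * cos \<beta> - C * sin \<beta>"
    by (simp add: a_e sin_diff C_def S_def sum_subtractf sum_distrib_right)
  finally have 2: "S = S * cos \<beta> - C * sin \<beta>" .
  have "(1 - cos \<beta>) * (C\<^sup>2 + S\<^sup>2) = C * (C - C * cos \<beta>) + S * (S - S * cos \<beta>)"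
    by (simp add: power2_eq_square algebra_simps)
  also have "C - C * cos \<beta> = S * sin \<beta>" using 1 by simp
  also have "S - S * cos \<beta> = - (C * sin \<beta>)" using 2 by simp
  also have "C * (S * sin \<beta>) + S * - (C * sin \<beta>) = 0" by simp
  finally have "(1 - cos \<beta>) * (C\<^sup>2 + S\<^sup>2) = 0" .
  moreover have "cos \<beta> \<noteq> 1"
  proof
    assume "cos \<beta> = 1"
    then obtain i :: int where "\<beta> = of_int i * 2 * pi" by (auto simp: cos_one_2pi_int)
    then have "real_of_int (k j0) = 2 * i * M" using M by (simp add: \<beta>_def field_simps)
    then have ki: "k j0 = 2 * i * int M" by (metis of_int_eq_iff of_int_mult of_int_numeral of_int_of_nat_eq)
    then have "i \<noteq> 0" using j0 by auto
    then have "1 * (2 * int M) \<le> \<bar>i\<bar> * (2 * int M)" by (intro mult_right_mono) auto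
    also have "\<dots> = \<bar>k j0\<bar>" by (simp add: ki abs_mult)
    finally show False using kM[of j0] by simp
  qed
  ultimately have "C = 0" by (simp add: sum_power2_eq_zero_iff)
  then show ?thesis by (simp add: C_def a_def)
qed

text \<open>Absence of aliasing: the grid average is the constant term, independent of
  \<open>x\<close> and \<open>M\<close>. This makes the grid mollification below a true average with
  constant normalization.\<close>

lemma trig_sum_int_grid_mean:
  fixes k :: "nat \<Rightarrow> 'n::finite \<Rightarrow> int"
  assumes L: "0 < L" and M: "d < 2 * M" and k: "\<And>i j. \<bar>k i j\<bar> \<le> int d"
    and h: "h = L / (2 * real M)"
  shows "(\<Sum>m\<in>int_grid M. trig_sum {..<N} c (\<lambda>i. lattice_vec (2 * pi / L) (k i)) \<theta> (x - lattice_vec h m)) =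
     real (card (int_grid M :: ('n \<Rightarrow> int) set)) * (\<Sum>i<N. if k i = (\<lambda>_. 0) then c i * cos (\<theta> i) else 0)"
proof -
  have "(\<Sum>m\<in>int_grid M. trig_sum {..<N} c (\<lambda>i. lattice_vec (2 * pi / L) (k i)) \<theta> (x - lattice_vec h m)) =
    (\<Sum>i<N. c i * (\<Sum>m\<in>int_grid M. cos (lattice_vec (2 * pi / L) (k i) \<bullet> (x - lattice_vec h m) + \<theta> i)))"
    unfolding trig_sum_def by (subst sum.swap) (simp add: sum_distrib_left)
  also have "\<dots> = (\<Sum>i<N. real (card (int_grid M :: ('n \<Rightarrow> int) set)) * (if k i = (\<lambda>_. 0) then c i * cos (\<theta> i) else 0))"
  proof (rule sum.cong[OF refl])
    fix i
    show "c i * (\<Sum>m\<in>int_grid M. cos (lattice_vec (2 * pi / L) (k i) \<bullet> (x - lattice_vec h m) + \<theta> i)) =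
      real (card (int_grid M :: ('n \<Rightarrow> int) set)) * (if k i = (\<lambda>_. 0) then c i * cos (\<theta> i) else 0)"
    proof (cases "k i = (\<lambda>_. 0)")
      case True
      then have "lattice_vec (2 * pi / L) (k i) = 0" by (simp add: vec_eq_iff)
      then show ?thesis using True by simp
    next
      case False
      have "\<bar>k i j\<bar> < 2 * int M" for j using k[of i j] M by linarith
      then show ?thesis using sum_cos_int_grid[OF L _ False _ h] M False by simp
    qed
  qed
  finally show ?thesis by (simp add: sum_distrib_left)
qed

text \<open>Equal to \<open>cos (pi * s / L) ^ (2 * N)\<close>, the de la Vallee-Poussin kernel
  without normalization: nonnegative, of period \<open>L\<close>, of degree \<open>N\<close>, and
  concentrated at the multiples of \<open>L\<close> as \<open>N\<close> grows.\<close>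

definition cos_kernel :: "real \<Rightarrow> nat \<Rightarrow> real \<Rightarrow> real" where
  "cos_kernel L N s = ((1 + cos (2 * pi / L * s)) / 2) ^ N"

lemma half_one_plus_cos_nonneg: "0 \<le> (1 + cos t) / 2" for t :: real
proof -
  have "0 \<le> 1 + cos t" using cos_ge_minus_one[of t] by linarith
  then show ?thesis by simp
qed

lemma cos_kernel_nonneg: "0 \<le> cos_kernel L N s"
  unfolding cos_kernel_def by (intro zero_le_power half_one_plus_cos_nonneg)

lemma cos_kernel_even: "cos_kernel L N \<bar>s\<bar> = cos_kernel L N s"
  by (simp add: cos_kernel_def abs_if)

lemma cos_kernel_periodic:
  assumes "L \<noteq> 0"
  shows "cos_kernel L N (s + L * of_int k) = cos_kernel L N s"
proof -
  have "2 * pi / L * (s + L * of_int k) = 2 * pi / L * s + 2 * pi * of_int k"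
    using assms by (simp add: field_simps)
  then show ?thesis unfolding cos_kernel_def using cos_int_2pin[of k] sin_int_2pin[of k] by (simp add: cos_add mult_ac)
qed

text \<open>Beyond distance \<open>d\<close> the base of the power is at most \<open>Q1\<close>,
  within \<open>d / 2\<close> it is at least \<open>Q2 > Q1\<close>. There are at most
  \<open>2 * M\<close> far terms and at least \<open>d / (2 * h)\<close> near ones, so
  \<open>M\<close> cancels from the ratio and \<open>N\<close> can be fixed before the grid.\<close>

lemma cos_kernel_concentration:
  assumes L: "0 < L" and d: "0 < d" "d \<le> L / 8" and \<theta>: "0 < \<theta>"
  obtains N where "\<And>M s. 0 < M \<Longrightarrow> L / (2 * real M) \<le> d / 2 \<Longrightarrow> \<bar>s\<bar> \<le> L / 8 \<Longrightarrow>
    (\<Sum>k\<in>{- int M..<int M}. if d \<le> \<bar>s - L / (2 * real M) * of_int k\<bar> then cos_kernel L N (s - L / (2 * real M) * of_int k) else 0)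
      \<le> \<theta> * (\<Sum>k\<in>{- int M..<int M}. cos_kernel L N (s - L / (2 * real M) * of_int k))"
proof -
  define w where "w = 2 * pi / L"
  have w: "w > 0" using L by (simp add: w_def)
  have wd: "w * d \<le> pi / 4" using d L mult_left_mono[OF d(2), of w] w by (simp add: w_def field_simps)
  have wd_pi: "w * d \<le> pi" using wd pi_gt_zero by linarith
  define Q1 where "Q1 = (1 + cos (w * d)) / 2"
  define Q2 where "Q2 = (1 + cos (w * (d / 2))) / 2"
  have Q1: "0 \<le> Q1" unfolding Q1_def by (rule half_one_plus_cos_nonneg)
  have "cos (w * d) < cos (w * (d / 2))" using w d wd_pi by (intro cos_monotone_0_pi) auto
  then have Q12: "Q1 < Q2" by (simp add: Q1_def Q2_def)
  have "(\<lambda>N. 2 * L / d * (Q1 / Q2) ^ N) \<longlonglongrightarrow> 2 * L / d * 0"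
    using Q1 Q12 by (intro tendsto_mult tendsto_const LIMSEQ_power_zero) auto
  then have "\<forall>\<^sub>F N in sequentially. 2 * L / d * (Q1 / Q2) ^ N < \<theta>" using \<theta> by (intro order_tendstoD(2)[of _ 0]) auto
  then obtain N where N: "2 * L / d * (Q1 / Q2) ^ N < \<theta>" by (auto simp: eventually_sequentially)
  show ?thesis
  proof (rule that[of N])
    fix M :: nat and s :: real
    assume M: "0 < M" and hd: "L / (2 * real M) \<le> d / 2" and s: "\<bar>s\<bar> \<le> L / 8"
    define h where "h = L / (2 * real M)"
    have h: "h > 0" "h * M = L / 2" using L M by (simp_all add: h_def)
    have far: "(if d \<le> \<bar>s - h * of_int k\<bar> then cos_kernel L N (s - h * of_int k) else 0) \<le> Q1 ^ N"
      if k: "k \<in> {- int M..<int M}" for k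
    proof (cases "d \<le> \<bar>s - h * of_int k\<bar>")
      case True
      define t where "t = \<bar>s - h * of_int k\<bar>"
      have "\<bar>k\<bar> \<le> int M" using k by auto
      then have "\<bar>real_of_int k\<bar> \<le> real M" by linarith
      then have "h * \<bar>real_of_int k\<bar> \<le> h * real M" using h by (intro mult_left_mono) auto
      then have "\<bar>h * of_int k\<bar> \<le> L / 2" using h by (simp add: abs_mult)
      \<comment> \<open>\<open>t\<close> may pass half a period, but by no more than
        \<open>L / 8\<close>; if \<open>w * t\<close> exceeds \<open>pi\<close>, then
        \<open>2 * pi - w * t\<close> is still at least \<open>3 * pi / 4\<close>, hence above
        \<open>w * d\<close>.\<close>
      then have t5: "t \<le> 5 * L / 8" using s unfolding t_def by linarith
      have "cos (w * t) \<le> cos (w * d)"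
      proof (cases "w * t \<le> pi")
        case True
        have "w * d \<le> w * t" using \<open>d \<le> \<bar>s - h * of_int k\<bar>\<close> w by (simp add: t_def)
        then show ?thesis using w d True by (intro cos_monotone_0_pi_le) auto
      next
        case False
        have "w * t \<le> w * (5 * L / 8)" using t5 w by simp
        also have "\<dots> = 5 * pi / 4" using L by (simp add: w_def field_simps)
        finally have "w * d \<le> 2 * pi - w * t" "2 * pi - w * t \<le> pi" using wd False by linarith+
        then have "cos (2 * pi - w * t) \<le> cos (w * d)" using w d by (intro cos_monotone_0_pi_le) auto
        then show ?thesis by simp
      qed
      then have "((1 + cos (w * t)) / 2) ^ N \<le> Q1 ^ N"
        unfolding Q1_def by (intro power_mono half_one_plus_cos_nonneg) auto
      moreover have "cos_kernel L N (s - h * of_int k) = ((1 + cos (w * t)) / 2) ^ N"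
        using cos_kernel_even[of L N "s - h * of_int k"] unfolding t_def[symmetric] cos_kernel_def[of L N t] w_def by (rule sym)
      ultimately show ?thesis using True by simp
    qed (use Q1 in simp)
    have "(\<Sum>k\<in>{- int M..<int M}. if d \<le> \<bar>s - h * of_int k\<bar> then cos_kernel L N (s - h * of_int k) else 0) \<le> (\<Sum>k\<in>{- int M..<int M}. Q1 ^ N)"
      by (intro sum_mono far)
    then have F: "(\<Sum>k\<in>{- int M..<int M}. if d \<le> \<bar>s - h * of_int k\<bar> then cos_kernel L N (s - h * of_int k) else 0) \<le> 2 * real M * Q1 ^ N"
      by simp
    \<comment> \<open>The integers between \<open>a\<close> and \<open>b\<close> index the grid
      points within \<open>d / 2\<close> of \<open>s\<close>. There are at least
      \<open>d / h - 1\<close> of them, hence at least \<open>d / (2 * h)\<close> because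
      \<open>h \<le> d / 2\<close>.\<close>
    define a b where "a = (s - d / 2) / h" and "b = (s + d / 2) / h"
    have ba: "b - a = d / h" using h by (simp add: a_def b_def field_simps)
    have A: "\<bar>s - h * of_int k\<bar> \<le> d / 2 \<and> k \<in> {- int M..<int M}" if k: "k \<in> {\<lceil>a\<rceil>..\<lfloor>b\<rfloor>}" for k
    proof -
      have "a \<le> of_int k" "of_int k \<le> b" using k by (auto simp: ceiling_le_iff le_floor_iff)
      then have ab: "s - d / 2 \<le> h * of_int k" "h * of_int k \<le> s + d / 2" using h by (simp_all add: a_def b_def field_simps)
      then have 1: "\<bar>s - h * of_int k\<bar> \<le> d / 2" by linarith
      have "h * (- real M) < h * of_int k" "h * of_int k < h * real M"
        using ab s d L unfolding mult_minus_right h(2) by linarith+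
      then have "- real M < of_int k" "real_of_int k < real M"
        using mult_less_cancel_left_pos[OF h(1)] by blast+
      then have "k \<in> {- int M..<int M}" by auto
      with 1 show ?thesis by blast
    qed
    have near: "Q2 ^ N \<le> cos_kernel L N (s - h * of_int k)" if "k \<in> {\<lceil>a\<rceil>..\<lfloor>b\<rfloor>}" for k
    proof -
      define t where "t = \<bar>s - h * of_int k\<bar>"
      have "t \<le> d / 2" using A[OF that] by (simp add: t_def)
      then have "w * t \<le> w * (d / 2)" using w by simp
      moreover have "w * (d / 2) \<le> pi" using wd_pi mult_pos_pos[OF w d(1)] by linarith
      ultimately have "cos (w * (d / 2)) \<le> cos (w * t)" using w by (intro cos_monotone_0_pi_le) (auto simp: t_def)
      then have "Q2 ^ N \<le> ((1 + cos (w * t)) / 2) ^ N" using Q1 Q12 unfolding Q2_def by (intro power_mono) auto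
      moreover have "cos_kernel L N (s - h * of_int k) = ((1 + cos (w * t)) / 2) ^ N"
        using cos_kernel_even[of L N "s - h * of_int k"] unfolding t_def[symmetric] cos_kernel_def[of L N t] w_def by (rule sym)
      ultimately show ?thesis by simp
    qed
    have "d / (2 * h) \<le> real (card {\<lceil>a\<rceil>..\<lfloor>b\<rfloor>})"
    proof -
      have "b - a - 1 \<le> of_int (\<lfloor>b\<rfloor> - \<lceil>a\<rceil> + 1)" by linarith
      also have "\<dots> \<le> real (nat (\<lfloor>b\<rfloor> - \<lceil>a\<rceil> + 1))" by linarith
      also have "\<dots> = real (card {\<lceil>a\<rceil>..\<lfloor>b\<rfloor>})" by simp
      finally have "d / h - 1 \<le> real (card {\<lceil>a\<rceil>..\<lfloor>b\<rfloor>})" by (simp add: ba)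
      moreover have "1 \<le> d / (2 * h)" using hd[folded h_def] h(1) by (simp add: field_simps)
      moreover have "d / h = d / (2 * h) + d / (2 * h)" using h by (simp add: field_simps)
      ultimately show ?thesis by linarith
    qed
    then have "d / (2 * h) * Q2 ^ N \<le> real (card {\<lceil>a\<rceil>..\<lfloor>b\<rfloor>}) * Q2 ^ N" using Q1 Q12 by (intro mult_right_mono) auto
    also have "\<dots> = (\<Sum>k\<in>{\<lceil>a\<rceil>..\<lfloor>b\<rfloor>}. Q2 ^ N)" by simp
    also have "\<dots> \<le> (\<Sum>k\<in>{\<lceil>a\<rceil>..\<lfloor>b\<rfloor>}. cos_kernel L N (s - h * of_int k))" by (intro sum_mono near)
    also have "\<dots> \<le> (\<Sum>k\<in>{- int M..<int M}. cos_kernel L N (s - h * of_int k))"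
      using A cos_kernel_nonneg by (intro sum_mono2) auto
    finally have G: "d / (2 * h) * Q2 ^ N \<le> (\<Sum>k\<in>{- int M..<int M}. cos_kernel L N (s - h * of_int k))" .
    have "2 * real M * Q1 ^ N \<le> \<theta> * (d / (2 * h) * Q2 ^ N)"
    proof -
      have "(2 * L / d * (Q1 / Q2) ^ N) * (d * real M / L * Q2 ^ N) \<le> \<theta> * (d * real M / L * Q2 ^ N)"
        using N d L Q1 Q12 by (intro mult_right_mono) auto
      moreover have "(2 * L / d * (Q1 / Q2) ^ N) * (d * real M / L * Q2 ^ N) = 2 * real M * Q1 ^ N"
        using d L Q1 Q12 by (simp add: power_divide)
      moreover have "d / (2 * h) = d * real M / L" using L M by (simp add: h_def)
      ultimately show ?thesis by simp
    qed
    also have "\<dots> \<le> \<theta> * (\<Sum>k\<in>{- int M..<int M}. cos_kernel L N (s - h * of_int k))"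
      using G \<theta> by (intro mult_left_mono) auto
    finally show "(\<Sum>k\<in>{- int M..<int M}. if d \<le> \<bar>s - L / (2 * real M) * of_int k\<bar> then cos_kernel L N (s - L / (2 * real M) * of_int k) else 0)
      \<le> \<theta> * (\<Sum>k\<in>{- int M..<int M}. cos_kernel L N (s - L / (2 * real M) * of_int k))"
      using F unfolding h_def by linarith
  qed
qed

definition torus_kernel :: "real \<Rightarrow> nat \<Rightarrow> real^'n \<Rightarrow> real" where
  "torus_kernel L N x = (\<Prod>j\<in>UNIV. cos_kernel L N (x $ j))"

lemma torus_kernel_nonneg: "0 \<le> torus_kernel L N x"
  unfolding torus_kernel_def by (intro prod_nonneg cos_kernel_nonneg)

lemma torus_kernel_0 [simp]: "torus_kernel L N 0 = 1"
  by (simp add: torus_kernel_def cos_kernel_def)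

lemma torus_kernel_periodic: "L \<noteq> 0 \<Longrightarrow> torus_kernel L N (x + lattice_vec L k) = torus_kernel L N x"
  by (simp add: torus_kernel_def cos_kernel_periodic)

lemma trig_poly_torus_kernel: "trig_poly L (CARD('n) * N) (torus_kernel L N :: real^'n \<Rightarrow> real)"
proof -
  have "trig_poly L 1 (\<lambda>x::real^'n. (1 + cos (2 * pi / L * x $ j)) / 2)" for j
  proof -
    define k where "k = (\<lambda>i. if i = j then 1 else 0 :: int)"
    have "lattice_vec (2 * pi / L) k = (2 * pi / L) *\<^sub>R axis j 1" by (auto simp: vec_eq_iff k_def axis_def)
    then have "lattice_vec (2 * pi / L) k \<bullet> x = 2 * pi / L * x $ j" for x by (simp add: axis_inner)
    moreover have "trig_poly L 1 (\<lambda>x::real^'n. 1 / 2 + 1 / 2 * cos (lattice_vec (2 * pi / L) k \<bullet> x + 0))"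
      by (intro trig_poly_add trig_poly_const trig_poly_single) (auto simp: k_def)
    ultimately show ?thesis by (simp add: add_divide_distrib)
  qed
  then have "trig_poly L (CARD('n) * (N * 1)) (\<lambda>x::real^'n. \<Prod>j\<in>UNIV. ((1 + cos (2 * pi / L * x $ j)) / 2) ^ N)"
    by (intro trig_poly_prod trig_poly_power) auto
  then show ?thesis by (simp add: torus_kernel_def[abs_def] cos_kernel_def)
qed

text \<open>Union bound over the coordinates: a point outside the cube is far in some coordinate,
  and since sums over the grid factorize, each coordinate contributes at most the fraction
  \<open>1 / (2 * CARD('n))\<close> of the total.\<close>

lemma torus_kernel_concentration:
  assumes L: "0 < L" and d: "0 < d" "d \<le> L / 8"
  obtains N where "\<And>M (x::real^'n). 0 < M \<Longrightarrow> L / (2 * real M) \<le> d / 2 \<Longrightarrow> (\<And>j. \<bar>x $ j\<bar> \<le> L / 8) \<Longrightarrow>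
    (\<Sum>m\<in>int_grid M. if (\<forall>j. \<bar>(x - lattice_vec (L / (2 * real M)) m) $ j\<bar> < d) then torus_kernel L N (x - lattice_vec (L / (2 * real M)) m) else 0)
      \<ge> 1 / 2 * (\<Sum>m\<in>int_grid M. torus_kernel L N (x - lattice_vec (L / (2 * real M)) m))"
proof -
  define \<theta> where "\<theta> = 1 / (2 * real CARD('n))"
  have \<theta>: "\<theta> > 0" by (simp add: \<theta>_def)
  obtain N where N: "\<And>M s. 0 < M \<Longrightarrow> L / (2 * real M) \<le> d / 2 \<Longrightarrow> \<bar>s\<bar> \<le> L / 8 \<Longrightarrow>
    (\<Sum>k\<in>{- int M..<int M}. if d \<le> \<bar>s - L / (2 * real M) * of_int k\<bar> then cos_kernel L N (s - L / (2 * real M) * of_int k) else 0)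
      \<le> \<theta> * (\<Sum>k\<in>{- int M..<int M}. cos_kernel L N (s - L / (2 * real M) * of_int k))"
    using cos_kernel_concentration[OF L d \<theta>] by blast
  show ?thesis
  proof (rule that[of N])
    fix M :: nat and x :: "real^'n"
    assume M: "0 < M" and hd: "L / (2 * real M) \<le> d / 2" and x: "\<And>j. \<bar>x $ j\<bar> \<le> L / 8"
    define h where "h = L / (2 * real M)"
    define G :: "('n \<Rightarrow> int) set" where "G = int_grid M"
    have G: "G = PiE UNIV (\<lambda>_. {- int M..<int M})" by (simp add: G_def int_grid_def)
    define F where "F = (\<lambda>m. torus_kernel L N (x - lattice_vec h m))"
    have F: "F m = (\<Prod>j\<in>UNIV. cos_kernel L N (x $ j - h * of_int (m j)))" for m
      by (simp add: F_def torus_kernel_def)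
    have F0: "0 \<le> F m" for m unfolding F_def by (rule torus_kernel_nonneg)
    define Z where "Z = (\<Sum>m\<in>G. F m)"
    define S where "S = (\<lambda>j. \<Sum>k\<in>{- int M..<int M}. cos_kernel L N (x $ j - h * of_int k))"
    have Z: "Z = (\<Prod>j\<in>UNIV. S j)"
      unfolding Z_def F G S_def by (rule prod_sum_PiE[symmetric]) auto
    have far: "(\<Sum>m\<in>G. if d \<le> \<bar>x $ i - h * of_int (m i)\<bar> then F m else 0) \<le> \<theta> * Z" for i
    proof -
      define g where "g = (\<lambda>j k. if j = i then (if d \<le> \<bar>x $ j - h * of_int k\<bar> then cos_kernel L N (x $ j - h * of_int k) else 0) else cos_kernel L N (x $ j - h * of_int k))"
      have "(if d \<le> \<bar>x $ i - h * of_int (m i)\<bar> then F m else 0) = (\<Prod>j\<in>UNIV. g j (m j))" for m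
      proof -
        have "F m = cos_kernel L N (x $ i - h * of_int (m i)) * (\<Prod>j\<in>UNIV - {i}. cos_kernel L N (x $ j - h * of_int (m j)))"
          unfolding F by (subst prod.remove[of _ i]) auto
        moreover have "(\<Prod>j\<in>UNIV. g j (m j)) = g i (m i) * (\<Prod>j\<in>UNIV - {i}. cos_kernel L N (x $ j - h * of_int (m j)))"
          by (subst prod.remove[of _ i]) (auto simp: g_def)
        ultimately show ?thesis by (simp add: g_def)
      qed
      then have "(\<Sum>m\<in>G. if d \<le> \<bar>x $ i - h * of_int (m i)\<bar> then F m else 0) = (\<Sum>m\<in>G. \<Prod>j\<in>UNIV. g j (m j))" by simp
      also have "\<dots> = (\<Prod>j\<in>UNIV. \<Sum>k\<in>{- int M..<int M}. g j k)"
        unfolding G by (rule prod_sum_PiE[symmetric]) auto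
      also have "\<dots> = (\<Sum>k\<in>{- int M..<int M}. g i k) * (\<Prod>j\<in>UNIV - {i}. S j)"
        by (subst prod.remove[of _ i]) (auto simp: g_def S_def)
      also have "(\<Sum>k\<in>{- int M..<int M}. g i k) \<le> \<theta> * S i"
        using N[OF M hd x[of i], folded h_def] by (simp only: g_def S_def if_True refl)
      also have "\<theta> * S i * (\<Prod>j\<in>UNIV - {i}. S j) = \<theta> * Z"
        unfolding Z by (subst (2) prod.remove[of _ i]) auto
      finally show ?thesis by (simp add: mult_right_mono prod_nonneg S_def sum_nonneg cos_kernel_nonneg)
    qed
    have "Z \<le> (\<Sum>m\<in>G. (if (\<forall>j. \<bar>x $ j - h * of_int (m j)\<bar> < d) then F m else 0) + (\<Sum>i\<in>UNIV. if d \<le> \<bar>x $ i - h * of_int (m i)\<bar> then F m else 0))"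
      unfolding Z_def
    proof (rule sum_mono)
      fix m
      show "F m \<le> (if (\<forall>j. \<bar>x $ j - h * of_int (m j)\<bar> < d) then F m else 0) + (\<Sum>i\<in>UNIV. if d \<le> \<bar>x $ i - h * of_int (m i)\<bar> then F m else 0)"
      proof (cases "\<forall>j. \<bar>x $ j - h * of_int (m j)\<bar> < d")
        case True
        then show ?thesis using F0 by (simp add: sum_nonneg)
      next
        case False
        then obtain i where i: "d \<le> \<bar>x $ i - h * of_int (m i)\<bar>" by (auto simp: not_less)
        have "(if d \<le> \<bar>x $ i - h * of_int (m i)\<bar> then F m else 0) \<le> (\<Sum>i\<in>UNIV. if d \<le> \<bar>x $ i - h * of_int (m i)\<bar> then F m else 0)"
          using F0 by (intro member_le_sum) auto
        then show ?thesis using i False F0[of m] by simp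
      qed
    qed
    also have "\<dots> = (\<Sum>m\<in>G. if (\<forall>j. \<bar>x $ j - h * of_int (m j)\<bar> < d) then F m else 0) + (\<Sum>i\<in>UNIV. \<Sum>m\<in>G. if d \<le> \<bar>x $ i - h * of_int (m i)\<bar> then F m else 0)"
      unfolding sum.distrib by (subst sum.swap) simp
    also have "(\<Sum>i\<in>UNIV. \<Sum>m\<in>G. if d \<le> \<bar>x $ i - h * of_int (m i)\<bar> then F m else 0) \<le> (\<Sum>i\<in>(UNIV::'n set). \<theta> * Z)"
      by (intro sum_mono far)
    also have "\<dots> = Z / 2" by (simp add: \<theta>_def)
    finally have "1 / 2 * Z \<le> (\<Sum>m\<in>G. if (\<forall>j. \<bar>x $ j - h * of_int (m j)\<bar> < d) then F m else 0)" by simp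
    then show "(\<Sum>m\<in>int_grid M. if (\<forall>j. \<bar>(x - lattice_vec (L / (2 * real M)) m) $ j\<bar> < d) then torus_kernel L N (x - lattice_vec (L / (2 * real M)) m) else 0)
      \<ge> 1 / 2 * (\<Sum>m\<in>int_grid M. torus_kernel L N (x - lattice_vec (L / (2 * real M)) m))"
      unfolding h_def[symmetric] by (simp add: Z_def F_def G_def cong: if_cong)
  qed
qed

text \<open>Discrete convolution commutes with differences along grid vectors: shifting the
  summation index moves them from the kernel to \<open>w\<close>, so lower bounds for the
  differences of the nonsmooth \<open>w\<close> pass to the sum.\<close>

lemma second_diff_sum_grid:
  fixes w F :: "real^'n \<Rightarrow> real"
  assumes M: "0 < M" and L: "0 < L" and h: "h = L / (2 * real M)"
    and w: "\<And>x k. w (x + lattice_vec L k) = w x" and F: "\<And>x k. F (x + lattice_vec L k) = F x"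
  shows "second_diff (\<lambda>x. \<Sum>m\<in>int_grid M. w (lattice_vec h m) * F (x - lattice_vec h m)) x (lattice_vec h e) =
    (\<Sum>m\<in>int_grid M. second_diff w (lattice_vec h m) (lattice_vec h e) * F (x - lattice_vec h m))"
proof -
  have latM: "lattice_vec h (\<lambda>j. m j + 2 * int M * l j) = lattice_vec h m + lattice_vec L l" for m l :: "'n \<Rightarrow> int"
    using M by (simp add: vec_eq_iff h field_simps)
  have F': "F (x - lattice_vec L k) = F x" for x k
    using F[of "x - lattice_vec L k" k] by simp
  have shift: "(\<Sum>m\<in>int_grid M. w (lattice_vec h m) * F (x + lattice_vec h e - lattice_vec h m)) =
      (\<Sum>m\<in>int_grid M. w (lattice_vec h m + lattice_vec h e) * F (x - lattice_vec h m))" for e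
  proof -
    define f where "f = (\<lambda>m. w (lattice_vec h m) * F (x + lattice_vec h e - lattice_vec h m))"
    have "f (\<lambda>j. m j + 2 * int M * l j) = f m" for m l
    proof -
      have "x + lattice_vec h e - lattice_vec h (\<lambda>j. m j + 2 * int M * l j) = (x + lattice_vec h e - lattice_vec h m) - lattice_vec L l"
        by (simp add: latM)
      then show ?thesis unfolding f_def by (simp only: F' latM w)
    qed
    then have "(\<Sum>m\<in>int_grid M. f m) = (\<Sum>m\<in>int_grid M. f (\<lambda>j. m j + e j))"
      using sum_int_grid_shift[OF M, of f e] by simp
    then show ?thesis by (simp add: f_def lattice_vec_add)
  qed
  have neg: "lattice_vec h (\<lambda>j. - e j) = - lattice_vec h e" for e :: "'n \<Rightarrow> int" by (simp add: vec_eq_iff)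
  show ?thesis
    using shift[of e] shift[of "\<lambda>j. - e j"]
    by (simp add: second_diff_def neg algebra_simps sum.distrib sum_subtractf sum_distrib_left)
qed

text \<open>Each node carries its own cube of volume \<open>h ^ CARD('n)\<close> inside
  \<open>E\<close>, so the measure of \<open>E\<close> bounds the number of nodes, as the discrete
  Monge-Ampere problem demands.\<close>

lemma grid_cubes_volume:
  fixes X :: "(real^'n) set"
  assumes X: "finite X" "X \<subseteq> lattice_vec h ` UNIV" and h: "0 < h" and E: "E \<in> lmeasurable"
    and sub: "\<And>x. x \<in> X \<Longrightarrow> box x (x + (\<chi> j. h)) \<subseteq> E"
  shows "real (card X) * h ^ CARD('n) \<le> measure lebesgue E"
proof -
  define Q where "Q = (\<lambda>x::real^'n. box x (x + (\<chi> j. h)))"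
  have Q: "measure lebesgue (Q x) = h ^ CARD('n)" for x
  proof -
    have "x \<in> cbox x (x + (\<chi> j. h))" using h by (simp add: mem_box_cart)
    then have "measure lborel (cbox x (x + (\<chi> j. h))) = h ^ CARD('n)" by (subst content_cbox_cart) auto
    moreover have "measure lebesgue (box x (x + (\<chi> j. h))) = measure lborel (cbox x (x + (\<chi> j. h)))"
      by (simp add: measure_lborel_box_eq measure_lborel_cbox_eq)
    ultimately show ?thesis by (simp add: Q_def)
  qed
  have disj: "Q x \<inter> Q y = {}" if xy: "x \<in> X" "y \<in> X" "x \<noteq> y" for x y
  proof (rule ccontr)
    assume "Q x \<inter> Q y \<noteq> {}"
    then obtain z where z: "z \<in> Q x" "z \<in> Q y" by blast
    obtain k l where kl: "x = lattice_vec h k" "y = lattice_vec h l" using xy X(2) by blast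
    have "k j = l j" for j
    proof -
      have "x $ j < z $ j" "z $ j < x $ j + h" "y $ j < z $ j" "z $ j < y $ j + h"
        using z by (auto simp: Q_def mem_box_cart)
      then have "h * of_int (k j) < h * (of_int (l j) + 1)" "h * of_int (l j) < h * (of_int (k j) + 1)"
        by (auto simp: kl distrib_left)
      then have "real_of_int (k j) < of_int (l j) + 1" "real_of_int (l j) < of_int (k j) + 1"
        using mult_less_cancel_left_pos[OF h] by blast+
      then show ?thesis by linarith
    qed
    then show False using kl xy(3) by (simp add: vec_eq_iff)
  qed
  have "real (card X) * h ^ CARD('n) = (\<Sum>x\<in>X. measure lebesgue (Q x))" by (simp add: Q)
  also have "\<dots> = measure lebesgue (\<Union>x\<in>X. Q x)"
    using X(1) disj by (intro measure_finite_Union[symmetric]) (auto simp: disjoint_family_on_def Q_def emeasure_lborel_box_finite[unfolded infinity_ennreal_def, THEN less_imp_neq])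
  also have "\<dots> \<le> measure lebesgue E"
    using X(1) sub E by (intro measure_mono_fmeasurable) (auto simp: Q_def)
  finally show ?thesis .
qed

text \<open>The trigonometric polynomial below replaces the solution of a Monge-Ampere equation with
  right-hand side \<open>1\<^sub>E\<close>: it is small, almost convex, and its Laplacian is bounded below on \<open>K\<close>.\<close>

proposition semiconvex_trig_sum_exists:
  fixes K E :: "(real^'n) set"
  defines "n \<equiv> real CARD('n)"
  assumes L: "0 < L" and K: "compact K" "K \<subseteq> E" and E: "open E" "E \<subseteq> ball 0 (L / 8)"
    and \<rho>: "0 < \<rho>" and vol: "measure lebesgue E \<le> (2 * \<rho>) ^ CARD('n)"
  obtains I :: "(('n \<Rightarrow> int) \<times> nat) set" and c k \<theta>
  where "semiconvex_trig I c (\<lambda>i. lattice_vec (2 * pi / L) (k i)) \<theta> (L * n ^ 3 * \<rho>) (8 * n / L * \<rho>)"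
    and "\<And>x. x \<in> K \<Longrightarrow> 1 / 24 - 4 * n\<^sup>2 / L * \<rho> \<le> (\<Sum>j\<in>UNIV. trig_hess I c (\<lambda>i. lattice_vec (2 * pi / L) (k i)) \<theta> x (axis j 1))"
proof -
  have n: "n \<ge> 1" by (simp add: n_def Suc_leI)
  obtain d0 where d0: "0 < d0" "\<And>x y. x \<in> K \<Longrightarrow> y \<notin> E \<Longrightarrow> d0 \<le> dist x y"
  proof -
    have "closed (- E)" "K \<inter> - E = {}" using E K by auto
    then obtain d where "0 < d" "\<forall>x\<in>K. \<forall>y\<in>- E. d \<le> dist x y" using separate_compact_closed[OF K(1)] by blast
    then show ?thesis using that by blast
  qed
  \<comment> \<open>A point whose coordinates differ by at most \<open>2 * d\<close> from those of a
    point of \<open>K\<close> is closer to it than \<open>d0\<close>, hence in \<open>E\<close>. The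
    bound \<open>L / 8\<close> is what the concentration of the kernel asks for.\<close>
  define d where "d = min (L / 8) (d0 / (4 * n))"
  have d: "0 < d" "d \<le> L / 8" "2 * d * n < d0" 
  proof -
    have "2 * d * n \<le> 2 * (d0 / (4 * n)) * n" using n by (intro mult_left_mono mult_right_mono) (auto simp: d_def)
    also have "\<dots> < d0" using n d0 by simp
    finally show "2 * d * n < d0" .
  qed (use L d0 n in \<open>auto simp: d_def\<close>)
  obtain N where conc: "\<And>M (x::real^'n). 0 < M \<Longrightarrow> L / (2 * real M) \<le> d / 2 \<Longrightarrow> (\<And>j. \<bar>x $ j\<bar> \<le> L / 8) \<Longrightarrow>
    (\<Sum>m\<in>int_grid M. if (\<forall>j. \<bar>(x - lattice_vec (L / (2 * real M)) m) $ j\<bar> < d) then torus_kernel L N (x - lattice_vec (L / (2 * real M)) m) else 0)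
      \<ge> 1 / 2 * (\<Sum>m\<in>int_grid M. torus_kernel L N (x - lattice_vec (L / (2 * real M)) m))"
    using torus_kernel_concentration[OF L d(1,2)] by blast
  define F :: "real^'n \<Rightarrow> real" where "F = torus_kernel L N"
  obtain N' a l \<eta> where F: "F = trig_sum {..<N'::nat} a (\<lambda>i. lattice_vec (2 * pi / L) (l i)) \<eta>"
    and l: "\<And>i j. \<bar>l i j\<bar> \<le> int (CARD('n) * N)"
    using trig_poly_imp_trig_sum[OF trig_poly_torus_kernel, of L N] unfolding F_def by blast
  define \<Xi> where "\<Xi> = (\<lambda>i. lattice_vec (2 * pi / L) (l i) :: real^'n)"
  define Fm where "Fm = (\<Sum>i<N'. if l i = (\<lambda>_. 0) then a i * cos (\<eta> i) else 0)"
  have F0: "0 \<le> F x" for x by (simp add: F_def torus_kernel_nonneg)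
  have mean: "(\<Sum>m\<in>int_grid M. F (x - lattice_vec (L / (2 * real M)) m)) = real (card (int_grid M :: ('n \<Rightarrow> int) set)) * Fm"
    if "CARD('n) * N < 2 * M" for M x
    unfolding F Fm_def by (rule trig_sum_int_grid_mean[OF L that l refl])
  have card_pos: "0 < real (card (int_grid M :: ('n \<Rightarrow> int) set))" if "0 < M" for M
  proof -
    have "(\<lambda>_. 0) \<in> int_grid M" using that by (simp add: mem_int_grid)
    then show ?thesis by (metis card_gt_0_iff empty_iff finite_int_grid of_nat_0_less_iff)
  qed
  have lat0: "lattice_vec h (\<lambda>_. 0) = 0" for h by (simp add: vec_eq_iff)
  \<comment> \<open>\<open>Fm\<close> is the average of the nonnegative kernel over any sufficiently
    fine grid, and the origin contributes \<open>F 0 = 1\<close>.\<close>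
  have Fm: "0 < Fm"
  proof -
    define M where "M = CARD('n) * N + 1"
    have "F (0 - lattice_vec (L / (2 * real M)) (\<lambda>_. 0)) \<le> (\<Sum>m\<in>int_grid M. F (0 - lattice_vec (L / (2 * real M)) m))"
    proof (rule member_le_sum)
      have "0 < M" by (simp add: M_def)
      then show "(\<lambda>_. 0) \<in> int_grid M" by (simp add: mem_int_grid)
    qed (auto simp: F0)
    then have "0 < (\<Sum>m\<in>int_grid M. F (0 - lattice_vec (L / (2 * real M)) m))" by (simp add: lat0) (simp add: F_def)
    then show ?thesis using card_pos[of M] by (subst (asm) mean) (auto simp: M_def zero_less_mult_iff)
  qed
  define K1 where "K1 = L * n ^ 3 * \<rho>"
  have K1: "0 \<le> K1" using L n \<rho> by (simp add: K1_def)
  \<comment> \<open>Bounds for the second and fourth derivatives of the mollified function that do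
    not depend on the grid; they let \<open>P\<close> be chosen before \<open>M\<close>.\<close>
  define B where "B = K1 / Fm * (\<Sum>i<N'. \<bar>a i\<bar> * norm (\<Xi> i) ^ 2)"
  define C where "C = K1 / Fm * (\<Sum>i<N'. \<bar>a i\<bar> * norm (\<Xi> i) ^ 4)"
  have B: "0 \<le> B" and C: "0 \<le> C" unfolding B_def C_def using K1 Fm by (intro mult_nonneg_nonneg sum_nonneg; simp)+
  define \<kappa> where "\<kappa> = 4 * n / L * \<rho>"
  have \<kappa>: "0 < \<kappa>" using n L \<rho> by (simp add: \<kappa>_def)
  \<comment> \<open>Dividing the inequality \<open>slack\<close> by \<kappa> leaves
    \<open>p * P + q < P\<^sup>2\<close>, which \<open>P = p + q + 1\<close> satisfies.\<close>
  define p where "p = 2 * n + 2 * B * n / \<kappa>"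
  define q where "q = n\<^sup>2 + B * n\<^sup>2 / \<kappa>"
  define P where "P = p + q + 1"
  have pq: "0 \<le> p" "0 \<le> q" using n B \<kappa> by (auto simp: p_def q_def)
  then have P: "1 \<le> P" by (simp add: P_def)
  have slack: "\<kappa> * (P + n)\<^sup>2 + B * (n * (2 * P + n)) < 2 * \<kappa> * P\<^sup>2"
  proof -
    have "p * P + q < P\<^sup>2"
    proof -
      have "q * 1 \<le> q * P" using P pq by (intro mult_left_mono) auto
      then have "p * P + q < p * P + q * P + P" using P by linarith
      also have "\<dots> = P\<^sup>2" by (simp add: P_def power2_eq_square algebra_simps)
      finally show ?thesis .
    qed
    then have "\<kappa> * (p * P + q) < \<kappa> * P\<^sup>2" using \<kappa> by simp
    moreover have "\<kappa> * (p * P + q) = \<kappa> * (2 * n * P + n\<^sup>2) + B * (n * (2 * P + n))"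
      using \<kappa> by (simp add: p_def q_def field_simps power2_eq_square)
    moreover have "\<kappa> * (P + n)\<^sup>2 = \<kappa> * P\<^sup>2 + \<kappa> * (2 * n * P + n\<^sup>2)" by (simp add: power2_eq_square algebra_simps)
    ultimately show ?thesis by linarith
  qed
  define hM where "hM = (\<lambda>M. L / (2 * real M))"
  have hM0: "hM \<longlonglongrightarrow> 0"
  proof -
    have "(\<lambda>M. (L / 2) * (1 / real M)) \<longlonglongrightarrow> (L / 2) * 0" by (intro tendsto_mult tendsto_const lim_1_over_n)
    then show ?thesis by (simp add: hM_def)
  qed
  have "(\<lambda>M. C * (hM M)\<^sup>2 * (P + n) ^ 4) \<longlonglongrightarrow> C * 0\<^sup>2 * (P + n) ^ 4" by (intro tendsto_intros hM0)
  then have ev1: "\<forall>\<^sub>F M in sequentially. C * (hM M)\<^sup>2 * (P + n) ^ 4 < 2 * \<kappa> * P\<^sup>2 - (\<kappa> * (P + n)\<^sup>2 + B * (n * (2 * P + n)))"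
    using slack by (intro order_tendstoD(2)[of _ "C * 0\<^sup>2 * (P + n) ^ 4"]) auto
  have "(\<lambda>M. n * C * (hM M)\<^sup>2) \<longlonglongrightarrow> n * C * 0\<^sup>2" by (intro tendsto_intros hM0)
  then have ev2: "\<forall>\<^sub>F M in sequentially. n * C * (hM M)\<^sup>2 < 1 / 24" by (intro order_tendstoD(2)[of _ "n * C * 0\<^sup>2"]) auto
  have ev3: "\<forall>\<^sub>F M in sequentially. hM M < d / 2" using d by (intro order_tendstoD(2)[OF hM0]) auto
  have ev4: "\<forall>\<^sub>F M in sequentially. CARD('n) * N + 1 \<le> M" by (rule eventually_ge_at_top)
  \<comment> \<open>The grid is taken last: it resolves the degree of the kernel, and its spacing
    makes the Taylor errors small against constants that are already fixed.\<close>
  obtain M where M1: "C * (hM M)\<^sup>2 * (P + n) ^ 4 < 2 * \<kappa> * P\<^sup>2 - (\<kappa> * (P + n)\<^sup>2 + B * (n * (2 * P + n)))"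
    and M2: "n * C * (hM M)\<^sup>2 < 1 / 24" and M3: "hM M < d / 2" and M4: "CARD('n) * N + 1 \<le> M"
    using eventually_conj[OF ev1 eventually_conj[OF ev2 eventually_conj[OF ev3 ev4]]]
    by (auto simp: eventually_sequentially)
  define h where "h = hM M"
  have M0: "0 < M" and MN: "CARD('n) * N < 2 * M" using M4 by auto
  have h: "0 < h" using L M0 by (simp add: h_def hM_def)
  have hd: "h < d / 2" using M3 by (simp add: h_def)
  define G :: "('n \<Rightarrow> int) set" where "G = int_grid M"
  have finG: "finite G" by (simp add: G_def)
  define Z where "Z = real (card G) * Fm"
  have Z: "0 < Z" using card_pos[OF M0] Fm by (simp add: Z_def G_def)
  have sumF: "(\<Sum>m\<in>G. F (x - lattice_vec h m)) = Z" for x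
    unfolding G_def h_def hM_def Z_def by (rule mean[OF MN])
  \<comment> \<open>Grid points near \<open>K\<close>: they capture at least half of the kernel mass
    seen from any point of \<open>K\<close>, while their cubes still lie in
    \<open>E\<close>.\<close>
  define nodes where "nodes = {m \<in> G. \<exists>x\<in>K. \<forall>j. \<bar>(x - lattice_vec h m) $ j\<bar> < d}"
  define X where "X = (lattice_vec h ` nodes :: (real^'n) set)"
  have finX: "finite X" using finG by (simp add: X_def nodes_def)
  have XE: "y \<in> E" if m: "m \<in> nodes" and y: "\<And>j. \<bar>(y - lattice_vec h m) $ j\<bar> \<le> h" for m y
  proof (rule ccontr)
    assume "y \<notin> E"
    obtain x where x: "x \<in> K" "\<And>j. \<bar>(x - lattice_vec h m) $ j\<bar> < d" using m by (auto simp: nodes_def)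
    have "\<bar>(x - y) $ j\<bar> \<le> 2 * d" for j
    proof -
      have "(x - y) $ j = (x - lattice_vec h m) $ j - (y - lattice_vec h m) $ j" by simp
      also have "\<bar>\<dots>\<bar> \<le> \<bar>(x - lattice_vec h m) $ j\<bar> + \<bar>(y - lattice_vec h m) $ j\<bar>" by (rule abs_triangle_ineq4)
      also have "\<dots> \<le> 2 * d" using x(2)[of j] y[of j] hd d by linarith
      finally show ?thesis .
    qed
    then have "norm (x - y) \<le> n * (2 * d)" unfolding n_def by (rule norm_le_card_mult)
    then have "dist x y < d0" using d(3) by (simp add: dist_norm mult_ac)
    with d0(2)[OF x(1) \<open>y \<notin> E\<close>] show False by simp
  qed
  have X_ball: "X \<subseteq> cball 0 (L / 4)"
  proof
    fix x assume "x \<in> X"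
    then obtain m where "m \<in> nodes" "x = lattice_vec h m" by (auto simp: X_def)
    then have "x \<in> E" using h by (intro XE) auto
    then show "x \<in> cball 0 (L / 4)" using E L by (auto simp: subset_iff)
  qed
  have Elm: "E \<in> lmeasurable"
    using E by (intro bounded_set_imp_lmeasurable) (auto intro: bounded_subset)
  have cardX: "real (card X) * h ^ CARD('n) \<le> (2 * \<rho>) ^ CARD('n)"
  proof -
    have "real (card X) * h ^ CARD('n) \<le> measure lebesgue E"
    proof (rule grid_cubes_volume[OF finX _ h Elm])
      show "X \<subseteq> lattice_vec h ` UNIV" by (auto simp: X_def)
      fix x assume "x \<in> X"
      then obtain m where m: "m \<in> nodes" "x = lattice_vec h m" by (auto simp: X_def)
      show "box x (x + (\<chi> j. h)) \<subseteq> E"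
      proof
        fix y assume y: "y \<in> box x (x + (\<chi> j. h))"
        show "y \<in> E"
        proof (rule XE[OF m(1)])
          fix j
          have "x $ j < y $ j" "y $ j < x $ j + h" using y by (auto simp: mem_box_cart)
          then show "\<bar>(y - lattice_vec h m) $ j\<bar> \<le> h" by (simp add: m(2))
        qed
      qed
    qed
    then show ?thesis using vol by linarith
  qed
  obtain w :: "real^'n \<Rightarrow> real" where w: "\<And>x k. w (x + lattice_vec L k) = w x"
    "\<And>x. \<bar>w x\<bar> \<le> (L * real CARD('n) ^ 3) * \<rho>"
    "\<And>x z. - (4 * real CARD('n) / L * \<rho>) * (norm z)\<^sup>2 \<le> second_diff w x z"
    "\<And>x. x \<in> X \<Longrightarrow> \<exists>j. (1 / 6 - 4 * real CARD('n) / L * \<rho>) * h\<^sup>2 \<le> second_diff w x (h *\<^sub>R axis j 1)"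
    using periodic_monge_ampere[OF finX X_ball h \<rho> L cardX] by blast
  define I where "I = G \<times> {..<N'}"
  define c where "c = (\<lambda>(m, i). w (lattice_vec h m) / Z * a i)"
  define \<theta> where "\<theta> = (\<lambda>(m, i). \<eta> i - \<Xi> i \<bullet> lattice_vec h m)"
  define k where "k = (\<lambda>(m :: 'n \<Rightarrow> int, i). l i)"
  \<comment> \<open>The average of \<open>w\<close> over the grid with weights
    \<open>F (x - lattice_vec h m) / Z\<close>; expanding \<open>F\<close> into waves exhibits it as
    a trigonometric sum indexed by grid points and waves.\<close>
  define W where "W = trig_sum I c (\<lambda>i. lattice_vec (2 * pi / L) (k i)) \<theta>"
  have finI: "finite I" using finG by (simp add: I_def)
  have W: "W x = (\<Sum>m\<in>G. w (lattice_vec h m) * F (x - lattice_vec h m)) / Z" for x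
  proof -
    have "W x = (\<Sum>m\<in>G. \<Sum>i<N'. w (lattice_vec h m) / Z * (a i * cos (\<Xi> i \<bullet> (x - lattice_vec h m) + \<eta> i)))"
      unfolding W_def trig_sum_def I_def sum.cartesian_product'
      by (simp add: c_def \<theta>_def k_def \<Xi>_def inner_diff_right algebra_simps)
    then show ?thesis unfolding F trig_sum_def by (simp add: \<Xi>_def sum_distrib_left sum_divide_distrib)
  qed
  have F_per: "F (x + lattice_vec L k) = F x" for x k unfolding F_def using L by (intro torus_kernel_periodic) simp
  have sdW: "second_diff W x (lattice_vec h e) = (\<Sum>m\<in>G. second_diff w (lattice_vec h m) (lattice_vec h e) * F (x - lattice_vec h m)) / Z" for x e
  proof -
    have "second_diff W x z = second_diff (\<lambda>x. \<Sum>m\<in>G. w (lattice_vec h m) * F (x - lattice_vec h m)) x z / Z" for z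
      by (simp add: second_diff_def W diff_divide_distrib add_divide_distrib)
    then show ?thesis unfolding G_def
      by (subst second_diff_sum_grid[OF M0 L _ w(1) F_per, symmetric]) (auto simp: h_def hM_def)
  qed
  have Wbd: "\<bar>W x\<bar> \<le> K1" for x
  proof -
    have "\<bar>\<Sum>m\<in>G. w (lattice_vec h m) * F (x - lattice_vec h m)\<bar> \<le> (\<Sum>m\<in>G. K1 * F (x - lattice_vec h m))"
      using w(2) F0 by (intro order_trans[OF sum_abs] sum_mono) (auto simp: abs_mult K1_def n_def intro!: mult_right_mono)
    also have "\<dots> = K1 * Z" by (simp add: sum_distrib_left[symmetric] sumF)
    finally show ?thesis unfolding W using Z by (simp add: field_simps)
  qed
  \<comment> \<open>The normalization \<open>Z\<close>, which is \<open>card G\<close> times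
    \<open>Fm\<close>, cancels the number of grid points, so the bounds do not grow with
    \<open>M\<close>.\<close>
  have coeff: "(\<Sum>i\<in>I. \<bar>c i\<bar> * norm (lattice_vec (2 * pi / L) (k i) :: real^'n) ^ r) \<le> K1 / Fm * (\<Sum>i<N'. \<bar>a i\<bar> * norm (\<Xi> i) ^ r)" for r
  proof -
    have "(\<Sum>i\<in>I. \<bar>c i\<bar> * norm (lattice_vec (2 * pi / L) (k i) :: real^'n) ^ r) =
        (\<Sum>m\<in>G. \<Sum>i<N'. \<bar>w (lattice_vec h m)\<bar> / Z * (\<bar>a i\<bar> * norm (\<Xi> i) ^ r))"
      unfolding I_def sum.cartesian_product' using Z by (simp add: c_def k_def \<Xi>_def abs_mult mult.assoc)
    also have "\<dots> \<le> (\<Sum>m\<in>G. \<Sum>i<N'. K1 / Z * (\<bar>a i\<bar> * norm (\<Xi> i) ^ r))"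
      using w(2) Z by (intro sum_mono mult_right_mono divide_right_mono) (auto simp: K1_def n_def)
    also have "\<dots> = real (card G) * (K1 / Z) * (\<Sum>i<N'. \<bar>a i\<bar> * norm (\<Xi> i) ^ r)"
      by (simp add: sum_distrib_left mult.assoc)
    also have "real (card G) * (K1 / Z) = K1 / Fm"
    proof -
      have "x * (K1 / (x * Fm)) = K1 / Fm" if "0 < x" for x using that by simp
      from this[OF card_pos[OF M0]] show ?thesis by (simp only: Z_def G_def)
    qed
    finally show ?thesis .
  qed
  have hess: "- (2 * \<kappa>) * (norm v)\<^sup>2 \<le> trig_hess I c (\<lambda>i. lattice_vec (2 * pi / L) (k i)) \<theta> x v" for x v
  proof (rule trig_hess_ge_of_grid[OF finI h _ _ _ coeff[of 2, folded B_def] coeff[of 4, folded C_def] meta_eq_to_obj_eq[OF n_def]])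
    show "0 < P" "0 \<le> \<kappa>" using P \<kappa> by auto
    show "C * h\<^sup>2 * (P + n) ^ 4 + \<kappa> * (P + n)\<^sup>2 + B * (n * (2 * P + n)) \<le> 2 * \<kappa> * P\<^sup>2"
      using M1 by (simp add: h_def)
    fix e
    have "(\<Sum>m\<in>G. (- \<kappa> * (norm (lattice_vec h e))\<^sup>2) * F (x - lattice_vec h m)) \<le> (\<Sum>m\<in>G. second_diff w (lattice_vec h m) (lattice_vec h e) * F (x - lattice_vec h m))"
      using w(3) F0 by (intro sum_mono mult_right_mono) (auto simp: \<kappa>_def n_def)
    also have "(\<Sum>m\<in>G. (- \<kappa> * (norm (lattice_vec h e))\<^sup>2) * F (x - lattice_vec h m)) = (- \<kappa> * (norm (lattice_vec h e))\<^sup>2) * Z"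
      by (simp only: sum_distrib_left[symmetric] sumF)
    finally show "- \<kappa> * (norm (lattice_vec h e))\<^sup>2 \<le> second_diff (trig_sum I c (\<lambda>i. lattice_vec (2 * pi / L) (k i)) \<theta>) x (lattice_vec h e)"
      using Z unfolding W_def[symmetric] sdW by (simp add: pos_le_divide_eq)
  qed
  have lap: "1 / 24 - n * \<kappa> \<le> (\<Sum>j\<in>UNIV. trig_hess I c (\<lambda>i. lattice_vec (2 * pi / L) (k i)) \<theta> x (axis j 1))" if x: "x \<in> K" for x
  proof -
    define ax where "ax = (\<lambda>j. lattice_vec h (\<lambda>i. if i = j then 1 else 0) :: real^'n)"
    have ax: "ax j = h *\<^sub>R axis j 1" for j by (simp add: ax_def vec_eq_iff axis_def)
    have nax: "norm (ax j) = h" for j using h by (simp add: ax)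
    define s where "s = (\<lambda>m. \<Sum>j\<in>UNIV. second_diff w (lattice_vec h m) (ax j))"
    \<comment> \<open>Every direction loses at most \<open>\<kappa> * h\<^sup>2\<close>; at a node
      one direction gains \<open>h\<^sup>2 / 6\<close>. As at least half of the kernel mass sits at
      nodes, the gain becomes \<open>1 / 12\<close> after division by \<open>h\<^sup>2\<close>, and
      the Taylor error takes at most \<open>1 / 24\<close> of it.\<close>
    have s_all: "- (n * \<kappa> * h\<^sup>2) + (if m \<in> nodes then h\<^sup>2 / 6 else 0) \<le> s m" for m
    proof -
      have lo: "- (\<kappa> * h\<^sup>2) \<le> second_diff w (lattice_vec h m) (ax j)" for j
        using w(3)[of "ax j" "lattice_vec h m"] by (simp add: nax \<kappa>_def n_def)
      show ?thesis
      proof (cases "m \<in> nodes")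
        case True
        then have "lattice_vec h m \<in> X" by (simp add: X_def)
        then obtain j0 where j0: "(1 / 6 - \<kappa>) * h\<^sup>2 \<le> second_diff w (lattice_vec h m) (ax j0)"
          using w(4) by (auto simp: ax \<kappa>_def n_def)
        have "(\<Sum>j\<in>UNIV. - (\<kappa> * h\<^sup>2) + (if j = j0 then h\<^sup>2 / 6 else 0)) \<le> s m"
          unfolding s_def
        proof (rule sum_mono)
          fix j
          show "- (\<kappa> * h\<^sup>2) + (if j = j0 then h\<^sup>2 / 6 else 0) \<le> second_diff w (lattice_vec h m) (ax j)"
            using lo[of j] j0 by (cases "j = j0") (simp_all add: left_diff_distrib)
        qed
        then show ?thesis using True by (simp add: sum_subtractf n_def)
      next
        case False
        have "(\<Sum>j\<in>(UNIV::'n set). - (\<kappa> * h\<^sup>2)) \<le> s m" unfolding s_def using lo by (intro sum_mono)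
        then show ?thesis using False by (simp add: n_def)
      qed
    qed
    have "x \<in> ball 0 (L / 8)" using x K E by blast
    then have xj: "\<bar>x $ j\<bar> \<le> L / 8" for j using component_le_norm_cart[of x j] by simp
    have "1 / 2 * Z \<le> (\<Sum>m\<in>G. if \<forall>j. \<bar>(x - lattice_vec h m) $ j\<bar> < d then F (x - lattice_vec h m) else 0)"
      using conc[OF M0 _ xj] hd unfolding sumF[of x, symmetric] G_def F_def h_def hM_def by simp
    also have "\<dots> \<le> (\<Sum>m\<in>G. if m \<in> nodes then F (x - lattice_vec h m) else 0)"
      using x F0 by (intro sum_mono) (auto simp: nodes_def)
    finally have near: "1 / 2 * Z \<le> (\<Sum>m\<in>G. if m \<in> nodes then F (x - lattice_vec h m) else 0)" .
    have "(- (n * \<kappa> * h\<^sup>2)) * Z + h\<^sup>2 / 6 * (1 / 2 * Z) \<le> (- (n * \<kappa> * h\<^sup>2)) * Z + h\<^sup>2 / 6 * (\<Sum>m\<in>G. if m \<in> nodes then F (x - lattice_vec h m) else 0)"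
      using near by (intro add_left_mono mult_left_mono) auto
    also have "\<dots> = (\<Sum>m\<in>G. (- (n * \<kappa> * h\<^sup>2) + (if m \<in> nodes then h\<^sup>2 / 6 else 0)) * F (x - lattice_vec h m))"
      unfolding sumF[of x, symmetric] sum_distrib_left sum.distrib[symmetric] by (intro sum.cong) (auto simp: algebra_simps)
    also have "\<dots> \<le> (\<Sum>m\<in>G. s m * F (x - lattice_vec h m))" using s_all F0 by (intro sum_mono mult_right_mono) auto
    also have "\<dots> = (\<Sum>j\<in>UNIV. second_diff W x (ax j)) * Z"
    proof -
      have "second_diff W x (ax j) * Z = (\<Sum>m\<in>G. second_diff w (lattice_vec h m) (ax j) * F (x - lattice_vec h m))" for j
        using Z unfolding ax_def sdW by simp
      then show ?thesis unfolding s_def sum_distrib_right by (subst sum.swap) simp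
    qed
    finally have "(h\<^sup>2 * (1 / 12 - n * \<kappa>)) * Z \<le> (\<Sum>j\<in>UNIV. second_diff W x (ax j)) * Z" by (simp add: algebra_simps)
    then have sd: "h\<^sup>2 * (1 / 12 - n * \<kappa>) \<le> (\<Sum>j\<in>UNIV. second_diff W x (ax j))" using Z by simp
    have "second_diff W x (ax j) \<le> h\<^sup>2 * (trig_hess I c (\<lambda>i. lattice_vec (2 * pi / L) (k i)) \<theta> x (axis j 1) + C * h\<^sup>2)" for j
    proof -
      have "second_diff W x (ax j) - trig_hess I c (\<lambda>i. lattice_vec (2 * pi / L) (k i)) \<theta> x (ax j) \<le> C * norm (ax j) ^ 4"
        unfolding W_def
        using second_diff_trig_hess[OF finI, of c "\<lambda>i. lattice_vec (2 * pi / L) (k i)" \<theta> x "ax j"]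
          mult_right_mono[OF coeff[of 4, folded C_def], of "norm (ax j) ^ 4"] by simp
      then show ?thesis unfolding nax unfolding ax trig_hess_scaleR by (simp add: algebra_simps power4_eq_xxxx power2_eq_square)
    qed
    then have "(\<Sum>j\<in>UNIV. second_diff W x (ax j)) \<le> (\<Sum>j\<in>UNIV. h\<^sup>2 * (trig_hess I c (\<lambda>i. lattice_vec (2 * pi / L) (k i)) \<theta> x (axis j 1) + C * h\<^sup>2))"
      by (intro sum_mono)
    also have "\<dots> = h\<^sup>2 * ((\<Sum>j\<in>UNIV. trig_hess I c (\<lambda>i. lattice_vec (2 * pi / L) (k i)) \<theta> x (axis j 1)) + n * C * h\<^sup>2)"
      by (simp add: sum_distrib_left[symmetric] sum.distrib n_def)
    finally have "h\<^sup>2 * (1 / 12 - n * \<kappa>) \<le> h\<^sup>2 * ((\<Sum>j\<in>UNIV. trig_hess I c (\<lambda>i. lattice_vec (2 * pi / L) (k i)) \<theta> x (axis j 1)) + n * C * h\<^sup>2)"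
      using sd by linarith
    then have "1 / 12 - n * \<kappa> \<le> (\<Sum>j\<in>UNIV. trig_hess I c (\<lambda>i. lattice_vec (2 * pi / L) (k i)) \<theta> x (axis j 1)) + n * C * h\<^sup>2"
      using h by simp
    then show ?thesis using M2 by (simp add: h_def)
  qed
  show ?thesis
  proof (rule that)
    show "semiconvex_trig I c (\<lambda>i. lattice_vec (2 * pi / L) (k i)) \<theta> (L * n ^ 3 * \<rho>) (8 * n / L * \<rho>)"
      unfolding semiconvex_trig_def using finI Wbd hess by (simp add: W_def K1_def \<kappa>_def mult.assoc)
    show "1 / 24 - 4 * n\<^sup>2 / L * \<rho> \<le> (\<Sum>j\<in>UNIV. trig_hess I c (\<lambda>i. lattice_vec (2 * pi / L) (k i)) \<theta> x (axis j 1))" if "x \<in> K" for x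
      using lap[OF that] by (simp add: \<kappa>_def power2_eq_square mult_ac)
  qed
qed

section \<open>Supersolutions\<close>

definition period_cell :: "real \<Rightarrow> (real^'n) set" where
  "period_cell L = {x. \<forall>j. - (L / 2) \<le> x $ j \<and> x $ j < L / 2}"

lemma period_cell_borel [measurable]: "(period_cell L :: (real^'n) set) \<in> sets borel"
proof -
  have "{x \<in> space (borel :: (real^'n) measure). \<forall>j\<in>(UNIV::'n set). - (L / 2) \<le> x $ j \<and> x $ j < L / 2} \<in> sets borel"
    by measurable
  then show ?thesis by (simp add: period_cell_def)
qed

lemma bounded_period_cell: "bounded (period_cell L :: (real^'n) set)"
proof -
  have "period_cell L \<subseteq> cbox (\<chi> j. - (L / 2)) (\<chi> j. L / 2 :: real^'n)"
    by (auto simp: period_cell_def mem_box_cart less_imp_le)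
  then show ?thesis by (rule bounded_subset[OF bounded_cbox])
qed

lemma integrable_indicator_bounded:
  fixes f :: "'a::euclidean_space \<Rightarrow> real"
  assumes "S \<in> sets borel" "bounded S" "f \<in> borel_measurable borel" "\<And>x. \<bar>f x\<bar> \<le> B"
  shows "integrable lborel (\<lambda>x. indicator S x * f x)"
proof -
  have "integrable lborel (\<lambda>x. indicator S x * B)"
    using assms(1,2) by (intro integrable_mult_left integrable_real_indicator)
      (auto simp: emeasure_bounded_finite[unfolded infinity_ennreal_def])
  then show ?thesis
  proof (rule Bochner_Integration.integrable_bound)
    show "(\<lambda>x. indicator S x * f x) \<in> borel_measurable lborel" using assms by measurable
    show "AE x in lborel. norm (indicator S x * f x) \<le> norm (indicator S x * B)"
      using assms(4) by (auto simp: indicator_def intro: order_trans[OF _ abs_ge_self])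
  qed
qed

text \<open>The shift moves a slab \<open>P\<close> out of the cell on one side; periodicity
  identifies it with the slab that enters on the other. Half-open cells make the cancellation
  exact.\<close>

lemma integral_period_cell_shift:
  fixes f :: "real^'n \<Rightarrow> real"
  assumes f: "f \<in> borel_measurable borel" "\<And>x. \<bar>f x\<bar> \<le> B"
    and per: "\<And>x. f (x + L *\<^sub>R axis j 1) = f x" and s: "0 \<le> s" "s \<le> L"
  shows "(\<integral>x. indicator (period_cell L) x * f (x + s *\<^sub>R axis j 1) \<partial>lborel) = (\<integral>x. indicator (period_cell L) x * f x \<partial>lborel)"
proof -
  note [measurable] = f(1)
  define Q :: "(real^'n) set" where "Q = period_cell L"
  define P where "P = {x \<in> Q. x $ j < - (L / 2) + s}"
  have Q[measurable]: "Q \<in> sets borel" by (simp add: Q_def)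
  have "{x \<in> space borel. x \<in> Q \<and> x $ j < - (L / 2) + s} \<in> sets borel" by measurable
  then have P[measurable]: "P \<in> sets borel" by (simp add: P_def)
  have bd: "bounded Q" by (simp add: Q_def bounded_period_cell)
  then have bdP: "bounded P" by (rule bounded_subset) (auto simp: P_def)
  define a where "a = (axis j 1 :: real^'n)"
  have ind: "indicator Q (x - s *\<^sub>R a) = (indicator Q x - indicator P x + indicator P (x - L *\<^sub>R a) :: real)" for x
  proof -
    define R where "R \<longleftrightarrow> (\<forall>i. i \<noteq> j \<longrightarrow> - (L / 2) \<le> x $ i \<and> x $ i < L / 2)"
    have 1: "x - t *\<^sub>R a \<in> Q \<longleftrightarrow> R \<and> - (L / 2) \<le> x $ j - t \<and> x $ j - t < L / 2" for t
    proof -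
      have "(x - t *\<^sub>R a) $ i = (if i = j then x $ j - t else x $ i)" for i by (simp add: a_def axis_def)
      then have "x - t *\<^sub>R a \<in> Q \<longleftrightarrow> (\<forall>i. - (L / 2) \<le> (if i = j then x $ j - t else x $ i) \<and> (if i = j then x $ j - t else x $ i) < L / 2)"
        unfolding Q_def period_cell_def by simp
      also have "\<dots> \<longleftrightarrow> R \<and> - (L / 2) \<le> x $ j - t \<and> x $ j - t < L / 2" 
      proof -
        have "(\<forall>i. T (if i = j then c else b i)) \<longleftrightarrow> (\<forall>i. i \<noteq> j \<longrightarrow> T (b i)) \<and> T c" for T and c :: real and b :: "'n \<Rightarrow> real"
          by auto
        from this[of "\<lambda>z. - (L / 2) \<le> z \<and> z < L / 2" "x $ j - t" "\<lambda>i. x $ i"] show ?thesis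
          unfolding R_def by simp
      qed
      finally show ?thesis .
    qed
    have 2: "x - t *\<^sub>R a \<in> P \<longleftrightarrow> R \<and> - (L / 2) \<le> x $ j - t \<and> x $ j - t < L / 2 \<and> x $ j - t < - (L / 2) + s" for t
      unfolding P_def using 1[of t] by (simp add: a_def axis_def)
    have m: "indicator Q (x - s *\<^sub>R a) = (of_bool (x - s *\<^sub>R a \<in> Q) :: real)" "indicator Q x = (of_bool (x - 0 *\<^sub>R a \<in> Q) :: real)"
      "indicator P x = (of_bool (x - 0 *\<^sub>R a \<in> P) :: real)" "indicator P (x - L *\<^sub>R a) = (of_bool (x - L *\<^sub>R a \<in> P) :: real)"
      by (simp_all add: indicator_def)
    consider "x $ j < - (L / 2)" | "- (L / 2) \<le> x $ j" "x $ j < - (L / 2) + s" | "- (L / 2) + s \<le> x $ j" "x $ j < L / 2"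
      | "L / 2 \<le> x $ j" "x $ j < L / 2 + s" | "L / 2 + s \<le> x $ j" by linarith
    then show ?thesis unfolding m 1 2 by cases (use s in auto)
  qed
  have iQ: "integrable lborel (\<lambda>x. indicator Q x * f x)" using f by (intro integrable_indicator_bounded[OF Q bd]) auto
  have iP: "integrable lborel (\<lambda>x. indicator P x * f x)" using f by (intro integrable_indicator_bounded[OF P bdP]) auto
  have bdP': "bounded ((+) (L *\<^sub>R a) ` P)" using bdP by (rule bounded_translation)
  have iP': "integrable lborel (\<lambda>x. indicator P (x - L *\<^sub>R a) * f x)"
  proof -
    define P' where "P' = (+) (L *\<^sub>R a) ` P"
    have eq: "indicator P (x - L *\<^sub>R a) = (indicator P' x :: real)" for x
    proof -
      have "x \<in> P' \<longleftrightarrow> x - L *\<^sub>R a \<in> P" unfolding P'_def by (auto simp: image_iff) (metis add_diff_cancel_left' add.commute diff_add_cancel)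
      then show ?thesis by (simp add: indicator_def)
    qed
    have "(\<lambda>x. indicator P (x - L *\<^sub>R a) :: real) \<in> borel_measurable borel" by measurable
    then have "(indicator P' :: _ \<Rightarrow> real) \<in> borel_measurable borel" unfolding eq .
    then have "P' \<in> sets borel" by (simp add: borel_measurable_indicator_iff)
    then show ?thesis unfolding eq using f bdP' by (intro integrable_indicator_bounded) (auto simp: P'_def)
  qed
  have "(\<integral>x. indicator Q x * f (x + s *\<^sub>R a) \<partial>lborel) = (\<integral>x. indicator Q ((x + s *\<^sub>R a) - s *\<^sub>R a) * f (x + s *\<^sub>R a) \<partial>lborel)"
    by simp
  also have "\<dots> = (\<integral>x. indicator Q (x - s *\<^sub>R a) * f x \<partial>lborel)"
    by (rule lborel_integral_translate[of "\<lambda>x. indicator Q (x - s *\<^sub>R a) * f x"]) measurable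
  also have "\<dots> = (\<integral>x. (indicator Q x * f x - indicator P x * f x) + indicator P (x - L *\<^sub>R a) * f x \<partial>lborel)"
    unfolding ind by (simp add: algebra_simps)
  also have "\<dots> = (\<integral>x. indicator Q x * f x \<partial>lborel) - (\<integral>x. indicator P x * f x \<partial>lborel) + (\<integral>x. indicator P (x - L *\<^sub>R a) * f x \<partial>lborel)"
    using iQ iP iP' by simp
  also have "(\<integral>x. indicator P (x - L *\<^sub>R a) * f x \<partial>lborel) = (\<integral>x. indicator P ((x + L *\<^sub>R a) - L *\<^sub>R a) * f (x + L *\<^sub>R a) \<partial>lborel)"
    by (rule lborel_integral_translate[of "\<lambda>x. indicator P (x - L *\<^sub>R a) * f x", symmetric]) measurable
  also have "\<dots> = (\<integral>x. indicator P x * f x \<partial>lborel)" using per by (simp add: a_def)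
  finally show ?thesis by (simp add: Q_def a_def)
qed

text \<open>Shifting by half a wavelength \<open>s\<close> along a coordinate with
  \<open>k j \<noteq> 0\<close> changes the sign of the wave but not its integral over a
  period.\<close>

lemma integral_period_cell_cos:
  assumes L: "0 < L" and k: "k \<noteq> (\<lambda>_. 0)"
  shows "(\<integral>x. indicator (period_cell L) x * cos (lattice_vec (2 * pi / L) k \<bullet> x + \<theta>) \<partial>lborel) = 0"
proof -
  obtain j where j: "k j \<noteq> 0" using k by (auto simp: fun_eq_iff)
  define f where "f = (\<lambda>x. cos (lattice_vec (2 * pi / L) k \<bullet> x + \<theta>))"
  have fm: "f \<in> borel_measurable borel" unfolding f_def by measurable
  have f_shift: "f (x + t *\<^sub>R axis j 1) = cos (lattice_vec (2 * pi / L) k \<bullet> x + \<theta> + 2 * pi / L * k j * t)" for x t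
    by (simp add: f_def inner_add_right inner_axis algebra_simps)
  define s where "s = L / (2 * \<bar>real_of_int (k j)\<bar>)"
  have k1: "1 \<le> \<bar>real_of_int (k j)\<bar>" using j by linarith
  have s: "0 \<le> s" "s \<le> L"
  proof -
    show "0 \<le> s" using L by (simp add: s_def)
    have "L * 1 \<le> L * (2 * \<bar>real_of_int (k j)\<bar>)" using L k1 by (intro mult_left_mono) auto
    then show "s \<le> L" unfolding s_def using k1 by (simp add: divide_le_eq)
  qed
  have per: "f (x + L *\<^sub>R axis j 1) = f x" for x
  proof -
    have "2 * pi / L * k j * L = 2 * pi * of_int (k j)" using L by simp
    then show ?thesis unfolding f_shift using cos_int_2pin[of "k j"] sin_int_2pin[of "k j"]
      by (simp add: f_def cos_add mult_ac)
  qed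
  have neg: "f (x + s *\<^sub>R axis j 1) = - f x" for x
  proof -
    have "2 * pi / L * k j * s = pi * (k j / \<bar>real_of_int (k j)\<bar>)" using L by (simp add: s_def)
    then have "2 * pi / L * k j * s = pi \<or> 2 * pi / L * k j * s = - pi" using j by (auto simp: abs_if)
    moreover have "cos (u + t) = - cos u" if "t = pi \<or> t = - pi" for u t :: real
      using that by (auto simp: cos_add)
    ultimately show ?thesis unfolding f_shift unfolding f_def by blast
  qed
  have "(\<integral>x. indicator (period_cell L) x * f (x + s *\<^sub>R axis j 1) \<partial>lborel) = (\<integral>x. indicator (period_cell L) x * f x \<partial>lborel)"
    by (rule integral_period_cell_shift[OF fm _ per s, of 1]) (simp add: f_def)
  then have "- (\<integral>x. indicator (period_cell L) x * f x \<partial>lborel) = (\<integral>x. indicator (period_cell L) x * f x \<partial>lborel)"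
    unfolding neg by simp
  then show ?thesis by (simp add: f_def)
qed

lemma trig_sum_borel [measurable]: "trig_sum I c \<xi> \<theta> \<in> borel_measurable borel"
  unfolding trig_sum_def[abs_def] by measurable

lemma trig_sum_bounded:
  shows "\<bar>trig_sum I c \<xi> \<theta> x\<bar> \<le> (\<Sum>i\<in>I. \<bar>c i\<bar>)"
  unfolding trig_sum_def
  by (intro order_trans[OF sum_abs] sum_mono) (simp add: abs_mult mult_left_le)

lemma integral_period_cell_trig_sum:
  assumes L: "0 < L" and I: "finite I" and c: "\<And>i. i \<in> I \<Longrightarrow> k i = (\<lambda>_. 0) \<Longrightarrow> c i = 0"
  shows "(\<integral>x. indicator (period_cell L) x * trig_sum I c (\<lambda>i. lattice_vec (2 * pi / L) (k i)) \<theta> x \<partial>lborel) = 0"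
proof -
  have int: "integrable lborel (\<lambda>x. indicator (period_cell L) x * cos (lattice_vec (2 * pi / L) (k i) \<bullet> x + \<theta> i))" for i
    by (intro integrable_indicator_bounded[of _ _ 1] bounded_period_cell) auto
  have "(\<integral>x. indicator (period_cell L) x * trig_sum I c (\<lambda>i. lattice_vec (2 * pi / L) (k i)) \<theta> x \<partial>lborel) =
     (\<Sum>i\<in>I. c i * (\<integral>x. indicator (period_cell L) x * cos (lattice_vec (2 * pi / L) (k i) \<bullet> x + \<theta> i) \<partial>lborel))"
  proof -
    have "indicator (period_cell L) x * trig_sum I c (\<lambda>i. lattice_vec (2 * pi / L) (k i)) \<theta> x =
      (\<Sum>i\<in>I. c i * (indicator (period_cell L) x * cos (lattice_vec (2 * pi / L) (k i) \<bullet> x + \<theta> i)))" for x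
      by (simp add: trig_sum_def sum_distrib_left mult_ac)
    then show ?thesis using int by simp
  qed
  also have "\<dots> = 0"
  proof (intro sum.neutral ballI)
    fix i assume "i \<in> I"
    then show "c i * (\<integral>x. indicator (period_cell L) x * cos (lattice_vec (2 * pi / L) (k i) \<bullet> x + \<theta> i) \<partial>lborel) = 0"
      using c[of i] integral_period_cell_cos[OF L, of "k i"] by (cases "k i = (\<lambda>_. 0)") auto
  qed
  finally show ?thesis .
qed

section \<open>The operators on trigonometric sums\<close>

definition levy_op :: "real \<Rightarrow> real^'n^'n \<Rightarrow> (real^'n \<Rightarrow> real) \<Rightarrow> real^'n \<Rightarrow> real" where
  "levy_op \<sigma> A u x = (\<integral>y. second_diff u x y * levy_kernel \<sigma> A y \<partial>lebesgue)"

lemma extremal_op_eq: "extremal_op \<sigma> lam \<Lambda> u x = (SUP A\<in>admissible lam \<Lambda>. ereal (levy_op \<sigma> A u x))"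
  by (simp add: extremal_op_def levy_op_def levy_kernel_def)

lemma levy_op_trig_sum:
  fixes \<xi> :: "'i \<Rightarrow> real^'n"
  assumes \<sigma>: "0 < \<sigma>" "\<sigma> < 2"
  shows "levy_op \<sigma> A (trig_sum I c \<xi> \<theta>) x = (\<Sum>i\<in>I. - c i * levy_symbol \<sigma> A (\<xi> i) * cos (\<xi> i \<bullet> x + \<theta> i))"
proof -
  have m: "(\<lambda>y. second_diff (trig_sum I c \<xi> \<theta>) x y * levy_kernel \<sigma> A y) \<in> borel_measurable borel"
    unfolding second_diff_def by measurable
  have "levy_op \<sigma> A (trig_sum I c \<xi> \<theta>) x = (\<integral>y. second_diff (trig_sum I c \<xi> \<theta>) x y * levy_kernel \<sigma> A y \<partial>lborel)"
    unfolding levy_op_def using m by (simp add: integral_completion)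
  also have "\<dots> = (\<integral>y. (\<Sum>i\<in>I. (- c i * cos (\<xi> i \<bullet> x + \<theta> i)) * (2 * (1 - cos (\<xi> i \<bullet> y)) * levy_kernel \<sigma> A y)) \<partial>lborel)"
    unfolding second_diff_trig_sum sum_distrib_right
    by (intro Bochner_Integration.integral_cong sum.cong refl) (simp add: algebra_simps)
  also have "\<dots> = (\<Sum>i\<in>I. (- c i * cos (\<xi> i \<bullet> x + \<theta> i)) * levy_symbol \<sigma> A (\<xi> i))"
    using integrable_levy_symbol[OF \<sigma>, of "\<xi> _" A] unfolding levy_symbol_def
    by (subst Bochner_Integration.integral_sum) auto
  finally show ?thesis by (simp add: mult_ac)
qed

text \<open>On the line through \<open>x\<close> along \<open>z\<close>, the sum plus
  \<open>\<kappa> * (norm z)\<^sup>2 / 2 * t\<^sup>2\<close> is convex; its midpoint inequality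
  between \<open>t = - 1\<close> and \<open>t = 1\<close> is the claim.\<close>

lemma second_diff_ge_of_hess:
  fixes \<xi> :: "'i \<Rightarrow> real^'n"
  assumes hess: "\<And>x v. - \<kappa> * (norm v)\<^sup>2 \<le> trig_hess I c \<xi> \<theta> x v"
  shows "- \<kappa> * (norm z)\<^sup>2 \<le> second_diff (trig_sum I c \<xi> \<theta>) x z"
proof -
  define g where "g = (\<lambda>t. trig_sum I c \<xi> \<theta> (x + t *\<^sub>R z) + \<kappa> * (norm z)\<^sup>2 / 2 * t\<^sup>2)"
  define g' where "g' = (\<lambda>t. (\<Sum>i\<in>I. - c i * (\<xi> i \<bullet> z) * sin (\<xi> i \<bullet> (x + t *\<^sub>R z) + \<theta> i)) + \<kappa> * (norm z)\<^sup>2 * t)"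
  define g'' where "g'' = (\<lambda>t. trig_hess I c \<xi> \<theta> (x + t *\<^sub>R z) z + \<kappa> * (norm z)\<^sup>2)"
  have 1: "(g has_real_derivative g' t) (at t)" for t
    unfolding g_def g'_def trig_sum_def inner_add_right inner_scaleR_right
    by (auto intro!: derivative_eq_intros sum.cong simp: sum_negf sum_distrib_right mult_ac)
  have 2: "(g' has_real_derivative g'' t) (at t)" for t
    unfolding g'_def g''_def trig_hess_def inner_add_right inner_scaleR_right
    by (auto intro!: derivative_eq_intros sum.cong simp: power2_eq_square mult_ac)
  have conv: "convex_on UNIV g"
  proof (rule f''_ge0_imp_convex[OF convex_UNIV])
    show "(g has_real_derivative g' t) (at t)" "(g' has_real_derivative g'' t) (at t)" for t by (rule 1, rule 2)
    show "0 \<le> g'' t" for t using hess[of z "x + t *\<^sub>R z"] by (simp add: g''_def)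
  qed
  have "g ((1 - 1/2) *\<^sub>R (- 1) + (1/2) *\<^sub>R 1) \<le> (1 - 1/2) * g (- 1) + (1/2) * g 1"
    using conv by (rule convex_onD) auto
  then have "2 * g 0 \<le> g (- 1) + g 1" by simp
  then show ?thesis by (simp add: g_def second_diff_def)
qed

section \<open>Smooth test functions\<close>

lemma C2_closure_add:
  assumes "C2_closure N u" "C2_closure N v"
  shows "C2_closure N (\<lambda>x. u x + v x)"
proof -
  obtain G H where u: "continuous_on (closure N) u" "continuous_on (closure N) G" "continuous_on (closure N) H"
      "\<forall>x\<in>N. (u has_derivative (\<lambda>h. G x \<bullet> h)) (at x) \<and> (G has_derivative (\<lambda>h. H x *v h)) (at x)"
    using assms(1) unfolding C2_closure_def by blast
  obtain G' H' where v: "continuous_on (closure N) v" "continuous_on (closure N) G'" "continuous_on (closure N) H'"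
      "\<forall>x\<in>N. (v has_derivative (\<lambda>h. G' x \<bullet> h)) (at x) \<and> (G' has_derivative (\<lambda>h. H' x *v h)) (at x)"
    using assms(2) unfolding C2_closure_def by blast
  have "((\<lambda>x. u x + v x) has_derivative (\<lambda>h. (G x + G' x) \<bullet> h)) (at x) \<and>
      ((\<lambda>x. G x + G' x) has_derivative (\<lambda>h. (H x + H' x) *v h)) (at x)" if "x \<in> N" for x
  proof
    have "((\<lambda>x. u x + v x) has_derivative (\<lambda>h. G x \<bullet> h + G' x \<bullet> h)) (at x)"
      using u(4) v(4) that by (intro has_derivative_add) auto
    then show "((\<lambda>x. u x + v x) has_derivative (\<lambda>h. (G x + G' x) \<bullet> h)) (at x)" by (simp add: inner_add_left)
    have "((\<lambda>x. G x + G' x) has_derivative (\<lambda>h. H x *v h + H' x *v h)) (at x)"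
      using u(4) v(4) that by (intro has_derivative_add) auto
    then show "((\<lambda>x. G x + G' x) has_derivative (\<lambda>h. (H x + H' x) *v h)) (at x)"
      by (simp add: matrix_vector_mult_add_rdistrib)
  qed
  moreover have "continuous_on (closure N) (\<lambda>x. u x + v x)" "continuous_on (closure N) (\<lambda>x. G x + G' x)"
    "continuous_on (closure N) (\<lambda>x. H x + H' x)"
    using u v by (auto intro: continuous_on_add)
  ultimately show ?thesis unfolding C2_closure_def by blast
qed

lemma C2_closure_cmult:
  assumes "C2_closure N u"
  shows "C2_closure N (\<lambda>x. a * u x)"
proof -
  obtain G H where u: "continuous_on (closure N) u" "continuous_on (closure N) G" "continuous_on (closure N) H"
      "\<forall>x\<in>N. (u has_derivative (\<lambda>h. G x \<bullet> h)) (at x) \<and> (G has_derivative (\<lambda>h. H x *v h)) (at x)"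
    using assms(1) unfolding C2_closure_def by blast
  have "((\<lambda>x. a * u x) has_derivative (\<lambda>h. (a *\<^sub>R G x) \<bullet> h)) (at x) \<and>
      ((\<lambda>x. a *\<^sub>R G x) has_derivative (\<lambda>h. (a *\<^sub>R H x) *v h)) (at x)" if "x \<in> N" for x
  proof
    have "((\<lambda>x. a * u x) has_derivative (\<lambda>h. a * (G x \<bullet> h))) (at x)"
      using u(4) that by (intro has_derivative_mult_right) auto
    then show "((\<lambda>x. a * u x) has_derivative (\<lambda>h. (a *\<^sub>R G x) \<bullet> h)) (at x)" by simp
    have "((\<lambda>x. a *\<^sub>R G x) has_derivative (\<lambda>h. a *\<^sub>R (H x *v h))) (at x)"
      using u(4) that by (intro has_derivative_scaleR_right) auto
    then show "((\<lambda>x. a *\<^sub>R G x) has_derivative (\<lambda>h. (a *\<^sub>R H x) *v h)) (at x)"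
      by (simp add: scaleR_matrix_vector_assoc)
  qed
  moreover have "continuous_on (closure N) (\<lambda>x. a * u x)" "continuous_on (closure N) (\<lambda>x. a *\<^sub>R G x)"
    "continuous_on (closure N) (\<lambda>x. a *\<^sub>R H x)"
    using u by (auto intro!: continuous_intros)
  ultimately show ?thesis unfolding C2_closure_def by blast
qed

lemma C2_closure_const: "C2_closure N (\<lambda>_. a)"
  unfolding C2_closure_def by (rule exI[of _ "\<lambda>_. 0"], rule exI[of _ "\<lambda>_. 0"]) (auto intro!: continuous_intros derivative_eq_intros)

lemma C2_closure_norm_square:
  fixes a :: "real^'n"
  shows "C2_closure N (\<lambda>x. (norm (x - a))\<^sup>2)"
  unfolding C2_closure_def
proof (intro exI conjI ballI)
  show "continuous_on (closure N) (\<lambda>x. 2 *\<^sub>R (x - a))" "continuous_on (closure N) (\<lambda>_. mat 2 :: real^'n^'n)"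
    "continuous_on (closure N) (\<lambda>x. (norm (x - a))\<^sup>2)"
    by (intro continuous_intros)+
  fix x
  show "((\<lambda>x. (norm (x - a))\<^sup>2) has_derivative (\<lambda>h. (2 *\<^sub>R (x - a)) \<bullet> h)) (at x)"
    unfolding power2_norm_eq_inner by (auto intro!: derivative_eq_intros simp: inner_commute)
  have "mat 2 *v h = 2 *\<^sub>R h" for h :: "real^'n"
    by (simp add: vec_eq_iff matrix_vector_mult_def mat_def if_distrib[of "\<lambda>x. x * _"] cong: if_cong)
  then show "((\<lambda>x. 2 *\<^sub>R (x - a)) has_derivative (\<lambda>h. mat 2 *v h)) (at x)"
    by (auto intro!: derivative_eq_intros simp: fun_eq_iff)
qed

lemma C2_closure_cos: "C2_closure N (\<lambda>x::real^'n. cos (\<xi> \<bullet> x + \<theta>))"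
  unfolding C2_closure_def
proof (intro exI conjI ballI)
  define H :: "real^'n \<Rightarrow> real^'n^'n" where "H = (\<lambda>x. \<chi> a b. - cos (\<xi> \<bullet> x + \<theta>) * (\<xi> $ a * \<xi> $ b))"
  show "continuous_on (closure N) (\<lambda>x. cos (\<xi> \<bullet> x + \<theta>))" "continuous_on (closure N) (\<lambda>x. - sin (\<xi> \<bullet> x + \<theta>) *\<^sub>R \<xi>)"
    "continuous_on (closure N) H"
    unfolding H_def by (intro continuous_intros)+
  fix x
  show "((\<lambda>x. cos (\<xi> \<bullet> x + \<theta>)) has_derivative (\<lambda>h. (- sin (\<xi> \<bullet> x + \<theta>) *\<^sub>R \<xi>) \<bullet> h)) (at x)"
    by (auto intro!: derivative_eq_intros)
  have "H x *v h = (- cos (\<xi> \<bullet> x + \<theta>) * (\<xi> \<bullet> h)) *\<^sub>R \<xi>" for h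
    by (simp add: vec_eq_iff H_def matrix_vector_mult_def inner_vec_def sum_distrib_left sum_distrib_right mult_ac sum_negf)
  then show "((\<lambda>x. - sin (\<xi> \<bullet> x + \<theta>) *\<^sub>R \<xi>) has_derivative (\<lambda>h. H x *v h)) (at x)"
    by (auto intro!: derivative_eq_intros)
qed

text \<open>What a test function needs for the viscosity definition and for absolutely convergent
  integrals: the quadratic part of the last bound serves at the origin, the constant part at
  infinity. The class is closed under linear combinations and contains constants and waves, hence
  the barriers.\<close>

definition smooth_test :: "(real^'n \<Rightarrow> real) \<Rightarrow> bool" where
  "smooth_test u \<longleftrightarrow> u \<in> borel_measurable borel \<and> (\<forall>N. C2_closure N u) \<and>
     (\<exists>M. \<forall>x y. \<bar>second_diff u x y\<bar> \<le> M * min 1 ((norm y)\<^sup>2))"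

lemma smooth_test_add:
  assumes "smooth_test u" "smooth_test v"
  shows "smooth_test (\<lambda>x. u x + v x)"
proof -
  obtain M M' where M: "\<And>x y. \<bar>second_diff u x y\<bar> \<le> M * min 1 ((norm y)\<^sup>2)" "\<And>x y. \<bar>second_diff v x y\<bar> \<le> M' * min 1 ((norm y)\<^sup>2)"
    using assms unfolding smooth_test_def by blast
  have "\<bar>second_diff (\<lambda>x. u x + v x) x y\<bar> \<le> (M + M') * min 1 ((norm y)\<^sup>2)" for x y
  proof -
    have "second_diff (\<lambda>x. u x + v x) x y = second_diff u x y + second_diff v x y" by (simp add: second_diff_def)
    then show ?thesis using M(1)[of x y] M(2)[of x y] by (simp add: distrib_right)
  qed
  then show ?thesis using assms unfolding smooth_test_def by (auto intro: C2_closure_add)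
qed

lemma smooth_test_cmult:
  assumes "smooth_test u"
  shows "smooth_test (\<lambda>x. a * u x)"
proof -
  obtain M where M: "\<And>x y. \<bar>second_diff u x y\<bar> \<le> M * min 1 ((norm y)\<^sup>2)"
    using assms unfolding smooth_test_def by blast
  have "\<bar>second_diff (\<lambda>x. a * u x) x y\<bar> \<le> (\<bar>a\<bar> * M) * min 1 ((norm y)\<^sup>2)" for x y
  proof -
    have "second_diff (\<lambda>x. a * u x) x y = a * second_diff u x y" by (simp add: second_diff_def algebra_simps)
    then show ?thesis using mult_left_mono[OF M[of x y], of "\<bar>a\<bar>"] by (simp add: abs_mult mult.assoc)
  qed
  then show ?thesis using assms unfolding smooth_test_def by (auto intro: C2_closure_cmult)
qed

lemma smooth_test_const: "smooth_test (\<lambda>_. a)"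
  unfolding smooth_test_def by (auto intro: C2_closure_const exI[of _ 0] simp: second_diff_def)

lemma smooth_test_cos: "smooth_test (\<lambda>x. cos (\<xi> \<bullet> x + \<theta>))"
proof -
  have "\<bar>second_diff (\<lambda>x. cos (\<xi> \<bullet> x + \<theta>)) x y\<bar> \<le> (4 * (1 + (norm \<xi>)\<^sup>2)) * min 1 ((norm y)\<^sup>2)" for x y
  proof -
    have "\<bar>second_diff (\<lambda>x. cos (\<xi> \<bullet> x + \<theta>)) x y\<bar> = \<bar>2 * (1 - cos (\<xi> \<bullet> y))\<bar> * \<bar>cos (\<xi> \<bullet> x + \<theta>)\<bar>"
      unfolding second_diff_cos by (simp add: abs_mult)
    also have "\<dots> \<le> \<bar>2 * (1 - cos (\<xi> \<bullet> y))\<bar> * 1" by (intro mult_left_mono) auto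
    finally show ?thesis using one_minus_cos_inner_bound[of \<xi> y] by linarith
  qed
  then show ?thesis unfolding smooth_test_def by (auto intro: C2_closure_cos)
qed

lemma smooth_test_trig_sum:
  assumes "finite I"
  shows "smooth_test (trig_sum I c \<xi> \<theta>)"
  unfolding trig_sum_def[abs_def] using assms
proof (induction I rule: finite_induct)
  case empty
  then show ?case by (simp add: smooth_test_const)
next
  case (insert i I)
  then show ?case using smooth_test_add[OF smooth_test_cmult[OF smooth_test_cos] insert.IH, of "c i" "\<xi> i" "\<theta> i"] by simp
qed

lemma lebesgue_measurable_translate:
  fixes x :: "'a::euclidean_space"
  shows "(\<lambda>y. x + y) \<in> lebesgue \<rightarrow>\<^sub>M lebesgue" "(\<lambda>y. x - y) \<in> lebesgue \<rightarrow>\<^sub>M lebesgue"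
  using lebesgue_affine_measurable[of "\<lambda>_. 1" x] lebesgue_affine_measurable[of "\<lambda>_. - 1" x]
  by (simp_all add: euclidean_representation sum_negf)

lemma second_diff_lebesgue_measurable:
  fixes v :: "'a::euclidean_space \<Rightarrow> real"
  assumes [measurable]: "v \<in> borel_measurable lebesgue"
  shows "second_diff v x \<in> borel_measurable lebesgue"
proof -
  note [measurable] = measurable_compose[OF lebesgue_measurable_translate(1) assms]
    measurable_compose[OF lebesgue_measurable_translate(2) assms]
  show ?thesis unfolding second_diff_def[abs_def] by measurable
qed

lemma integrable_levy_op:
  assumes \<sigma>: "0 < \<sigma>" "\<sigma> < 2" and u: "smooth_test u"
  shows "integrable lebesgue (\<lambda>y. second_diff u x y * levy_kernel \<sigma> A y)"
proof -
  obtain M where M: "\<And>x y. \<bar>second_diff u x y\<bar> \<le> M * min 1 ((norm y)\<^sup>2)"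
    using u unfolding smooth_test_def by blast
  show ?thesis
    using u by (intro integrable_levy_kernel[OF \<sigma> _ M] second_diff_lebesgue_measurable measurable_completion)
      (simp add: smooth_test_def)
qed

lemma levy_op_linear:
  assumes \<sigma>: "0 < \<sigma>" "\<sigma> < 2" and u: "smooth_test u" and v: "smooth_test v"
  shows "levy_op \<sigma> A (\<lambda>x. a * u x + b * v x + c) x = a * levy_op \<sigma> A u x + b * levy_op \<sigma> A v x"
proof -
  have "second_diff (\<lambda>x. a * u x + b * v x + c) x y * levy_kernel \<sigma> A y =
     a * (second_diff u x y * levy_kernel \<sigma> A y) + b * (second_diff v x y * levy_kernel \<sigma> A y)" for y
    by (simp add: second_diff_def algebra_simps)
  then show ?thesis unfolding levy_op_def using integrable_levy_op[OF \<sigma> u, of x A] integrable_levy_op[OF \<sigma> v, of x A] by simp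
qed

text \<open>The weights \<open>\<bar>\<xi>\<bar> powr (2 - \<sigma>)\<close> turn \<open>W\<close> into minus its fractional Laplacian of order
  \<open>2 - \<sigma>\<close>.  Composed with it, every \<open>levy_op\<close> becomes a local second order operator.\<close>

lemma levy_op_fractional:
  fixes \<xi> :: "'i \<Rightarrow> real^'n"
  assumes \<sigma>: "0 < \<sigma>" "\<sigma> < 2" and I: "finite I"
    and ws: "symbol_decomposition \<sigma> A b ws"
  shows "levy_op \<sigma> A (trig_sum I (\<lambda>i. - c i * norm (\<xi> i) powr (2 - \<sigma>)) \<xi> \<theta>) x =
    - (\<Sum>w\<leftarrow>ws. trig_hess I c \<xi> \<theta> x w) - b * (\<Sum>j\<in>UNIV. trig_hess I c \<xi> \<theta> x (axis j 1))"
proof -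
  \<comment> \<open>The singular factor of the symbol cancels; at zero frequency both sides
    vanish.\<close>
  have s: "norm \<xi> powr (2 - \<sigma>) * levy_symbol \<sigma> A \<xi> = (\<Sum>w\<leftarrow>ws. (w \<bullet> \<xi>)\<^sup>2) + b * (norm \<xi>)\<^sup>2" for \<xi> :: "real^'n"
  proof (cases "\<xi> = 0")
    case True
    then show ?thesis by (simp add: levy_symbol_def)
  next
    case False
    then have "norm \<xi> powr (2 - \<sigma>) * norm \<xi> powr (\<sigma> - 2) = 1" by (simp flip: powr_add)
    then show ?thesis using ws by (simp add: symbol_decomposition_def flip: mult.assoc)
  qed
  have "levy_op \<sigma> A (trig_sum I (\<lambda>i. - c i * norm (\<xi> i) powr (2 - \<sigma>)) \<xi> \<theta>) x =
      (\<Sum>i\<in>I. c i * (norm (\<xi> i) powr (2 - \<sigma>) * levy_symbol \<sigma> A (\<xi> i)) * cos (\<xi> i \<bullet> x + \<theta> i))"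
    unfolding levy_op_trig_sum[OF \<sigma>] by (intro sum.cong) auto
  also have "\<dots> = (\<Sum>i\<in>I. (\<Sum>w\<leftarrow>ws. c i * (\<xi> i \<bullet> w)\<^sup>2 * cos (\<xi> i \<bullet> x + \<theta> i)) + b * (c i * (norm (\<xi> i))\<^sup>2 * cos (\<xi> i \<bullet> x + \<theta> i)))"
    unfolding s by (intro sum.cong) (auto simp: algebra_simps inner_commute sum_list_const_mult[symmetric] sum_list_mult_const[symmetric])
  also have "\<dots> = (\<Sum>w\<leftarrow>ws. \<Sum>i\<in>I. c i * (\<xi> i \<bullet> w)\<^sup>2 * cos (\<xi> i \<bullet> x + \<theta> i)) + b * (\<Sum>i\<in>I. c i * (norm (\<xi> i))\<^sup>2 * cos (\<xi> i \<bullet> x + \<theta> i))"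
  proof -
    have "(\<Sum>i\<in>I. \<Sum>w\<leftarrow>ws. f i w) = (\<Sum>w\<leftarrow>ws. \<Sum>i\<in>I. f i w)" for f :: "'i \<Rightarrow> real^'n \<Rightarrow> real"
      by (induction ws) (simp_all add: sum.distrib)
    then show ?thesis by (simp add: sum.distrib sum_distrib_left)
  qed
  also have "(\<Sum>w\<leftarrow>ws. \<Sum>i\<in>I. c i * (\<xi> i \<bullet> w)\<^sup>2 * cos (\<xi> i \<bullet> x + \<theta> i)) = - (\<Sum>w\<leftarrow>ws. trig_hess I c \<xi> \<theta> x w)"
    by (induction ws) (simp_all add: trig_hess_def sum_negf)
  also have "(\<Sum>i\<in>I. c i * (norm (\<xi> i))\<^sup>2 * cos (\<xi> i \<bullet> x + \<theta> i)) = - (\<Sum>j\<in>UNIV. trig_hess I c \<xi> \<theta> x (axis j 1))"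
  proof -
    have n: "(norm \<xi>)\<^sup>2 = (\<Sum>j\<in>UNIV. (\<xi> \<bullet> axis j 1)\<^sup>2)" for \<xi> :: "real^'n"
      by (simp add: norm_vec_def L2_set_def sum_nonneg inner_axis)
    show ?thesis unfolding n trig_hess_def by (subst sum.swap) (simp add: sum_negf sum_distrib_left sum_distrib_right)
  qed
  finally show ?thesis by simp
qed

text \<open>The multiplier \<open>- norm \<xi> powr \<alpha>\<close> is, up to the factor
  \<open>a\<close>, integration of second differences against
  \<open>1 / norm z powr (n + \<alpha>)\<close>. These are at least
  \<open>- k2 * (norm z)\<^sup>2\<close> near the origin and at least \<open>- 4 * k1\<close> far
  away. \<open>D\<close> is independent of the sum, and the Hessian is bounded on one side only, so
  the conclusion is one-sided too.\<close>

lemma fractional_lower_bound: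
  assumes \<alpha>: "0 < \<alpha>" "\<alpha> < 2"
  obtains D where "0 < D" "\<And>(I :: 'i set) c (\<xi> :: 'i \<Rightarrow> real^'n) \<theta> k1 k2 x. semiconvex_trig I c \<xi> \<theta> k1 k2 \<Longrightarrow> 0 \<le> k2 \<Longrightarrow>
    - D * (k1 + k2) \<le> trig_sum I (\<lambda>i. - c i * norm (\<xi> i) powr \<alpha>) \<xi> \<theta> x"
proof -
  obtain a where a: "0 < a"
    "\<And>\<xi> :: real^'n. integrable lborel (\<lambda>z. 2 * (1 - cos (\<xi> \<bullet> z)) / norm z powr (real CARD('n) + \<alpha>))"
    "\<And>\<xi> :: real^'n. (\<integral>z. 2 * (1 - cos (\<xi> \<bullet> z)) / norm z powr (real CARD('n) + \<alpha>) \<partial>lborel) = a * norm \<xi> powr \<alpha>"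
    using fractional_symbol[OF \<alpha>] by blast
  define J where "J = (\<integral>z. min 1 ((norm (z::real^'n))\<^sup>2) / norm z powr (real CARD('n) + \<alpha>) \<partial>lborel)"
  have Ji: "integrable lborel (\<lambda>z::real^'n. min 1 ((norm z)\<^sup>2) / norm z powr (real CARD('n) + \<alpha>))"
    using integrable_min_kernel[OF \<alpha>, where 'a="real^'n"] by simp
  have J: "0 \<le> J" unfolding J_def by (intro integral_nonneg_AE) auto
  show ?thesis
  proof (rule that[of "4 * (J + 1) / a"])
    show "0 < 4 * (J + 1) / a" using J a by simp
    fix I :: "'i set" and c and \<xi> :: "'i \<Rightarrow> real^'n" and \<theta> k1 k2 x
    assume "semiconvex_trig I c \<xi> \<theta> k1 k2" and k2: "0 \<le> k2"
    then have I: "finite I" and W: "\<And>x. \<bar>trig_sum I c \<xi> \<theta> x\<bar> \<le> k1"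
      and hess: "\<And>x v. - k2 * (norm v)\<^sup>2 \<le> trig_hess I c \<xi> \<theta> x v" by (auto simp: semiconvex_trig_def)
    define p where "p = real CARD('n) + \<alpha>"
    have k1: "0 \<le> k1" using W[of 0] by linarith
    have eq: "a * trig_sum I (\<lambda>i. - c i * norm (\<xi> i) powr \<alpha>) \<xi> \<theta> x = (\<integral>z. second_diff (trig_sum I c \<xi> \<theta>) x z / norm z powr p \<partial>lborel)"
    proof -
      have "(\<integral>z. second_diff (trig_sum I c \<xi> \<theta>) x z / norm z powr p \<partial>lborel) =
          (\<integral>z. (\<Sum>i\<in>I. (- c i * cos (\<xi> i \<bullet> x + \<theta> i)) * (2 * (1 - cos (\<xi> i \<bullet> z)) / norm z powr p)) \<partial>lborel)"
        unfolding second_diff_trig_sum sum_divide_distrib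
        by (intro Bochner_Integration.integral_cong sum.cong refl) (simp add: algebra_simps)
      also have "\<dots> = (\<Sum>i\<in>I. (- c i * cos (\<xi> i \<bullet> x + \<theta> i)) * (a * norm (\<xi> i) powr \<alpha>))"
      proof -
        define g where "g = (\<lambda>i z. 2 * (1 - cos (\<xi> i \<bullet> z)) / norm z powr p)"
        have g: "integrable lborel (g i)" "(\<integral>z. g i z \<partial>lborel) = a * norm (\<xi> i) powr \<alpha>" for i
          using a(2,3) by (simp_all only: g_def p_def)
        then have "(\<integral>z. (\<Sum>i\<in>I. (- c i * cos (\<xi> i \<bullet> x + \<theta> i)) * g i z) \<partial>lborel) = (\<Sum>i\<in>I. (- c i * cos (\<xi> i \<bullet> x + \<theta> i)) * (a * norm (\<xi> i) powr \<alpha>))"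
          by simp
        then show ?thesis by (simp only: g_def)
      qed
      finally show ?thesis by (simp add: trig_sum_def sum_distrib_left mult_ac sum_negf)
    qed
    have int: "integrable lborel (\<lambda>z. second_diff (trig_sum I c \<xi> \<theta>) x z / norm z powr p)"
    proof -
      have "integrable lborel (\<lambda>z. \<Sum>i\<in>I. (- c i * cos (\<xi> i \<bullet> x + \<theta> i)) * (2 * (1 - cos (\<xi> i \<bullet> z)) / norm z powr p))"
        using a(2) unfolding p_def by (intro Bochner_Integration.integrable_sum integrable_mult_right) auto
      moreover have "second_diff (trig_sum I c \<xi> \<theta>) x z / norm z powr p = (\<Sum>i\<in>I. (- c i * cos (\<xi> i \<bullet> x + \<theta> i)) * (2 * (1 - cos (\<xi> i \<bullet> z)) / norm z powr p))" for z
        unfolding second_diff_trig_sum sum_divide_distrib by (intro sum.cong refl) (simp add: algebra_simps)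
      ultimately show ?thesis by simp
    qed
    have "- (4 * (k1 + k2)) * J = (\<integral>z. - (4 * (k1 + k2)) * (min 1 ((norm (z::real^'n))\<^sup>2) / norm z powr p) \<partial>lborel)"
      unfolding J_def p_def by (rule integral_mult_right_zero[symmetric])
    also have "\<dots> \<le> (\<integral>z. second_diff (trig_sum I c \<xi> \<theta>) x z / norm z powr p \<partial>lborel)"
    proof (rule integral_mono)
      show "integrable lborel (\<lambda>z::real^'n. - (4 * (k1 + k2)) * (min 1 ((norm z)\<^sup>2) / norm z powr p))"
        using Ji unfolding p_def by (rule integrable_mult_right)
      show "integrable lborel (\<lambda>z. second_diff (trig_sum I c \<xi> \<theta>) x z / norm z powr p)" by (rule int)
      fix z :: "real^'n"
      have "- (4 * (k1 + k2)) * min 1 ((norm z)\<^sup>2) \<le> second_diff (trig_sum I c \<xi> \<theta>) x z"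
      proof (cases "(norm z)\<^sup>2 \<le> 1")
        case True
        have "- (4 * (k1 + k2)) * (norm z)\<^sup>2 \<le> - k2 * (norm z)\<^sup>2" using k1 k2 by (intro mult_right_mono) auto
        also have "\<dots> \<le> second_diff (trig_sum I c \<xi> \<theta>) x z" by (rule second_diff_ge_of_hess[OF hess])
        finally show ?thesis using True by (simp add: min_def)
      next
        case False
        have "- (4 * k1) \<le> second_diff (trig_sum I c \<xi> \<theta>) x z"
          unfolding second_diff_def using W[of "x + z"] W[of "x - z"] W[of x] by (simp add: abs_le_iff)
        then show ?thesis using False k2 by (simp add: min_def)
      qed
      then show "- (4 * (k1 + k2)) * (min 1 ((norm z)\<^sup>2) / norm z powr p) \<le> second_diff (trig_sum I c \<xi> \<theta>) x z / norm z powr p"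
        using divide_right_mono[of "- (4 * (k1 + k2)) * min 1 ((norm z)\<^sup>2)" _ "norm z powr p"] by simp
    qed
    finally have "- (4 * (k1 + k2)) * J \<le> a * trig_sum I (\<lambda>i. - c i * norm (\<xi> i) powr \<alpha>) \<xi> \<theta> x" by (simp only: eq)
    moreover have "(4 * (k1 + k2)) * J \<le> (4 * (k1 + k2)) * (J + 1)" using k1 k2 by (intro mult_left_mono) auto
    moreover have "- (4 * (k1 + k2)) * J = - ((4 * (k1 + k2)) * J)" by (rule mult_minus_left)
    ultimately have "- ((4 * (k1 + k2)) * (J + 1)) \<le> a * trig_sum I (\<lambda>i. - c i * norm (\<xi> i) powr \<alpha>) \<xi> \<theta> x" by linarith
    then show "- (4 * (J + 1) / a) * (k1 + k2) \<le> trig_sum I (\<lambda>i. - c i * norm (\<xi> i) powr \<alpha>) \<xi> \<theta> x"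
      using a(1) by (simp add: field_simps)
  qed
qed

text \<open>The sum of \<open>cos (2 * pi / L * x $ j)\<close> over the coordinates: on the ball of
  radius \<open>L / 8\<close> all angles are at most \<open>pi / 4\<close>, so each wave is bounded
  below and its eigenvalue, controlled by \<open>b\<close>, makes every operator negative.\<close>

lemma cosine_barrier:
  assumes \<sigma>: "0 < \<sigma>" "\<sigma> < 2" and L: "0 < L" and b: "0 < b"
  obtains \<beta> :: "real^'n \<Rightarrow> real" and e where "0 < e" "smooth_test \<beta>" "\<And>x. \<bar>\<beta> x\<bar> \<le> real CARD('n)"
    "(\<integral>x. indicator (period_cell L) x * \<beta> x \<partial>lborel) = 0"
    "\<And>A ws x. symbol_decomposition \<sigma> A b ws \<Longrightarrow> x \<in> ball 0 (L / 8) \<Longrightarrow> levy_op \<sigma> A \<beta> x \<le> - e"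
proof -
  define \<delta> where "\<delta> = (\<lambda>(j::'n) i. if i = j then 1 else 0 :: int)"
  define w where "w = 2 * pi / L"
  have w: "w > 0" using L by (simp add: w_def)
  have lat: "lattice_vec w (\<delta> j) = w *\<^sub>R axis j 1" for j by (auto simp: vec_eq_iff \<delta>_def axis_def)
  define \<beta> where "\<beta> = trig_sum UNIV (\<lambda>_. 1) (\<lambda>j. lattice_vec (2 * pi / L) (\<delta> j)) (\<lambda>_. 0)"
  \<comment> \<open>The lower bound \<open>b * w powr \<sigma>\<close> of the symbol at a frequency
    of length \<open>w\<close>, times the lower bound \<open>1 / 2\<close> of the cosine on the
    ball.\<close>
  define e where "e = w powr \<sigma> * b / 2"
  show ?thesis
  proof (rule that[of e \<beta>])
    show "0 < e" using w b by (simp add: e_def)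
    show "smooth_test \<beta>" unfolding \<beta>_def by (rule smooth_test_trig_sum) simp
    show "\<bar>\<beta> x\<bar> \<le> real CARD('n)" for x
      using trig_sum_bounded[of UNIV "\<lambda>_. 1" "\<lambda>j. lattice_vec (2 * pi / L) (\<delta> j)" "\<lambda>_. 0" x] by (simp add: \<beta>_def)
    show "(\<integral>x. indicator (period_cell L) x * \<beta> x \<partial>lborel) = 0"
      unfolding \<beta>_def
    proof (rule integral_period_cell_trig_sum[OF L])
      fix j assume "\<delta> j = (\<lambda>_. 0)"
      then show "1 = (0::real)" by (metis \<delta>_def zero_neq_one)
    qed simp
    fix A :: "real^'n^'n" and ws and x :: "real^'n"
    assume ws: "symbol_decomposition \<sigma> A b ws" and x: "x \<in> ball 0 (L / 8)"
    have each: "- levy_symbol \<sigma> A (w *\<^sub>R axis j 1) * cos (w * x $ j) \<le> - e" for j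
    proof -
      have "w powr (\<sigma> - 2) * (b * w\<^sup>2) \<le> levy_symbol \<sigma> A (w *\<^sub>R axis j 1)"
      proof -
        have "0 \<le> (\<Sum>v\<leftarrow>ws. (v \<bullet> (w *\<^sub>R axis j 1))\<^sup>2)" by (intro sum_list_nonneg) auto
        then show ?thesis using ws w by (simp add: symbol_decomposition_def norm_axis_1)
      qed
      moreover have "w powr (\<sigma> - 2) * (b * w\<^sup>2) = 2 * e" using w by (simp add: e_def powr_diff powr_numeral)
      ultimately have l: "2 * e \<le> levy_symbol \<sigma> A (w *\<^sub>R axis j 1)" by simp
      have "\<bar>x $ j\<bar> \<le> L / 8" using x component_le_norm_cart[of x j] by simp
      then have "w * \<bar>x $ j\<bar> \<le> w * (L / 8)" using w by (intro mult_left_mono) auto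
      also have "\<dots> = pi / 4" using L by (simp add: w_def)
      finally have xw: "\<bar>w * x $ j\<bar> \<le> pi / 4" using w by (simp add: abs_mult)
      have "cos (pi / 3) \<le> cos \<bar>w * x $ j\<bar>"
        using xw pi_gt_zero by (intro cos_monotone_0_pi_le) linarith+
      then have "1 / 2 \<le> cos (w * x $ j)" by (simp add: cos_60)
      then have "2 * e * (1 / 2) \<le> levy_symbol \<sigma> A (w *\<^sub>R axis j 1) * cos (w * x $ j)"
        using l \<open>0 < e\<close> by (intro mult_mono) auto
      then show ?thesis by simp
    qed
    have "levy_op \<sigma> A \<beta> x = (\<Sum>j\<in>UNIV. - levy_symbol \<sigma> A (w *\<^sub>R axis j 1) * cos (w * x $ j))"
      unfolding \<beta>_def levy_op_trig_sum[OF \<sigma>] w_def[symmetric] lat by (simp add: axis_inner)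
    also have "\<dots> \<le> (\<Sum>j\<in>(UNIV::'n set). - e)" by (intro sum_mono each)
    also have "\<dots> = - (real CARD('n) * e)" by simp
    also have "\<dots> \<le> - e"
    proof -
      have "1 * e \<le> real CARD('n) * e" using \<open>0 < e\<close> by (intro mult_right_mono) (auto simp: Suc_leI)
      then show ?thesis by simp
    qed
    finally show "levy_op \<sigma> A \<beta> x \<le> - e" .
  qed
qed

text \<open>The extra \<open>C\<close> on \<open>K\<close> is meant for points where
  \<open>g\<close> may be as large as \<open>C\<close>; \<eta> absorbs small values of
  \<open>g\<close> in the rest of the ball. The integral over a cell is the only sense in which the
  barrier is small.\<close>

definition small_barrier ::
    "real \<Rightarrow> real \<Rightarrow> real \<Rightarrow> real \<Rightarrow> (real^'n) set \<Rightarrow> real \<Rightarrow> real \<Rightarrow> real \<Rightarrow> (real^'n \<Rightarrow> real) \<Rightarrow> bool" where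
  "small_barrier \<sigma> lam \<Lambda> L K C \<eta> d \<Phi> \<longleftrightarrow> smooth_test \<Phi> \<and> (\<forall>x. 0 \<le> \<Phi> x) \<and>
     integrable lborel (\<lambda>x. indicator (period_cell L) x * \<Phi> x) \<and>
     (\<integral>x. indicator (period_cell L) x * \<Phi> x \<partial>lborel) \<le> d \<and>
     (\<forall>A\<in>admissible lam \<Lambda>. \<forall>x\<in>ball 0 (L / 8). levy_op \<sigma> A \<Phi> x \<le> - \<eta>) \<and>
     (\<forall>A\<in>admissible lam \<Lambda>. \<forall>x\<in>K. levy_op \<sigma> A \<Phi> x \<le> - C - \<eta>)"

text \<open>The barrier is \<open>c1 * \<phi> + c2 * \<beta> + c3\<close>: \<phi> is strongly
  negative for the operators on \<open>K\<close>, \<beta> repairs the defect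
  \<open>S * \<rho>\<close> of \<phi> in the ball, and \<open>c3\<close> restores nonnegativity.
  Both \<phi> and \<beta> have mean zero, so the integral is \<open>c3\<close> times the volume of
  the cell, of order \<open>\<rho> + \<eta>\<close>.\<close>

proposition small_supersolution:
  assumes \<sigma>: "0 < \<sigma>" "\<sigma> < 2" and lam: "0 < lam" and L: "0 < L" and C: "0 \<le> C"
  obtains D where "0 < D"
    "\<And>(K :: (real^'n) set) E \<rho> \<eta>. compact K \<Longrightarrow> K \<subseteq> E \<Longrightarrow> open E \<Longrightarrow> E \<subseteq> ball 0 (L / 8) \<Longrightarrow> 0 < \<rho> \<Longrightarrow>
      measure lebesgue E \<le> (2 * \<rho>) ^ CARD('n) \<Longrightarrow> 0 \<le> \<eta> \<Longrightarrow> \<exists>\<Phi>. small_barrier \<sigma> lam \<Lambda> L K C \<eta> (D * (\<rho> + \<eta>)) \<Phi>"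
proof -
  define n where "n = real CARD('n)"
  have n: "1 \<le> n" by (simp add: n_def Suc_leI)
  obtain b Cw where b: "0 < b" and Cw: "0 \<le> Cw" and ws: "\<And>A :: real^'n^'n. A \<in> admissible lam \<Lambda> \<Longrightarrow>
       \<exists>ws. (\<Sum>w\<leftarrow>ws. (norm w)\<^sup>2) \<le> Cw \<and> symbol_decomposition \<sigma> A b ws"
    using levy_symbol_sum_of_squares[OF \<sigma> lam, of \<Lambda>] by blast
  obtain \<beta> :: "real^'n \<Rightarrow> real" and e where e: "0 < e" and \<beta>: "smooth_test \<beta>" "\<And>x. \<bar>\<beta> x\<bar> \<le> real CARD('n)"
    "(\<integral>x. indicator (period_cell L) x * \<beta> x \<partial>lborel) = 0"
    "\<And>A ws x. symbol_decomposition \<sigma> A b ws \<Longrightarrow> x \<in> ball 0 (L / 8) \<Longrightarrow> levy_op \<sigma> A \<beta> x \<le> - e"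
  proof (rule cosine_barrier[where 'n='n, OF \<sigma> L b], goal_cases)
    case 1 from 1(2-) show ?thesis by (rule 1(1))
  qed
  note \<beta>n = \<beta>(2)[folded n_def]
  have \<alpha>: "0 < 2 - \<sigma>" "2 - \<sigma> < 2" using \<sigma> by auto
  obtain Df where Df: "0 < Df" and frac: "\<And>(I :: (('n \<Rightarrow> int) \<times> nat) set) c (\<xi> :: _ \<Rightarrow> real^'n) \<theta> k1 k2 x.
    semiconvex_trig I c \<xi> \<theta> k1 k2 \<Longrightarrow> 0 \<le> k2 \<Longrightarrow>
    - Df * (k1 + k2) \<le> trig_sum I (\<lambda>i. - c i * norm (\<xi> i) powr (2 - \<sigma>)) \<xi> \<theta> x"
  proof (rule fractional_lower_bound[where 'i="('n \<Rightarrow> int) \<times> nat" and 'n='n, OF \<alpha>], goal_cases)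
    case 1 from 1(2-) show ?thesis by (rule 1(1))
  qed
  define K1 where "K1 = L * n ^ 3"
  define K2 where "K2 = 8 * n / L"
  have K12: "0 < K1" "0 < K2" using L n by (simp_all add: K1_def K2_def)
  \<comment> \<open>\<open>S * \<rho>\<close> bounds every operator on \<phi> from above:
    \<open>Cw\<close> accounts for the directions of the squares, \<open>b * n\<close> for the axes
    in the Laplacian.\<close>
  define S where "S = (Cw + b * n) * K2"
  have S: "0 < S" using Cw b n K12 by (simp add: S_def add_nonneg_pos)
  \<comment> \<open>On \<open>K\<close> the Laplacian of the semiconvex sum is at least
    \<open>1 / 24\<close> up to an error of order \<rho>, which \<open>S\<close> covers;
    \<open>c1 * b / 24 = C + 1\<close> leaves one unit to spare.\<close>
  define c1 where "c1 = 24 * (C + 1) / b"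
  have c1: "0 < c1" using C b by (simp add: c1_def)
  define q where "q = measure lborel (period_cell L :: (real^'n) set)"
  have q: "0 \<le> q" by (simp add: q_def)
  have qi: "integrable lborel (indicator (period_cell L :: (real^'n) set) :: _ \<Rightarrow> real)"
    by (intro integrable_real_indicator) (auto simp: emeasure_bounded_finite[OF bounded_period_cell, unfolded infinity_ennreal_def])
  define D where "D = (q + 1) * (c1 * (Df * (K1 + K2)) + (c1 * S + 1) / e * n)"
  have m: "0 < c1 * (Df * (K1 + K2))" "0 < (c1 * S + 1) / e * n"
    using c1 Df K12 S e n by (auto intro!: mult_pos_pos divide_pos_pos add_pos_pos)
  have D: "0 < D" unfolding D_def using q m by (intro mult_pos_pos) auto
  show ?thesis
  proof (rule that[OF D])
    fix K E :: "(real^'n) set" and \<rho> \<eta> :: real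
    assume K: "compact K" "K \<subseteq> E" and E: "open E" "E \<subseteq> ball 0 (L / 8)" and \<rho>: "0 < \<rho>"
      and vol: "measure lebesgue E \<le> (2 * \<rho>) ^ CARD('n)" and \<eta>: "0 \<le> \<eta>"
    obtain I :: "(('n \<Rightarrow> int) \<times> nat) set" and c k \<theta> where
      W0: "semiconvex_trig I c (\<lambda>i. lattice_vec (2 * pi / L) (k i)) \<theta> (L * n ^ 3 * \<rho>) (8 * n / L * \<rho>)"
      "\<And>x. x \<in> K \<Longrightarrow> 1 / 24 - 4 * n\<^sup>2 / L * \<rho> \<le> (\<Sum>j\<in>UNIV. trig_hess I c (\<lambda>i. lattice_vec (2 * pi / L) (k i)) \<theta> x (axis j 1))"
      using semiconvex_trig_sum_exists[OF L K E \<rho> vol] unfolding n_def by blast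
    define \<xi> where "\<xi> = (\<lambda>i. lattice_vec (2 * pi / L) (k i) :: real^'n)"
    have W: "semiconvex_trig I c \<xi> \<theta> (K1 * \<rho>) (K2 * \<rho>)" using W0(1) by (simp add: K1_def K2_def \<xi>_def)
    then have I: "finite I" and hess: "- (K2 * \<rho>) * (norm v)\<^sup>2 \<le> trig_hess I c \<xi> \<theta> x v" for x v
      by (auto simp: semiconvex_trig_def)
    define \<phi> where "\<phi> = trig_sum I (\<lambda>i. - c i * norm (\<xi> i) powr (2 - \<sigma>)) \<xi> \<theta>"
    have \<phi>t: "smooth_test \<phi>" unfolding \<phi>_def by (rule smooth_test_trig_sum[OF I])
    have "- Df * (K1 * \<rho> + K2 * \<rho>) \<le> \<phi> x" for x
      unfolding \<phi>_def using K12 \<rho> by (intro frac[OF W]) simp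
    then have \<phi>_ge: "- (Df * (K1 + K2) * \<rho>) \<le> \<phi> x" for x by (simp add: algebra_simps)
    have \<phi>_int: "(\<integral>x. indicator (period_cell L) x * \<phi> x \<partial>lborel) = 0"
      unfolding \<phi>_def \<xi>_def
    proof (rule integral_period_cell_trig_sum[OF L I])
      fix i assume "k i = (\<lambda>_. 0)"
      \<comment> \<open>The factor \<open>norm \<xi> powr (2 - \<sigma>)\<close> vanishes at
        frequency zero, so the fractional Laplacian has no constant term and mean zero.\<close>
      then have "lattice_vec (2 * pi / L) (k i) = (0 :: real^'n)" by (simp add: vec_eq_iff)
      then show "- c i * norm (lattice_vec (2 * pi / L) (k i) :: real^'n) powr (2 - \<sigma>) = 0" by simp
    qed
    have op_\<phi>: "levy_op \<sigma> A \<phi> x \<le> Cw * (K2 * \<rho>) - b * (\<Sum>j\<in>UNIV. trig_hess I c \<xi> \<theta> x (axis j 1))" if A: "A \<in> admissible lam \<Lambda>" for A x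
    proof -
      obtain vs where vs: "(\<Sum>w\<leftarrow>vs. (norm w)\<^sup>2) \<le> Cw" "symbol_decomposition \<sigma> A b vs"
        using ws[OF A] by blast
      have "- (Cw * (K2 * \<rho>)) \<le> - ((\<Sum>w\<leftarrow>vs. (norm w)\<^sup>2) * (K2 * \<rho>))"
        using vs(1) K12 \<rho> by (simp add: mult_right_mono)
      also have "\<dots> = (\<Sum>w\<leftarrow>vs. - (K2 * \<rho>) * (norm w)\<^sup>2)" by (induction vs) (simp_all add: algebra_simps)
      also have "\<dots> \<le> (\<Sum>w\<leftarrow>vs. trig_hess I c \<xi> \<theta> x w)" by (intro sum_list_mono hess)
      finally show ?thesis unfolding \<phi>_def levy_op_fractional[OF \<sigma> I vs(2)] by simp
    qed
    have op_all: "levy_op \<sigma> A \<phi> x \<le> S * \<rho>" if A: "A \<in> admissible lam \<Lambda>" for A x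
    proof -
      have "(\<Sum>j\<in>(UNIV::'n set). - (K2 * \<rho>)) \<le> (\<Sum>j\<in>UNIV. trig_hess I c \<xi> \<theta> x (axis j 1))"
      proof (rule sum_mono)
        fix j :: 'n show "- (K2 * \<rho>) \<le> trig_hess I c \<xi> \<theta> x (axis j 1)" using hess[of "axis j 1" x] by (simp add: norm_axis_1)
      qed
      then have "- (n * (K2 * \<rho>)) \<le> (\<Sum>j\<in>UNIV. trig_hess I c \<xi> \<theta> x (axis j 1))" by (simp add: n_def)
      then have "b * - (n * (K2 * \<rho>)) \<le> b * (\<Sum>j\<in>UNIV. trig_hess I c \<xi> \<theta> x (axis j 1))" using b by (intro mult_left_mono) auto
      then show ?thesis using op_\<phi>[OF A, of x] by (simp add: S_def algebra_simps)
    qed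
    have op_K: "levy_op \<sigma> A \<phi> x \<le> S * \<rho> - b / 24" if A: "A \<in> admissible lam \<Lambda>" and x: "x \<in> K" for A x
    proof -
      have "1 / 24 - n * K2 * \<rho> \<le> 1 / 24 - 4 * n\<^sup>2 / L * \<rho>" using n L \<rho> by (simp add: K2_def power2_eq_square divide_right_mono mult_right_mono)
      also have "\<dots> \<le> (\<Sum>j\<in>UNIV. trig_hess I c \<xi> \<theta> x (axis j 1))" using W0(2)[OF x] by (simp add: \<xi>_def)
      finally have "b * (1 / 24 - n * K2 * \<rho>) \<le> b * (\<Sum>j\<in>UNIV. trig_hess I c \<xi> \<theta> x (axis j 1))" using b by (intro mult_left_mono) auto
      then show ?thesis using op_\<phi>[OF A, of x] by (simp add: S_def algebra_simps)
    qed
    define c2 where "c2 = (c1 * (S * \<rho>) + \<eta>) / e"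
    have c2: "0 \<le> c2" using c1 S \<rho> \<eta> e by (simp add: c2_def)
    define c3 where "c3 = c1 * (Df * (K1 + K2) * \<rho>) + c2 * n"
    have c3: "0 \<le> c3" using c1 Df K12 \<rho> c2 n by (simp add: c3_def)
    define \<Phi> where "\<Phi> = (\<lambda>x. c1 * \<phi> x + c2 * \<beta> x + c3)"
    have \<Phi>op: "levy_op \<sigma> A \<Phi> x = c1 * levy_op \<sigma> A \<phi> x + c2 * levy_op \<sigma> A \<beta> x" for A x
      unfolding \<Phi>_def by (rule levy_op_linear[OF \<sigma> \<phi>t \<beta>(1)])
    have op_\<beta>: "c2 * levy_op \<sigma> A \<beta> x \<le> - (c1 * (S * \<rho>) + \<eta>)" if A: "A \<in> admissible lam \<Lambda>" and x: "x \<in> ball 0 (L / 8)" for A x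
    proof -
      have "levy_op \<sigma> A \<beta> x \<le> - e" using ws[OF A] \<beta>(4) x by blast
      then have "c2 * levy_op \<sigma> A \<beta> x \<le> c2 * - e" using c2 by (intro mult_left_mono)
      then show ?thesis using e by (simp add: c2_def)
    qed
    have t: "smooth_test \<Phi>"
      unfolding \<Phi>_def by (intro smooth_test_add smooth_test_cmult \<phi>t \<beta>(1) smooth_test_const)
    have int\<phi>: "integrable lborel (\<lambda>x. indicator (period_cell L) x * \<phi> x)"
      unfolding \<phi>_def by (rule integrable_indicator_bounded[OF period_cell_borel bounded_period_cell _ trig_sum_bounded]) simp
    have int\<beta>: "integrable lborel (\<lambda>x. indicator (period_cell L) x * \<beta> x)"
      using \<beta>(1) by (intro integrable_indicator_bounded[OF period_cell_borel bounded_period_cell _ \<beta>(2)]) (simp add: smooth_test_def)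
    have eq: "(\<lambda>x. indicator (period_cell L) x * \<Phi> x) = (\<lambda>x. c1 * (indicator (period_cell L) x * \<phi> x) + c2 * (indicator (period_cell L) x * \<beta> x) + c3 * indicator (period_cell L) x)"
      by (simp add: \<Phi>_def fun_eq_iff algebra_simps)
    have int\<Phi>: "integrable lborel (\<lambda>x. indicator (period_cell L) x * \<Phi> x)"
      unfolding eq using int\<phi> int\<beta> qi by simp
    have "(\<integral>x. indicator (period_cell L) x * \<Phi> x \<partial>lborel) = c3 * q"
      unfolding eq using int\<phi> int\<beta> qi \<phi>_int \<beta>(3) by (simp add: q_def)
    also have "\<dots> \<le> D * (\<rho> + \<eta>)"
    proof -
      have "c2 \<le> (c1 * S + 1) / e * (\<rho> + \<eta>)"
      proof -
        have "c1 * (S * \<rho>) + \<eta> \<le> (c1 * S + 1) * (\<rho> + \<eta>)" using c1 S \<rho> \<eta> by (simp add: algebra_simps)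
        then show ?thesis unfolding c2_def using e by (simp add: divide_right_mono)
      qed
      then have "c2 * n \<le> ((c1 * S + 1) / e * (\<rho> + \<eta>)) * n" using n by (intro mult_right_mono) auto
      then have "c2 * n \<le> (c1 * S + 1) / e * n * (\<rho> + \<eta>)" by (simp only: mult.assoc mult.commute[of _ n])
      moreover have "c1 * (Df * (K1 + K2) * \<rho>) \<le> c1 * (Df * (K1 + K2)) * (\<rho> + \<eta>)"
        unfolding mult.assoc[symmetric, of c1 _ \<rho>] using m(1) \<eta> by (intro mult_left_mono) auto
      ultimately have "c3 \<le> (c1 * (Df * (K1 + K2)) + (c1 * S + 1) / e * n) * (\<rho> + \<eta>)"
        unfolding c3_def distrib_right by (rule add_mono[rotated])
      then have "c3 * q \<le> (c1 * (Df * (K1 + K2)) + (c1 * S + 1) / e * n) * (\<rho> + \<eta>) * (q + 1)"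
        using q c3 by (intro mult_mono) auto
      then show ?thesis by (simp add: D_def mult_ac)
    qed
    finally have int_le: "(\<integral>x. indicator (period_cell L) x * \<Phi> x \<partial>lborel) \<le> D * (\<rho> + \<eta>)" .
    show "\<exists>\<Phi>. small_barrier \<sigma> lam \<Lambda> L K C \<eta> (D * (\<rho> + \<eta>)) \<Phi>"
      unfolding small_barrier_def
    proof (intro exI[of _ \<Phi>] conjI allI ballI t int\<Phi> int_le)
      fix x
      have "c1 * - (Df * (K1 + K2) * \<rho>) \<le> c1 * \<phi> x" using \<phi>_ge c1 by (intro mult_left_mono) auto
      moreover have "c2 * - n \<le> c2 * \<beta> x" using \<beta>n[of x] c2 by (intro mult_left_mono) (auto simp: abs_le_iff)
      ultimately show "0 \<le> \<Phi> x" by (simp add: \<Phi>_def c3_def)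
    next
      fix A :: "real^'n^'n" and x :: "real^'n" assume A: "A \<in> admissible lam \<Lambda>" and x: "x \<in> ball 0 (L / 8)"
      have "c1 * levy_op \<sigma> A \<phi> x \<le> c1 * (S * \<rho>)" using op_all[OF A] c1 by (intro mult_left_mono) auto
      then show "levy_op \<sigma> A \<Phi> x \<le> - \<eta>" using op_\<beta>[OF A x] by (simp add: \<Phi>op)
    next
      fix A :: "real^'n^'n" and x :: "real^'n" assume A: "A \<in> admissible lam \<Lambda>" and x: "x \<in> K"
      have "c1 * levy_op \<sigma> A \<phi> x \<le> c1 * (S * \<rho> - b / 24)" using op_K[OF A x] c1 by (intro mult_left_mono) auto
      also have "\<dots> = c1 * (S * \<rho>) - (C + 1)" using b by (simp add: c1_def field_simps)
      finally show "levy_op \<sigma> A \<Phi> x \<le> - C - \<eta>" using op_\<beta>[OF A, of x] x K E by (auto simp: \<Phi>op)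
    qed
  qed
qed

section \<open>Viscosity subsolutions\<close>

lemma levy_kernel_admissible:
  fixes A :: "real^'n^'n"
  assumes "A \<in> admissible lam \<Lambda>"
  shows "0 \<le> levy_kernel \<sigma> A y" "y \<bullet> (A *v y) \<le> \<Lambda> * (norm y)\<^sup>2"
    "levy_kernel \<sigma> A y \<le> \<Lambda> / norm y powr (real CARD('n) + \<sigma>)"
proof -
  show "0 \<le> levy_kernel \<sigma> A y" using assms by (simp add: levy_kernel_def admissible_def psd_def)
  have "0 \<le> y \<bullet> ((mat \<Lambda> - A) *v y)" using assms by (simp add: admissible_def psd_def)
  then show le: "y \<bullet> (A *v y) \<le> \<Lambda> * (norm y)\<^sup>2"
    by (simp add: matrix_vector_mult_diff_rdistrib inner_diff_right mat_form)
  show "levy_kernel \<sigma> A y \<le> \<Lambda> / norm y powr (real CARD('n) + \<sigma>)"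
  proof (cases "y = 0")
    case False
    have "levy_kernel \<sigma> A y \<le> \<Lambda> * (norm y)\<^sup>2 / norm y powr (real CARD('n) + \<sigma> + 2)"
      unfolding levy_kernel_def using le by (intro divide_right_mono) auto
    also have "\<dots> = \<Lambda> / norm y powr (real CARD('n) + \<sigma>)" using False by (simp add: powr_add powr_numeral)
    finally show ?thesis .
  qed (simp add: levy_kernel_def)
qed

text \<open>Passes from strict to weak contact: adding
  \<open>\<tau> * (norm (y - x))\<^sup>2\<close> makes the contact strict and changes the operator
  by at most \<open>e / 2\<close>, and a matrix that almost attains the supremum costs another
  \<open>e / 2\<close>. The test function replaces \<open>v\<close> only in a ball of radius
  \<open>s\<close>, which may be taken as small as desired.\<close>

lemma viscosity_test:
  fixes v :: "real^'n \<Rightarrow> real"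
  assumes \<sigma>: "0 < \<sigma>" "\<sigma> < 2" and sub: "viscosity_subsolution \<sigma> lam \<Lambda> B v h" and B: "open B" and x: "x \<in> B"
    and \<Theta>: "smooth_test \<Theta>" and le: "\<And>y. y \<in> B \<Longrightarrow> v y \<le> \<Theta> y" and eq: "v x = \<Theta> x"
    and e: "0 < e" and s0: "0 < s0"
  obtains A s where "A \<in> admissible lam \<Lambda>" "0 < s" "s \<le> s0"
    "integrable lebesgue (\<lambda>y. (if norm y < s then second_diff \<Theta> x y else second_diff v x y) * levy_kernel \<sigma> A y)"
    "h x - e < (\<integral>y. (if norm y < s then second_diff \<Theta> x y else second_diff v x y) * levy_kernel \<sigma> A y \<partial>lebesgue)"
proof -
  obtain s1 where s1: "0 < s1" "ball x s1 \<subseteq> B" using B x by (auto simp: open_contains_ball)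
  define s where "s = min s1 (min s0 1)"
  have s: "0 < s" "s \<le> s0" "s \<le> 1" "ball x s \<subseteq> B" using s1 s0 by (auto simp: s_def)
  define p where "p = real CARD('n) + \<sigma>"
  define J where "J = (\<integral>z. min 1 ((norm z)\<^sup>2) / norm (z::real^'n) powr p \<partial>lebesgue)"
  have Ji: "integrable lebesgue (\<lambda>z::real^'n. min 1 ((norm z)\<^sup>2) / norm z powr p)"
    using integrable_min_kernel[OF \<sigma>, where 'a="real^'n"] by (simp add: p_def integrable_completion)
  have J: "0 \<le> J" unfolding J_def by (intro integral_nonneg_AE) auto
  define \<tau> where "\<tau> = e / (4 * (\<bar>\<Lambda>\<bar> * J + 1))"
  have \<tau>: "0 < \<tau>" using e J by (simp add: \<tau>_def add_nonneg_pos)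
  have \<tau>J: "2 * \<tau> * (\<bar>\<Lambda>\<bar> * J) \<le> e / 2"
  proof -
    have "4 * \<tau> * (\<bar>\<Lambda>\<bar> * J) \<le> 4 * \<tau> * (\<bar>\<Lambda>\<bar> * J + 1)" using \<tau> by (intro mult_left_mono) auto
    also have "\<dots> = e"
    proof -
      have "0 < \<bar>\<Lambda>\<bar> * J + 1" using J by (simp add: add_nonneg_pos)
      moreover have "4 * (e / (4 * d)) * d = e" if "0 < d" for d using that by simp
      ultimately show ?thesis unfolding \<tau>_def by blast
    qed
    finally show ?thesis by simp
  qed
  define \<psi> where "\<psi> = (\<lambda>y. \<Theta> y + \<tau> * (norm (y - x))\<^sup>2)"
  define V where "V = (\<lambda>y. if y \<in> ball x s then \<psi> y else v y)"
  define F where "F = (\<lambda>y. if norm y < s then second_diff \<Theta> x y else second_diff v x y)"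
  define q where "q = (\<lambda>y::real^'n. if norm y < s then 2 * (norm y)\<^sup>2 else 0)"
  have "C2_closure (ball x s) \<psi>"
    unfolding \<psi>_def using \<Theta> by (intro C2_closure_add C2_closure_cmult C2_closure_norm_square) (auto simp: smooth_test_def)
  moreover have "v y < \<psi> y" if "y \<in> ball x s - {x}" for y
  proof -
    have "0 < \<tau> * (norm (y - x))\<^sup>2" using that \<tau> by simp
    moreover have "v y \<le> \<Theta> y" using that s(4) by (intro le) auto
    ultimately show ?thesis by (simp add: \<psi>_def)
  qed
  moreover have "\<psi> x = v x" by (simp add: \<psi>_def eq)
  ultimately have "ereal (h x) \<le> extremal_op \<sigma> lam \<Lambda> V x"
    using sub x s(1,4) unfolding viscosity_subsolution_def V_def by (meson centre_in_ball open_ball)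
  moreover have "ereal (h x - e / 2) < ereal (h x)" using e by simp
  ultimately have "ereal (h x - e / 2) < (SUP A\<in>admissible lam \<Lambda>. ereal (levy_op \<sigma> A V x))"
    unfolding extremal_op_eq by (rule less_le_trans[rotated])
  then obtain A where A: "A \<in> admissible lam \<Lambda>" and opV: "h x - e / 2 < levy_op \<sigma> A V x"
    by (auto simp: less_SUP_iff)
  have sdV: "second_diff V x y = F y + \<tau> * q y" for y
  proof -
    have "x + y \<in> ball x s \<longleftrightarrow> norm y < s" "x - y \<in> ball x s \<longleftrightarrow> norm y < s" "x \<in> ball x s"
      using s(1) by (auto simp: dist_norm)
    then show ?thesis by (auto simp: second_diff_def V_def F_def q_def \<psi>_def eq algebra_simps)
  qed
  obtain M where M: "\<And>x y. \<bar>second_diff \<Theta> x y\<bar> \<le> M * min 1 ((norm y)\<^sup>2)" using \<Theta> unfolding smooth_test_def by blast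
  have v: "bounded (range v)" "v \<in> borel_measurable lebesgue" using sub by (auto simp: viscosity_subsolution_def)
  then obtain N where N: "\<And>y. \<bar>v y\<bar> \<le> N" by (auto simp: bounded_iff)
  have N0: "0 \<le> N" using N[of 0] by linarith
  have M0: "0 \<le> M" using M[of 0 "axis undefined 1"] by (simp add: norm_axis_1)
  have F_meas: "F \<in> borel_measurable lebesgue"
  proof -
    have [measurable]: "second_diff v x \<in> borel_measurable lebesgue" "second_diff \<Theta> x \<in> borel_measurable lebesgue"
      by (rule second_diff_lebesgue_measurable[OF v(2)])
        (use \<Theta> in \<open>auto simp: smooth_test_def intro!: second_diff_lebesgue_measurable intro: measurable_completion\<close>)
    have [measurable]: "(norm :: real^'n \<Rightarrow> real) \<in> borel_measurable lebesgue" by (intro measurable_completion) simp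
    show ?thesis unfolding F_def by measurable
  qed
  \<comment> \<open>Inside the ball the bound for \<Theta> applies; outside, the second difference
    of \<open>v\<close> is at most \<open>4 * N\<close>, and since \<open>s \<le> norm y\<close> and
    \<open>s \<le> 1\<close>, the quotient \<open>min 1 ((norm y)\<^sup>2) / s\<^sup>2\<close> is at
    least one.\<close>
  have F_bd: "\<bar>F y\<bar> \<le> (M + 4 * N / s\<^sup>2) * min 1 ((norm y)\<^sup>2)" for y
  proof (cases "norm y < s")
    case True
    have "\<bar>F y\<bar> \<le> M * min 1 ((norm y)\<^sup>2)" using M True by (simp add: F_def)
    also have "\<dots> \<le> (M + 4 * N / s\<^sup>2) * min 1 ((norm y)\<^sup>2)" using N0 by (intro mult_right_mono) auto
    finally show ?thesis .
  next
    case False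
    have "\<bar>F y\<bar> \<le> 4 * N" using False N[of "x + y"] N[of "x - y"] N[of x] unfolding F_def second_diff_def by (simp add: abs_le_iff)
    also have "\<dots> = 4 * N / s\<^sup>2 * s\<^sup>2" using s(1) by simp
    also have "\<dots> \<le> 4 * N / s\<^sup>2 * min 1 ((norm y)\<^sup>2)"
    proof (intro mult_left_mono)
      have "s\<^sup>2 \<le> 1\<^sup>2" using s by (intro power_mono) auto
      moreover have "s\<^sup>2 \<le> (norm y)\<^sup>2" using False s by (intro power_mono) auto
      ultimately show "s\<^sup>2 \<le> min 1 ((norm y)\<^sup>2)" by simp
    qed (use N0 in simp)
    also have "\<dots> \<le> (M + 4 * N / s\<^sup>2) * min 1 ((norm y)\<^sup>2)" using M0 by (intro mult_right_mono) auto
    finally show ?thesis .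
  qed
  have F_int: "integrable lebesgue (\<lambda>y. F y * levy_kernel \<sigma> A y)"
    by (rule integrable_levy_kernel[OF \<sigma> F_meas F_bd])
  have q_meas: "q \<in> borel_measurable lebesgue" unfolding q_def by (intro measurable_completion) measurable
  have q_bd: "\<bar>q y\<bar> \<le> 2 * min 1 ((norm y)\<^sup>2)" for y
  proof (cases "norm y < s")
    case True
    then have "(norm y)\<^sup>2 \<le> 1" using s by (intro power_le_one) auto
    then show ?thesis using True by (simp add: q_def)
  qed (simp add: q_def)
  have q_int: "integrable lebesgue (\<lambda>y. q y * levy_kernel \<sigma> A y)"
    by (rule integrable_levy_kernel[OF \<sigma> q_meas q_bd])
  have "(\<integral>y. q y * levy_kernel \<sigma> A y \<partial>lebesgue) \<le> (\<integral>y. 2 * \<bar>\<Lambda>\<bar> * (min 1 ((norm (y::real^'n))\<^sup>2) / norm y powr p) \<partial>lebesgue)"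
  proof (rule integral_mono[OF q_int])
    show "integrable lebesgue (\<lambda>y::real^'n. 2 * \<bar>\<Lambda>\<bar> * (min 1 ((norm y)\<^sup>2) / norm y powr p))"
      using Ji by (rule integrable_mult_right)
    fix y
    have "q y * levy_kernel \<sigma> A y \<le> (2 * min 1 ((norm y)\<^sup>2)) * (\<bar>\<Lambda>\<bar> / norm y powr p)"
    proof (intro mult_mono)
      show "q y \<le> 2 * min 1 ((norm y)\<^sup>2)" using q_bd[of y] by simp
      have "levy_kernel \<sigma> A y \<le> \<Lambda> / norm y powr p" using levy_kernel_admissible(3)[OF A] by (simp add: p_def)
      also have "\<dots> \<le> \<bar>\<Lambda>\<bar> / norm y powr p" by (intro divide_right_mono) auto
      finally show "levy_kernel \<sigma> A y \<le> \<bar>\<Lambda>\<bar> / norm y powr p" .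
    qed (use levy_kernel_admissible(1)[OF A] in auto)
    then show "q y * levy_kernel \<sigma> A y \<le> 2 * \<bar>\<Lambda>\<bar> * (min 1 ((norm y)\<^sup>2) / norm y powr p)" by (simp add: mult_ac)
  qed
  also have "\<dots> = 2 * (\<bar>\<Lambda>\<bar> * J)" unfolding J_def by (subst integral_mult_right_zero) simp
  finally have "\<tau> * (\<integral>y. q y * levy_kernel \<sigma> A y \<partial>lebesgue) \<le> \<tau> * (2 * (\<bar>\<Lambda>\<bar> * J))" using \<tau> by (intro mult_left_mono) auto
  then have qJ: "\<tau> * (\<integral>y. q y * levy_kernel \<sigma> A y \<partial>lebesgue) \<le> e / 2" using \<tau>J by (simp add: mult_ac)
  have "levy_op \<sigma> A V x = (\<integral>y. F y * levy_kernel \<sigma> A y + \<tau> * (q y * levy_kernel \<sigma> A y) \<partial>lebesgue)"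
    unfolding levy_op_def sdV by (simp add: algebra_simps)
  also have "\<dots> = (\<integral>y. F y * levy_kernel \<sigma> A y \<partial>lebesgue) + \<tau> * (\<integral>y. q y * levy_kernel \<sigma> A y \<partial>lebesgue)"
    using F_int q_int by simp
  finally have "h x - e < (\<integral>y. F y * levy_kernel \<sigma> A y \<partial>lebesgue)" using opV qJ by linarith
  with A s F_int show ?thesis by (intro that[of A s]) (auto simp: F_def)
qed

text \<open>If every \<open>x\<close> had a larger value at some \<open>y x\<close>, open sets on
  which \<open>f\<close> stays below \<open>f (y x)\<close> would cover \<open>S\<close>; in a
  finite subcover the point with the largest of these values lies in one of the sets, a
  contradiction.\<close>

lemma usc_on_attains_max:
  fixes f :: "'a::topological_space \<Rightarrow> real"
  assumes S: "compact S" "S \<noteq> {}" and f: "usc_on S f"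
  obtains x where "x \<in> S" "\<And>y. y \<in> S \<Longrightarrow> f y \<le> f x"
proof (rule ccontr)
  assume neg: "\<not> thesis"
  note intro = that
  have "\<exists>y\<in>S. f x < f y" if "x \<in> S" for x
    using neg intro[OF that] by (meson not_less)
  then obtain y where y: "\<And>x. x \<in> S \<Longrightarrow> y x \<in> S \<and> f x < f (y x)" by metis
  have "\<exists>U. open U \<and> x \<in> U \<and> (\<forall>z\<in>U \<inter> S. f z < f (y x))" if "x \<in> S" for x
  proof -
    have "\<forall>\<^sub>F z in at x within S. f z < f (y x)" using f y[OF that] that unfolding usc_on_def by blast
    then obtain U where "open U" "x \<in> U" "\<forall>z\<in>U. z \<noteq> x \<longrightarrow> z \<in> S \<longrightarrow> f z < f (y x)"
      unfolding eventually_at_topological by blast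
    then show ?thesis using y[OF that] by (metis Int_iff)
  qed
  then obtain U where U: "\<And>x. x \<in> S \<Longrightarrow> open (U x) \<and> x \<in> U x \<and> (\<forall>z\<in>U x \<inter> S. f z < f (y x))" by metis
  obtain T where T: "T \<subseteq> S" "finite T" "S \<subseteq> (\<Union>x\<in>T. U x)"
    using compactE_image[OF S(1), of S U] U by blast
  have "T \<noteq> {}" using T(3) S(2) by auto
  then have "Max ((\<lambda>s. f (y s)) ` T) \<in> (\<lambda>s. f (y s)) ` T" using T(2) by (intro Max_in) auto
  then obtain t where t0: "t \<in> T" "f (y t) = Max ((\<lambda>s. f (y s)) ` T)" by auto
  have t: "f (y s) \<le> f (y t)" if "s \<in> T" for s unfolding t0(2) using that T(2) by (intro Max_ge) auto
  have "y t \<in> S" using t0(1) T y by blast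
  then obtain s where "s \<in> T" "y t \<in> U s" using T(3) by blast
  then have "f (y t) < f (y s)" using U T(1) \<open>y t \<in> S\<close> by blast
  then show False using t[OF \<open>s \<in> T\<close>] by simp
qed

lemma usc_on_diff_continuous:
  fixes f g :: "'a::topological_space \<Rightarrow> real"
  assumes f: "usc_on S f" and g: "continuous_on UNIV g"
  shows "usc_on S (\<lambda>x. f x - g x)"
  unfolding usc_on_def
proof (intro ballI allI impI)
  fix x c assume x: "x \<in> S" and c: "f x - g x < c"
  define d where "d = (c - (f x - g x)) / 2"
  have d: "d > 0" using c by (simp add: d_def)
  have "\<forall>\<^sub>F y in at x within S. f y < f x + d" using f x d unfolding usc_on_def by simp
  moreover have "(g \<longlongrightarrow> g x) (at x within S)"
    using g by (meson UNIV_I continuous_on_def subset_UNIV tendsto_within_subset)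
  then have "\<forall>\<^sub>F y in at x within S. g x - d < g y" using d by (intro order_tendstoD(1)) auto
  ultimately show "\<forall>\<^sub>F y in at x within S. f y - g y < c"
    by eventually_elim (use c in \<open>simp add: d_def field_simps\<close>)
qed

lemma smooth_test_continuous: "smooth_test u \<Longrightarrow> continuous_on UNIV u"
  unfolding smooth_test_def C2_closure_def by (metis closure_UNIV)

text \<open>At a maximum point of \<open>v - \<Phi>\<close> the function \<Phi> plus a constant
  \<open>k > m\<close> touches \<open>v\<close> from above. There \<open>v\<close> is at least
  \<open>m\<close>, which is why \<open>super\<close> is demanded only on that superlevel set; later
  this confines the relevant points to a compact subset of \<open>B\<close>.\<close>

lemma viscosity_comparison:
  fixes v :: "real^'n \<Rightarrow> real"
  assumes \<sigma>: "0 < \<sigma>" "\<sigma> < 2" and sub: "viscosity_subsolution \<sigma> lam \<Lambda> B v h" and B: "open B" "bounded B"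
    and out: "\<And>x. x \<notin> B \<Longrightarrow> v x \<le> 0" and \<Phi>: "smooth_test \<Phi>" "\<And>x. 0 \<le> \<Phi> x" and m: "0 < m" and \<tau>: "0 < \<tau>"
    and super: "\<And>x A. x \<in> B \<Longrightarrow> m \<le> v x \<Longrightarrow> A \<in> admissible lam \<Lambda> \<Longrightarrow> levy_op \<sigma> A \<Phi> x \<le> h x - \<tau>"
  shows "v x \<le> \<Phi> x + m"
proof (rule ccontr)
  assume neg: "\<not> v x \<le> \<Phi> x + m"
  then have "x \<in> B" using out[of x] \<Phi>(2)[of x] m by fastforce
  then have xc: "x \<in> closure B" using closure_subset by blast
  have cB: "compact (closure B)" "closure B \<noteq> {}" using B xc by (auto simp: compact_closure)
  have usc: "usc_on (closure B) (\<lambda>x. v x - \<Phi> x)"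
    using sub by (intro usc_on_diff_continuous smooth_test_continuous \<Phi>) (simp add: viscosity_subsolution_def)
  obtain z where z: "z \<in> closure B" "\<And>y. y \<in> closure B \<Longrightarrow> v y - \<Phi> y \<le> v z - \<Phi> z"
    using usc_on_attains_max[OF cB usc] by blast
  define k where "k = v z - \<Phi> z"
  have k: "m < k" using z(2)[OF xc] neg by (simp add: k_def)
  have vz: "m \<le> v z" using k \<Phi>(2)[of z] by (simp add: k_def)
  then have zB: "z \<in> B" using out[of z] m by fastforce
  define \<Theta> where "\<Theta> = (\<lambda>y. \<Phi> y + k)"
  have \<Theta>: "smooth_test \<Theta>" unfolding \<Theta>_def by (intro smooth_test_add smooth_test_const \<Phi>)
  \<comment> \<open>Outside \<open>B\<close> the touching function is positive because
    \<open>k > m > 0\<close>, so the inequality is global and the nonlocal part of the operator can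
    be compared as well.\<close>
  have le: "v y \<le> \<Theta> y" for y
  proof (cases "y \<in> B")
    case True
    then show ?thesis using z(2)[of y] closure_subset by (auto simp: \<Theta>_def k_def algebra_simps)
  next
    case False
    then show ?thesis using out[of y] \<Phi>(2)[of y] k m by (simp add: \<Theta>_def)
  qed
  have eq: "v z = \<Theta> z" by (simp add: \<Theta>_def k_def)
  obtain A s where A: "A \<in> admissible lam \<Lambda>" "0 < s" "s \<le> 1"
    "integrable lebesgue (\<lambda>y. (if norm y < s then second_diff \<Theta> z y else second_diff v z y) * levy_kernel \<sigma> A y)"
    "h z - \<tau> < (\<integral>y. (if norm y < s then second_diff \<Theta> z y else second_diff v z y) * levy_kernel \<sigma> A y \<partial>lebesgue)"
    by (rule viscosity_test[OF \<sigma> sub B(1) zB \<Theta> le eq \<tau> zero_less_one]) (rule that; assumption)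
  have "(\<integral>y. (if norm y < s then second_diff \<Theta> z y else second_diff v z y) * levy_kernel \<sigma> A y \<partial>lebesgue) \<le> levy_op \<sigma> A \<Theta> z"
    unfolding levy_op_def
  proof (rule integral_mono[OF A(4) integrable_levy_op[OF \<sigma> \<Theta>]])
    fix y
    have "(if norm y < s then second_diff \<Theta> z y else second_diff v z y) \<le> second_diff \<Theta> z y"
      using le[of "z + y"] le[of "z - y"] eq by (simp add: second_diff_def)
    then show "(if norm y < s then second_diff \<Theta> z y else second_diff v z y) * levy_kernel \<sigma> A y \<le> second_diff \<Theta> z y * levy_kernel \<sigma> A y"
      by (rule mult_right_mono[OF _ levy_kernel_admissible(1)[OF A(1)]])
  qed
  also have "levy_op \<sigma> A \<Theta> z = levy_op \<sigma> A \<Phi> z" 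
  proof -
    have "second_diff \<Theta> z = second_diff \<Phi> z" by (simp add: \<Theta>_def second_diff_def fun_eq_iff)
    then show ?thesis by (simp add: levy_op_def)
  qed
  also have "\<dots> \<le> h z - \<tau>" by (rule super[OF zB vz A(1)])
  finally show False using A(5) by simp
qed

text \<open>Stays away from the ball of radius \<open>s \<le> \<rho> / 2\<close> in which a test
  function will have replaced the subsolution.\<close>

definition annulus :: "real \<Rightarrow> (real^'n) set" where
  "annulus \<rho> = {y. \<rho> / 2 \<le> norm y \<and> norm y < \<rho>}"

lemma annulus_borel [measurable]: "(annulus \<rho> :: (real^'n) set) \<in> sets borel"
proof -
  have "{y \<in> space (borel :: (real^'n) measure). \<rho> / 2 \<le> norm y \<and> norm y < \<rho>} \<in> sets borel" by measurable
  then show ?thesis by (simp add: annulus_def)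
qed

lemma bounded_annulus: "bounded (annulus \<rho>)"
  by (rule bounded_subset[OF bounded_ball[of 0 \<rho>]]) (auto simp: annulus_def)

text \<open>Reflections and exchanges of coordinates preserve the annulus, so its second moments
  form a multiple of the identity and \<open>A\<close> enters through its trace, which
  \<open>lam\<close> bounds from below; dilation gives the power of \<rho>.\<close>

lemma annulus_quadratic_moment:
  obtains c where "0 < c"
    "\<And>\<rho> (A :: real^'n^'n). integrable lborel (\<lambda>y. indicator (annulus \<rho>) y * (y \<bullet> (A *v y)))"
    "\<And>\<rho> (A :: real^'n^'n). 0 < \<rho> \<Longrightarrow> (\<integral>y. indicator (annulus \<rho>) y * (y \<bullet> (A *v y)) \<partial>lborel) = c * trace A * \<rho> ^ (CARD('n) + 2)"
proof -
  have refl: "indicator (annulus \<rho>) (reflect i z) = (indicator (annulus \<rho>) z :: real)" for \<rho> i and z :: "real^'n"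
    using orthogonal_transformation_norm[OF orthogonal_reflect, of i z] by (simp add: indicator_def annulus_def)
  have swap: "indicator (annulus \<rho>) (swap_coords i k z) = (indicator (annulus \<rho>) z :: real)" for \<rho> i k and z :: "real^'n"
    using orthogonal_transformation_norm[OF orthogonal_swap_coords, of i k z] by (simp add: indicator_def annulus_def)
  have int: "integrable lborel (\<lambda>z::real^'n. indicator (annulus \<rho>) z * (z $ i * z $ j))" for \<rho> i j
  proof -
    have "integrable lborel (\<lambda>z::real^'n. indicator (annulus \<rho>) z * (indicator (annulus \<rho>) z * (z $ i * z $ j)))"
    proof (rule integrable_indicator_bounded[OF annulus_borel bounded_annulus])
      fix z :: "real^'n"
      show "\<bar>indicator (annulus \<rho>) z * (z $ i * z $ j)\<bar> \<le> \<rho>\<^sup>2"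
      proof (cases "z \<in> annulus \<rho>")
        case True
        then have "norm z \<le> \<rho>" by (simp add: annulus_def)
        then have "\<bar>z $ i\<bar> \<le> \<rho>" "\<bar>z $ j\<bar> \<le> \<rho>" using component_le_norm_cart[of z] by (meson order_trans)+
        then have "\<bar>z $ i\<bar> * \<bar>z $ j\<bar> \<le> \<rho> * \<rho>" by (intro mult_mono) auto
        then show ?thesis using True by (simp add: abs_mult power2_eq_square)
      qed simp
    qed measurable
    then show ?thesis by (simp add: mult.assoc[symmetric] indicator_inter_arith[symmetric])
  qed
  obtain i0 :: 'n where True by simp
  define c where "c = (\<integral>z. indicator (annulus 1) z * (z $ i0 * z $ i0) \<partial>lborel)"
  have one: "(\<integral>y. indicator (annulus 1) y * (y \<bullet> (A *v y)) \<partial>lborel) = c * trace A" for A :: "real^'n^'n"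
  proof -
    have "(\<integral>z. indicator (annulus 1) z * (z $ i * z $ i) \<partial>lborel) = c" for i :: 'n
      unfolding c_def using swap by (intro integral_square_swap) auto
    then show ?thesis
      using integral_quadratic_form(2)[of "indicator (annulus 1)" A] int refl by (simp add: trace_def sum_distrib_left mult_ac)
  qed
  have c: "0 < c"
  proof -
    have nn: "0 \<le> indicator (annulus 1) z * (z $ i0 * z $ i0)" for z :: "real^'n" by (simp add: indicator_def)
    have "c \<noteq> 0"
    proof
      assume "c = 0"
      then have "AE z in lborel. indicator (annulus 1) z * (z $ i0 * z $ i0) = (0::real)"
        using integral_nonneg_eq_0_iff_AE[OF int[of 1 i0 i0]] nn by (simp add: c_def)
      then have "AE z in lborel. z \<notin> ball ((3/4) *\<^sub>R axis i0 1 :: real^'n) (1/8)"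
      proof eventually_elim
        case (elim z)
        show ?case
        proof
          assume z: "z \<in> ball ((3/4) *\<^sub>R axis i0 1 :: real^'n) (1/8)"
          have d: "norm (z - (3/4) *\<^sub>R axis i0 1) < 1/8" using z by (simp add: dist_norm norm_minus_commute)
          have "norm z \<le> 3/4 + 1/8"
            using norm_triangle_ineq[of "z - (3/4) *\<^sub>R axis i0 1" "(3/4) *\<^sub>R axis i0 1"] d by (simp add: norm_axis_1)
          moreover have "3/4 - 1/8 \<le> norm z"
            using norm_triangle_ineq[of "(3/4) *\<^sub>R axis i0 1 - z" z] d by (simp add: norm_axis_1 norm_minus_commute)
          ultimately have "z \<in> annulus 1" by (simp add: annulus_def)
          moreover have "\<bar>z $ i0 - 3/4\<bar> < 1/8"
            using component_le_norm_cart[of "z - (3/4) *\<^sub>R axis i0 1" i0] d by simp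
          then have "z $ i0 \<noteq> 0" by auto
          ultimately show False using elim by simp
        qed
      qed
      then have "ball ((3/4) *\<^sub>R axis i0 1 :: real^'n) (1/8) \<in> null_sets lborel" by (subst AE_iff_null_sets) auto
      then have "negligible (ball ((3/4) *\<^sub>R axis i0 1 :: real^'n) (1/8))"
        by (simp add: negligible_iff_null_sets null_sets_completionI)
      then show False using open_not_negligible[OF open_ball, of "(3/4) *\<^sub>R axis i0 1 :: real^'n" "1/8"] by simp
    qed
    moreover have "0 \<le> c" unfolding c_def using nn by (intro integral_nonneg_AE) auto
    ultimately show ?thesis by simp
  qed
  show ?thesis
  proof (rule that[OF c])
    show "integrable lborel (\<lambda>y. indicator (annulus \<rho>) y * (y \<bullet> (A *v y)))" for \<rho> and A :: "real^'n^'n"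
      using int refl by (intro integral_quadratic_form(1)) auto
    fix \<rho> :: real and A :: "real^'n^'n" assume \<rho>: "0 < \<rho>"
    have "(\<integral>y. indicator (annulus \<rho>) y * (y \<bullet> (A *v y)) \<partial>lborel) =
       \<rho> ^ CARD('n) * (\<integral>z. indicator (annulus \<rho>) (\<rho> *\<^sub>R z) * ((\<rho> *\<^sub>R z) \<bullet> (A *v (\<rho> *\<^sub>R z))) \<partial>lborel)"
      by (subst lborel_integral_similarity[OF orthogonal_transformation_id \<rho>]) (auto simp: DIM_cart)
    also have "(\<lambda>z. indicator (annulus \<rho>) (\<rho> *\<^sub>R z) * ((\<rho> *\<^sub>R z) \<bullet> (A *v (\<rho> *\<^sub>R z)))) = (\<lambda>z. \<rho>\<^sup>2 * (indicator (annulus 1) z * (z \<bullet> (A *v z))))"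
    proof
      fix z :: "real^'n"
      have "\<rho> *\<^sub>R z \<in> annulus \<rho> \<longleftrightarrow> z \<in> annulus 1" using \<rho> by (simp add: annulus_def)
      then show "indicator (annulus \<rho>) (\<rho> *\<^sub>R z) * ((\<rho> *\<^sub>R z) \<bullet> (A *v (\<rho> *\<^sub>R z))) = \<rho>\<^sup>2 * (indicator (annulus 1) z * (z \<bullet> (A *v z)))"
        by (simp add: indicator_def matrix_vector_mult_scaleR power2_eq_square)
    qed
    also have "\<rho> ^ CARD('n) * (\<integral>z. \<rho>\<^sup>2 * (indicator (annulus 1) z * (z \<bullet> (A *v z))) \<partial>lborel) = c * trace A * \<rho> ^ (CARD('n) + 2)"
      by (simp add: one power_add power2_eq_square)
    finally show "(\<integral>y. indicator (annulus \<rho>) y * (y \<bullet> (A *v y)) \<partial>lborel) = c * trace A * \<rho> ^ (CARD('n) + 2)" .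
  qed
qed

definition dirichlet_subsolution ::
    "real \<Rightarrow> real \<Rightarrow> real \<Rightarrow> (real^'n) set \<Rightarrow> real \<Rightarrow> (real^'n \<Rightarrow> real) \<Rightarrow> (real^'n \<Rightarrow> real) \<Rightarrow> bool" where
  "dirichlet_subsolution \<sigma> lam \<Lambda> B C v h \<longleftrightarrow> viscosity_subsolution \<sigma> lam \<Lambda> B v h \<and>
     (\<forall>x. x \<notin> B \<longrightarrow> v x \<le> 0) \<and> (\<forall>x\<in>B. - C \<le> h x)"

text \<open>At its maximum \<open>m\<close> the function \<open>v\<close> is touched from above by the constant \<open>m\<close>.  If \<open>v \<le> m / 2\<close>
  on most of a small annulus, then all the nonlocal operators are very negative there.\<close>

proposition viscosity_max_bound:
  assumes \<sigma>: "0 < \<sigma>" "\<sigma> < 2" and lam: "0 < lam" and \<delta>: "0 < \<delta>"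
  obtains t where "0 < t" "\<And>(B :: (real^'n) set) v h x. dirichlet_subsolution \<sigma> lam \<Lambda> B C v h \<Longrightarrow> open B \<Longrightarrow> bounded B \<Longrightarrow>
     measure lebesgue {y \<in> B. \<delta> / 2 < v y} \<le> t \<Longrightarrow> v x \<le> \<delta>"
proof -
  obtain c where c: "0 < c"
    "\<And>\<rho> (A :: real^'n^'n). integrable lborel (\<lambda>y. indicator (annulus \<rho>) y * (y \<bullet> (A *v y)))"
    "\<And>\<rho> (A :: real^'n^'n). 0 < \<rho> \<Longrightarrow> (\<integral>y. indicator (annulus \<rho>) y * (y \<bullet> (A *v y)) \<partial>lborel) = c * trace A * \<rho> ^ (CARD('n) + 2)"
    by (rule annulus_quadratic_moment) (rule that; assumption)
  define p where "p = real CARD('n) + \<sigma> + 2"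
  \<comment> \<open>With \<open>\<rho> powr (- \<sigma>) = R\<close>, the gain
    \<open>\<delta> * lam * c * R / 4\<close> from the annulus equals
    \<open>\<bar>C\<bar> + 2\<close>, which beats the right-hand side and the error \<open>1\<close>
    allowed in the test.\<close>
  define R where "R = 4 * (\<bar>C\<bar> + 2) / (\<delta> * lam * c)"
  have R: "0 < R" using \<delta> lam c(1) by (simp add: R_def)
  define \<rho> where "\<rho> = R powr (- 1 / \<sigma>)"
  have \<rho>: "0 < \<rho>" using R by (simp add: \<rho>_def)
  have \<rho>\<sigma>: "\<rho> powr (- \<sigma>) = R" using \<sigma> R by (simp add: \<rho>_def powr_powr)
  have pow: "\<rho> ^ (CARD('n) + 2) / \<rho> powr p = R"
  proof -
    have "\<rho> ^ (CARD('n) + 2) = \<rho> powr real (CARD('n) + 2)" by (rule powr_realpow[OF \<rho>, symmetric])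
    then show ?thesis by (simp add: p_def \<rho>\<sigma>[symmetric] flip: powr_diff)
  qed
  \<comment> \<open>The exceptional set may spoil at most half of the quadratic moment of the
    annulus, since \<open>y \<bullet> (A *v y)\<close> is at most
    \<open>\<bar>\<Lambda>\<bar> * \<rho>\<^sup>2\<close> there.\<close>
  define t where "t = lam * c * \<rho> ^ CARD('n) / (2 * (\<bar>\<Lambda>\<bar> + 1))"
  have t: "0 < t" using lam c(1) \<rho> by (simp add: t_def)
  have tL: "\<bar>\<Lambda>\<bar> * \<rho>\<^sup>2 * t \<le> lam * c * \<rho> ^ (CARD('n) + 2) / 2"
  proof -
    have "\<bar>\<Lambda>\<bar> * \<rho>\<^sup>2 * t \<le> (\<bar>\<Lambda>\<bar> + 1) * \<rho>\<^sup>2 * t" using t by (intro mult_right_mono) auto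
    also have "\<dots> = \<rho>\<^sup>2 * ((\<bar>\<Lambda>\<bar> + 1) * t)" by simp
    also have "(\<bar>\<Lambda>\<bar> + 1) * t = lam * c * \<rho> ^ CARD('n) / 2"
    proof -
      have "d * (a / (2 * d)) = a / 2" if "0 < d" for a d :: real using that by simp
      then show ?thesis unfolding t_def by (metis abs_ge_zero add_nonneg_pos zero_less_one)
    qed
    finally show ?thesis by (simp add: power_add mult_ac power2_eq_square)
  qed
  show ?thesis
  proof (rule that[OF t])
    fix B :: "(real^'n) set" and v h x
    assume sol: "dirichlet_subsolution \<sigma> lam \<Lambda> B C v h" and B: "open B" "bounded B"
      and small: "measure lebesgue {y \<in> B. \<delta> / 2 < v y} \<le> t"
    then have sub: "viscosity_subsolution \<sigma> lam \<Lambda> B v h"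
      and out: "\<forall>x. x \<notin> B \<longrightarrow> v x \<le> 0" and h: "\<forall>x\<in>B. - C \<le> h x" by (auto simp: dirichlet_subsolution_def)
    show "v x \<le> \<delta>"
    proof (rule ccontr)
      assume "\<not> v x \<le> \<delta>"
      then have vx: "\<delta> < v x" by simp
      then have xB: "x \<in> B" using out \<delta> by fastforce
      then have xc: "x \<in> closure B" using closure_subset by blast
      have cB: "compact (closure B)" "closure B \<noteq> {}" using B xc by (auto simp: compact_closure)
      have usc: "usc_on (closure B) v" using sub by (simp add: viscosity_subsolution_def)
      obtain z where z: "z \<in> closure B" "\<And>y. y \<in> closure B \<Longrightarrow> v y \<le> v z"
        using usc_on_attains_max[OF cB usc] by blast
      define m where "m = v z"
      have m: "\<delta> < m" using z(2)[OF xc] vx by (simp add: m_def)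
      then have zB: "z \<in> B" using out \<delta> by (fastforce simp: m_def)
      have le: "v y \<le> m" for y
      proof (cases "y \<in> B")
        case True
        then show ?thesis using z(2)[of y] closure_subset by (auto simp: m_def)
      next
        case False
        then show ?thesis using out m \<delta> by fastforce
      qed
      obtain A s where A: "A \<in> admissible lam \<Lambda>" "0 < s" "s \<le> \<rho> / 2"
        and int: "integrable lebesgue (\<lambda>y. (if norm y < s then second_diff (\<lambda>_. m) z y else second_diff v z y) * levy_kernel \<sigma> A y)"
        and lower: "h z - 1 < (\<integral>y. (if norm y < s then second_diff (\<lambda>_. m) z y else second_diff v z y) * levy_kernel \<sigma> A y \<partial>lebesgue)"
      proof (rule viscosity_test[OF \<sigma> sub B(1) zB smooth_test_const[of m]])
        show "v y \<le> m" for y by (rule le)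
        show "v z = m" by (simp add: m_def)
        show "0 < (1::real)" "0 < \<rho> / 2" using \<rho> by auto
      qed (rule that; assumption)
      define S where "S = {y \<in> B. \<delta> / 2 < v y}"
      have S: "S \<in> lmeasurable"
      proof (rule bounded_set_imp_lmeasurable)
        show "bounded S" using B(2) by (rule bounded_subset) (auto simp: S_def)
        have "v \<in> borel_measurable lebesgue" using sub by (simp add: viscosity_subsolution_def)
        then have "{y \<in> space lebesgue. \<delta> / 2 < v y} \<in> sets lebesgue" by measurable
        then have "{y. \<delta> / 2 < v y} \<inter> B \<in> sets lebesgue" using B(1) by (intro sets.Int) (auto simp: borel_open)
        moreover have "{y. \<delta> / 2 < v y} \<inter> B = S" by (auto simp: S_def)
        ultimately show "S \<in> sets lebesgue" by simp
      qed
      define T where "T = (+) (- z) ` S"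
      have T: "T \<in> lmeasurable" "measure lebesgue T \<le> t"
        unfolding T_def measure_translation using measurable_translation[OF S] small unfolding S_def by blast+
      have T_iff: "y \<in> T \<longleftrightarrow> z + y \<in> S" for y
        unfolding T_def by (auto simp: image_iff) (metis add_diff_cancel_left' diff_conv_add_uminus add.commute)
      \<comment> \<open>Majorant of the integrand: points of the annulus count with the factor
        \<open>- (\<delta> / 2)\<close>, and the subtracted indicator makes \<open>G\<close>
        nonnegative on the exceptional set \<open>T\<close>, where only the sign of the integrand is
        known.\<close>
      define G where "G = (\<lambda>y. - (\<delta> / 2 / \<rho> powr p) * (indicator (annulus \<rho>) y * (y \<bullet> (A *v y)) - \<bar>\<Lambda>\<bar> * \<rho>\<^sup>2 * indicator T y))"
      have i1: "integrable lebesgue (\<lambda>y. indicator (annulus \<rho>) y * (y \<bullet> (A *v y)))"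
        using c(2)[of \<rho> A] by (simp add: integrable_completion)
      have i2: "integrable lebesgue (indicator T :: _ \<Rightarrow> real)"
        using T(1) by (intro integrable_real_indicator) (auto simp: fmeasurable_def)
      have Gint: "integrable lebesgue G" unfolding G_def using i1 i2 by (intro integrable_mult_right Bochner_Integration.integrable_diff) auto
      have FG: "(if norm y < s then second_diff (\<lambda>_. m) z y else second_diff v z y) * levy_kernel \<sigma> A y \<le> G y" for y
      proof -
        define F where "F = (if norm y < s then second_diff (\<lambda>_. m) z y else second_diff v z y)"
        have F0: "F \<le> 0" using le[of "z + y"] le[of "z - y"] by (simp add: F_def second_diff_def m_def[symmetric])
        have k0: "0 \<le> levy_kernel \<sigma> A y" by (rule levy_kernel_admissible(1)[OF A(1)])
        have Fk: "F * levy_kernel \<sigma> A y \<le> 0" using F0 k0 by (rule mult_nonpos_nonneg)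
        have d: "0 < \<delta> / 2 / \<rho> powr p" using \<delta> \<rho> by simp
        show ?thesis
        proof (cases "y \<in> annulus \<rho> \<and> y \<notin> T")
          case True
          then have y: "\<rho> / 2 \<le> norm y" "norm y < \<rho>" and zy: "z + y \<notin> S" by (auto simp: annulus_def T_iff)
          have "v (z + y) \<le> \<delta> / 2"
          proof (cases "z + y \<in> B")
            case True
            then show ?thesis using zy by (simp add: S_def)
          next
            case False
            then show ?thesis using out \<delta> by fastforce
          qed
          \<comment> \<open>\<open>v (z + y) \<le> \<delta> / 2\<close> and
            \<open>v (z - y) \<le> m\<close> bound the second difference by
            \<open>\<delta> / 2 - m\<close>, and \<open>m > \<delta>\<close>.\<close>
          then have F: "F \<le> - (\<delta> / 2)"
            using y A(3) m le[of "z - y"] by (simp add: F_def second_diff_def m_def[symmetric])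
          have ny: "0 < norm y" using y \<rho> by linarith
          have p: "0 \<le> p" using \<sigma> by (simp add: p_def)
          have "0 \<le> y \<bullet> (A *v y)" using A(1) by (simp add: admissible_def psd_def)
          then have "(y \<bullet> (A *v y)) / \<rho> powr p \<le> levy_kernel \<sigma> A y"
            unfolding levy_kernel_def p_def[symmetric] using y ny p by (intro divide_left_mono powr_mono2 mult_pos_pos) auto
          then have "F * levy_kernel \<sigma> A y \<le> F * ((y \<bullet> (A *v y)) / \<rho> powr p)" using F0 by (intro mult_left_mono_neg)
          also have "\<dots> \<le> - (\<delta> / 2) * ((y \<bullet> (A *v y)) / \<rho> powr p)"
            using F \<open>0 \<le> y \<bullet> (A *v y)\<close> by (intro mult_right_mono) auto
          also have "\<dots> = G y" using True by (simp add: G_def)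
          finally show ?thesis by (simp add: F_def)
        next
          case False
          have "indicator (annulus \<rho>) y * (y \<bullet> (A *v y)) - \<bar>\<Lambda>\<bar> * \<rho>\<^sup>2 * indicator T y \<le> 0"
          proof (cases "y \<in> annulus \<rho>")
            case True
            then have "y \<in> T" using False by blast
            have "y \<bullet> (A *v y) \<le> \<Lambda> * (norm y)\<^sup>2" by (rule levy_kernel_admissible(2)[OF A(1)])
            also have "\<dots> \<le> \<bar>\<Lambda>\<bar> * (norm y)\<^sup>2" by (intro mult_right_mono) auto
            also have "\<dots> \<le> \<bar>\<Lambda>\<bar> * \<rho>\<^sup>2" using True by (intro mult_left_mono power_mono) (auto simp: annulus_def)
            finally show ?thesis using True \<open>y \<in> T\<close> by simp
          qed simp
          moreover have "- (\<delta> / 2 / \<rho> powr p) \<le> 0" using d by linarith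
          ultimately have "0 \<le> G y" unfolding G_def by (rule mult_nonpos_nonpos[rotated])
          then show ?thesis using Fk by (simp add: F_def)
        qed
      qed
      have "h z - 1 < (\<integral>y. G y \<partial>lebesgue)"
        using integral_mono[OF int Gint FG] lower by linarith
      also have "\<dots> = - (\<delta> / 2 / \<rho> powr p) * (c * trace A * \<rho> ^ (CARD('n) + 2) - \<bar>\<Lambda>\<bar> * \<rho>\<^sup>2 * measure lebesgue T)"
      proof -
        have "(\<integral>y. indicator (annulus \<rho>) y * (y \<bullet> (A *v y)) \<partial>lebesgue) = c * trace A * \<rho> ^ (CARD('n) + 2)"
          using c(3)[OF \<rho>, of A] by (simp add: integral_completion)
        then show ?thesis unfolding G_def using i1 i2 T(1) by (subst integral_mult_right_zero) (simp add: fmeasurable_def)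
      qed
      also have "\<dots> \<le> - (\<delta> / 2 / \<rho> powr p) * (lam * c * \<rho> ^ (CARD('n) + 2) / 2)"
      proof (rule mult_left_mono_neg)
        have "c * lam * \<rho> ^ (CARD('n) + 2) \<le> c * trace A * \<rho> ^ (CARD('n) + 2)"
          using A(1) c(1) \<rho> by (intro mult_right_mono mult_left_mono) (auto simp: admissible_def)
        moreover have "\<bar>\<Lambda>\<bar> * \<rho>\<^sup>2 * measure lebesgue T \<le> \<bar>\<Lambda>\<bar> * \<rho>\<^sup>2 * t" using T(2) by (intro mult_left_mono) auto
        ultimately show "lam * c * \<rho> ^ (CARD('n) + 2) / 2 \<le> c * trace A * \<rho> ^ (CARD('n) + 2) - \<bar>\<Lambda>\<bar> * \<rho>\<^sup>2 * measure lebesgue T"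
          using tL by (simp add: mult.commute[of lam c])
        show "- (\<delta> / 2 / \<rho> powr p) \<le> 0" using \<delta> by simp
      qed
      also have "\<dots> = - (\<delta> * lam * c / 4) * (\<rho> ^ (CARD('n) + 2) / \<rho> powr p)" by simp
      also have "\<dots> = - (\<bar>C\<bar> + 2)"
      proof -
        have "- (a / 4) * (4 * X / a) = - X" if "0 < a" for a X :: real using that by simp
        then show ?thesis unfolding pow R_def using \<delta> lam c(1) by (meson mult_pos_pos)
      qed
      finally show False using h zB by fastforce
    qed
  qed
qed

text \<open>By continuity a violation at one point spreads to an open set, which is not negligible,
  so the essential bound holds at every point of \<open>B\<close>.\<close>

lemma continuous_Linf_bound:
  fixes g :: "real^'n \<Rightarrow> real"
  assumes B: "open B" and g: "continuous_on B g" and C: "Linf_norm (lebesgue_on B) g \<le> ereal C" and x: "x \<in> B"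
  shows "\<bar>g x\<bar> \<le> C"
proof (rule ccontr)
  assume "\<not> \<bar>g x\<bar> \<le> C"
  define U where "U = {y \<in> B. C < \<bar>g y\<bar>}"
  have "open (B \<inter> (\<lambda>y. \<bar>g y\<bar>) -` {C<..})"
    using B g by (intro continuous_open_preimage continuous_intros) auto
  moreover have "B \<inter> (\<lambda>y. \<bar>g y\<bar>) -` {C<..} = U" by (auto simp: U_def)
  ultimately have U: "open U" by simp
  have "AE y in lebesgue_on B. ereal \<bar>g y\<bar> \<le> esssup (lebesgue_on B) (\<lambda>y. ereal \<bar>g y\<bar>)" by (rule esssup_AE)
  then have "AE y in lebesgue_on B. \<bar>g y\<bar> \<le> C"
  proof eventually_elim
    case (elim y)
    then have "ereal \<bar>g y\<bar> \<le> ereal C" using C unfolding Linf_norm_def by (rule order_trans)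
    then show ?case by simp
  qed
  then have "AE y in lebesgue. y \<in> B \<longrightarrow> \<bar>g y\<bar> \<le> C"
    using B by (subst (asm) AE_restrict_space_iff) (auto simp: borel_open)
  then have "AE y in lebesgue. y \<notin> U" by eventually_elim (auto simp: U_def)
  then have "negligible U"
    using U by (subst (asm) AE_iff_null_sets[symmetric]) (auto simp: borel_open negligible_iff_null_sets)
  moreover have "x \<in> U" using x \<open>\<not> \<bar>g x\<bar> \<le> C\<close> by (simp add: U_def)
  ultimately show False using open_not_negligible[OF U] by blast
qed

lemma compact_superlevel_set:
  fixes f :: "'a::metric_space \<Rightarrow> real"
  assumes S: "compact S" and f: "usc_on S f"
  shows "compact {x \<in> S. m \<le> f x}"
proof -
  have "openin (top_of_set S) {x \<in> S. f x < m}"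
    unfolding openin_euclidean_subtopology_iff
  proof (intro conjI ballI)
    fix x assume x: "x \<in> {x \<in> S. f x < m}"
    then have "\<forall>\<^sub>F y in at x within S. f y < m" using f unfolding usc_on_def by blast
    then obtain d where "0 < d" "\<forall>y\<in>S. y \<noteq> x \<and> dist y x < d \<longrightarrow> f y < m" by (auto simp: eventually_at)
    then show "\<exists>e>0. \<forall>x'\<in>S. dist x' x < e \<longrightarrow> x' \<in> {x \<in> S. f x < m}"
      using x by (intro exI[of _ d]) auto
  qed auto
  then have "closedin (top_of_set S) (S - {x \<in> S. f x < m})" by (intro closedin_diff) auto
  moreover have "S - {x \<in> S. f x < m} = {x \<in> S. m \<le> f x}" by auto
  ultimately show ?thesis using closedin_compact[OF S] by simp
qed

text \<open>Only points with \<open>v \<ge> \<delta> / 4\<close> matter in the comparison, and those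
  among them with \<open>g \<ge> \<rho>\<close> form a compact subset \<open>K\<close> of
  \<open>E\<close>, on which the barrier absorbs the full bound \<open>C\<close>. At the others the
  slack \<open>2 * \<rho>\<close> exceeds \<open>g\<close> by more than \<rho>.\<close>

proposition viscosity_small_sup:
  fixes x0 :: "real^'n"
  assumes \<sigma>: "0 < \<sigma>" "\<sigma> < 2" and lam: "0 < lam" and r: "0 < r" and C: "0 \<le> C" and \<delta>: "0 < \<delta>"
  defines "B \<equiv> ball x0 r"
  obtains t where "0 < t" "\<And>v g x. continuous_on B g \<Longrightarrow> \<forall>x\<in>B. \<bar>g x\<bar> \<le> C \<Longrightarrow>
    viscosity_subsolution \<sigma> lam \<Lambda> B v (\<lambda>x. - g x) \<Longrightarrow> \<forall>x. x \<notin> B \<longrightarrow> v x \<le> 0 \<Longrightarrow>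
    measure lebesgue {x \<in> B. g x > 0} \<le> t \<Longrightarrow> v x \<le> \<delta>"
proof -
  \<comment> \<open>Large enough for \<open>B\<close> to lie in the ball of radius
    \<open>L / 8\<close> about the origin, where the barriers are controlled, and in one period
    cell.\<close>
  define L where "L = 8 * (norm x0 + r)"
  have L: "0 < L" unfolding L_def using r by (simp add: add_nonneg_pos)
  have BL: "B \<subseteq> ball 0 (L / 8)"
  proof
    fix x assume "x \<in> B"
    then have "norm (x - x0) < r" by (simp add: B_def dist_norm norm_minus_commute)
    then have "norm x < norm x0 + r" using norm_triangle_ineq[of "x - x0" x0] by simp
    then show "x \<in> ball 0 (L / 8)" by (simp add: L_def)
  qed
  have B: "open B" "bounded B" by (auto simp: B_def)
  have cell: "B \<subseteq> period_cell L"
  proof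
    fix x assume "x \<in> B"
    then have "norm x < L / 8" using BL by auto
    then have "\<bar>x $ j\<bar> < L / 2" for j using component_le_norm_cart[of x j] L by simp
    then have "- (L / 2) \<le> x $ j \<and> x $ j < L / 2" for j using abs_less_iff[of "x $ j" "L / 2"] by (metis less_imp_le minus_less_iff)
    then show "x \<in> period_cell L" unfolding period_cell_def by blast
  qed
  obtain t0 where t0: "0 < t0" and bound: "\<And>(B :: (real^'n) set) v h x. dirichlet_subsolution \<sigma> lam \<Lambda> B C v h \<Longrightarrow> open B \<Longrightarrow> bounded B \<Longrightarrow>
     measure lebesgue {y \<in> B. \<delta> / 2 < v y} \<le> t0 \<Longrightarrow> v x \<le> \<delta>"
  proof (rule viscosity_max_bound[OF \<sigma> lam \<delta>, where 'n='n and \<Lambda>=\<Lambda> and C=C], goal_cases)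
    case 1 from 1(2-) show ?thesis by (rule 1(1))
  qed
  obtain D where D: "0 < D" and small: "\<And>(K :: (real^'n) set) E \<rho> \<eta>. compact K \<Longrightarrow> K \<subseteq> E \<Longrightarrow> open E \<Longrightarrow> E \<subseteq> ball 0 (L / 8) \<Longrightarrow>
      0 < \<rho> \<Longrightarrow> measure lebesgue E \<le> (2 * \<rho>) ^ CARD('n) \<Longrightarrow> 0 \<le> \<eta> \<Longrightarrow> \<exists>\<Phi>. small_barrier \<sigma> lam \<Lambda> L K C \<eta> (D * (\<rho> + \<eta>)) \<Phi>"
  proof (rule small_supersolution[OF \<sigma> lam L C, where 'n='n and \<Lambda>=\<Lambda>], goal_cases)
    case 1 from 1(2-) show ?thesis by (rule 1(1))
  qed
  \<comment> \<open>For Chebyshev's inequality: the integral of the barrier is at most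
    \<open>3 * D * \<rho> = \<delta> / 4 * t0\<close>, so the barrier exceeds
    \<open>\<delta> / 4\<close> on a part of the cell of measure at most \<open>t0\<close>.\<close>
  define \<rho> where "\<rho> = t0 * \<delta> / (12 * D)"
  have \<rho>: "0 < \<rho>" using t0 \<delta> D by (simp add: \<rho>_def)
  define t where "t = (2 * \<rho>) ^ CARD('n)"
  have t: "0 < t" using \<rho> by (simp add: t_def)
  show ?thesis
  proof (rule that[OF t])
    fix v :: "real^'n \<Rightarrow> real" and g x
    assume g: "continuous_on B g" and gC: "\<forall>x\<in>B. \<bar>g x\<bar> \<le> C" and sub: "viscosity_subsolution \<sigma> lam \<Lambda> B v (\<lambda>x. - g x)"
      and out: "\<forall>x. x \<notin> B \<longrightarrow> v x \<le> 0" and gt: "measure lebesgue {x \<in> B. g x > 0} \<le> t"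
    define E where "E = {x \<in> B. g x > 0}"
    define K0 where "K0 = {x \<in> closure B. \<delta> / 4 \<le> v x}"
    define K where "K = {x \<in> K0. \<rho> \<le> g x}"
    have "compact (closure B)" using B by (simp add: compact_closure)
    then have K0: "compact K0" unfolding K0_def
      using sub by (intro compact_superlevel_set) (auto simp: viscosity_subsolution_def)
    have K0B: "K0 \<subseteq> B" using out \<delta> by (fastforce simp: K0_def)
    have "closedin (top_of_set K0) (K0 \<inter> g -` {\<rho>..})"
      using continuous_on_subset[OF g K0B] by (intro continuous_closedin_preimage) auto
    moreover have "K0 \<inter> g -` {\<rho>..} = K" by (auto simp: K_def)
    ultimately have K: "compact K" using closedin_compact[OF K0] by simp
    have KE: "K \<subseteq> E" using K0B \<rho> by (auto simp: K_def E_def)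
    have "open (B \<inter> g -` {0<..})" using B g by (intro continuous_open_preimage) auto
    moreover have "B \<inter> g -` {0<..} = E" by (auto simp: E_def)
    ultimately have E: "open E" by simp
    have EL: "E \<subseteq> ball 0 (L / 8)" using BL by (auto simp: E_def)
    have vol: "measure lebesgue E \<le> (2 * \<rho>) ^ CARD('n)" using gt by (simp add: E_def t_def)
    have "0 \<le> 2 * \<rho>" using \<rho> by simp
    from small[OF K KE E EL \<rho> vol this] obtain \<Phi> where "small_barrier \<sigma> lam \<Lambda> L K C (2 * \<rho>) (D * (\<rho> + 2 * \<rho>)) \<Phi>" ..
    then have \<Phi>: "smooth_test \<Phi>" "\<forall>x. 0 \<le> \<Phi> x"
        "integrable lborel (\<lambda>x. indicator (period_cell L) x * \<Phi> x)"
        "(\<integral>x. indicator (period_cell L) x * \<Phi> x \<partial>lborel) \<le> D * (\<rho> + 2 * \<rho>)"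
        "\<forall>A\<in>admissible lam \<Lambda>. \<forall>x\<in>ball 0 (L / 8). levy_op \<sigma> A \<Phi> x \<le> - (2 * \<rho>)"
        "\<forall>A\<in>admissible lam \<Lambda>. \<forall>x\<in>K. levy_op \<sigma> A \<Phi> x \<le> - C - 2 * \<rho>"
      unfolding small_barrier_def by blast+
    have le: "v x \<le> \<Phi> x + \<delta> / 4" for x
    proof (rule viscosity_comparison[OF \<sigma> sub B _ \<Phi>(1) _ _ \<rho>])
      fix x and A :: "real^'n^'n" assume x: "x \<in> B" "\<delta> / 4 \<le> v x" and A: "A \<in> admissible lam \<Lambda>"
      show "levy_op \<sigma> A \<Phi> x \<le> - g x - \<rho>"
      proof (cases "\<rho> \<le> g x")
        case True
        then have "x \<in> K" using x closure_subset by (auto simp: K_def K0_def)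
        then have "levy_op \<sigma> A \<Phi> x \<le> - C - 2 * \<rho>" using \<Phi>(6) A by blast
        moreover have "g x \<le> C" using gC x by (auto simp: abs_le_iff)
        ultimately show ?thesis using \<rho> by linarith
      next
        case False
        have "levy_op \<sigma> A \<Phi> x \<le> - (2 * \<rho>)" using \<Phi>(5) A x BL by blast
        then show ?thesis using False by linarith
      qed
    qed (use out \<Phi>(2) \<delta> in auto)
    have \<Phi>m: "\<Phi> \<in> borel_measurable borel" using \<Phi>(1) by (simp add: smooth_test_def)
    define S where "S = {y \<in> space borel. y \<in> period_cell L \<and> \<delta> / 4 < \<Phi> y}"
    have S: "S \<in> sets borel" unfolding S_def using \<Phi>m by measurable
    have bdS: "bounded S" by (rule bounded_subset[OF bounded_period_cell]) (auto simp: S_def)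
    have intS: "integrable lborel (indicator S :: _ \<Rightarrow> real)"
      using S bdS by (intro integrable_real_indicator) (auto simp: emeasure_bounded_finite[unfolded infinity_ennreal_def])
    have "\<delta> / 4 * measure lborel S = (\<integral>y. \<delta> / 4 * indicator S y \<partial>lborel)" using S by simp
    also have "\<dots> \<le> (\<integral>x. indicator (period_cell L) x * \<Phi> x \<partial>lborel)"
    proof (rule integral_mono[OF _ \<Phi>(3)])
      show "integrable lborel (\<lambda>y. \<delta> / 4 * indicator S y)" using intS by simp
      fix y show "\<delta> / 4 * indicator S y \<le> indicator (period_cell L) y * \<Phi> y"
        using \<Phi>(2) by (auto simp: S_def indicator_def)
    qed
    also have "\<dots> \<le> \<delta> / 4 * t0" using \<Phi>(4) D by (simp add: \<rho>_def)
    finally have mS: "measure lborel S \<le> t0" using \<delta> by simp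
    \<comment> \<open>Where \<open>v\<close> exceeds \<open>\<delta> / 2\<close>, the comparison
      \<open>le\<close> forces the barrier above \<open>\<delta> / 4\<close>.\<close>
    have "measure lebesgue {y \<in> B. \<delta> / 2 < v y} \<le> measure lebesgue S"
    proof (rule measure_mono_fmeasurable)
      show "{y \<in> B. \<delta> / 2 < v y} \<subseteq> S"
      proof
        fix y assume y: "y \<in> {y \<in> B. \<delta> / 2 < v y}"
        then show "y \<in> S" using cell le[of y] by (auto simp: S_def)
      qed
      have "v \<in> borel_measurable lebesgue" using sub by (simp add: viscosity_subsolution_def)
      then have "{y \<in> space lebesgue. \<delta> / 2 < v y} \<in> sets lebesgue" by measurable
      then have "{y. \<delta> / 2 < v y} \<inter> B \<in> sets lebesgue" using B(1) by (intro sets.Int) (auto simp: borel_open)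
      moreover have "{y. \<delta> / 2 < v y} \<inter> B = {y \<in> B. \<delta> / 2 < v y}" by auto
      ultimately show "{y \<in> B. \<delta> / 2 < v y} \<in> sets lebesgue" by simp
      show "S \<in> lmeasurable" using S bdS by (intro bounded_set_imp_lmeasurable) auto
    qed
    also have "\<dots> \<le> t0" using mS S by simp
    finally have "measure lebesgue {y \<in> B. \<delta> / 2 < v y} \<le> t0" .
    moreover have "dirichlet_subsolution \<sigma> lam \<Lambda> B C v (\<lambda>x. - g x)"
      using sub out gC by (simp add: dirichlet_subsolution_def abs_le_iff)
    ultimately show "v x \<le> \<delta>" using B by (intro bound)
  qed
qed

text \<open>The threshold \<open>t\<close> depends on \<delta>, \<open>C\<close> and the fixed data
  but not on \<epsilon>, so the decay of the measures gives the bound \<delta> for all small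
  \<epsilon> directly; no limit of the functions is taken.\<close>

theorem proposition1p8:
  fixes \<sigma> lam \<Lambda> C r :: real
    and x0 :: "real^'n"
    and B :: "(real^'n) set"
    and g v :: "real \<Rightarrow> real^'n \<Rightarrow> real"
  assumes "0 < \<sigma>" and "\<sigma> < 2" and "0 < lam" and "0 < \<Lambda>"
    and "0 < r" and "B = ball x0 r"
    and "\<And>\<epsilon>. 0 < \<epsilon> \<Longrightarrow> continuous_on B (g \<epsilon>)"
    and "\<And>\<epsilon>. 0 < \<epsilon> \<Longrightarrow> Linf_norm (lebesgue_on B) (g \<epsilon>) \<le> ereal C"
    and "\<And>\<epsilon>. 0 < \<epsilon> \<Longrightarrow> viscosity_subsolution \<sigma> lam \<Lambda> B (v \<epsilon>) (\<lambda>x. - g \<epsilon> x)"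
    and "\<And>\<epsilon> x. 0 < \<epsilon> \<Longrightarrow> x \<notin> B \<Longrightarrow> v \<epsilon> x \<le> 0"
    and "((\<lambda>\<epsilon>. measure lebesgue {x \<in> B. g \<epsilon> x > 0}) \<longlongrightarrow> 0) (at_right 0)"
  shows "((\<lambda>\<epsilon>. Linf_norm lebesgue (\<lambda>x. max (v \<epsilon> x) 0)) \<longlongrightarrow> 0) (at_right 0)"
proof -
  have pos: "\<forall>\<^sub>F \<epsilon> in at_right 0. 0 < (\<epsilon>::real)" by (simp add: eventually_at_right_less)
  have gC: "\<bar>g \<epsilon> x\<bar> \<le> C" if "0 < \<epsilon>" "x \<in> B" for \<epsilon> x
    by (rule continuous_Linf_bound[OF _ assms(7)[OF that(1)] assms(8)[OF that(1)] that(2)]) (simp add: assms(6))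
  have C: "0 \<le> C" using gC[of 1 x0] assms(5,6) by simp
  have ev: "\<forall>\<^sub>F \<epsilon> in at_right 0. \<forall>x. v \<epsilon> x \<le> \<delta>" if \<delta>: "0 < \<delta>" for \<delta>
  proof -
    obtain t where t: "0 < t" and bound: "\<And>v g x. continuous_on (ball x0 r) g \<Longrightarrow> \<forall>x\<in>ball x0 r. \<bar>g x\<bar> \<le> C \<Longrightarrow>
        viscosity_subsolution \<sigma> lam \<Lambda> (ball x0 r) v (\<lambda>x. - g x) \<Longrightarrow> \<forall>x. x \<notin> ball x0 r \<longrightarrow> v x \<le> 0 \<Longrightarrow>
        measure lebesgue {x \<in> ball x0 r. g x > 0} \<le> t \<Longrightarrow> v x \<le> \<delta>"
    proof (rule viscosity_small_sup[OF assms(1,2,3,5) C \<delta>, of x0 \<Lambda>], goal_cases)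
      case 1 from 1(2-) show ?thesis by (rule 1(1))
    qed
    have "\<forall>\<^sub>F \<epsilon> in at_right 0. measure lebesgue {x \<in> B. g \<epsilon> x > 0} < t"
      using assms(11) t by (rule order_tendstoD(2))
    with pos show ?thesis
    proof eventually_elim
      case (elim \<epsilon>)
      then show ?case
        using assms(7,9,10)[of \<epsilon>] gC[of \<epsilon>] by (intro allI bound[of "g \<epsilon>"]) (simp_all add: assms(6))
    qed
  qed
  have meas: "(\<lambda>x. ereal \<bar>max (v \<epsilon> x) 0\<bar>) \<in> borel_measurable lebesgue" if "0 < \<epsilon>" for \<epsilon>
  proof -
    have [measurable]: "v \<epsilon> \<in> borel_measurable lebesgue" using assms(9)[OF that] by (simp add: viscosity_subsolution_def)
    show ?thesis by measurable
  qed
  have nonneg: "0 \<le> Linf_norm lebesgue (\<lambda>x. max (v \<epsilon> x) 0)" if "0 < \<epsilon>" for \<epsilon>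
  proof -
    \<comment> \<open>Positive measure of the whole space keeps the essential supremum of the zero
      function at \<open>0\<close> instead of minus infinity.\<close>
    have "emeasure lebesgue (space lebesgue :: (real^'n) set) \<noteq> 0"
      by (simp add: emeasure_lborel_UNIV)
    then have "(0::ereal) = esssup lebesgue (\<lambda>_::real^'n. 0)" by (rule esssup_const[symmetric])
    also have "\<dots> \<le> Linf_norm lebesgue (\<lambda>x. max (v \<epsilon> x) 0)"
      unfolding Linf_norm_def
    proof (rule esssup_mono)
      show "0 \<le> ereal \<bar>max (v \<epsilon> x) 0\<bar>" for x
        unfolding zero_ereal_def ereal_less_eq(3) by (rule abs_ge_zero)
    qed simp
    finally show ?thesis .
  qed
  show ?thesis
  proof (rule order_tendstoI)
    fix a :: ereal assume "a < 0"
    from pos show "\<forall>\<^sub>F \<epsilon> in at_right 0. a < Linf_norm lebesgue (\<lambda>x. max (v \<epsilon> x) 0)"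
      by eventually_elim (use \<open>a < 0\<close> nonneg in \<open>auto intro: less_le_trans\<close>)
  next
    fix a :: ereal assume "0 < a"
    then obtain \<delta> :: real where \<delta>: "0 < \<delta>" "ereal \<delta> < a" using ereal_dense2[of 0 a] by auto
    from pos ev[OF \<delta>(1)] show "\<forall>\<^sub>F \<epsilon> in at_right 0. Linf_norm lebesgue (\<lambda>x. max (v \<epsilon> x) 0) < a"
    proof eventually_elim
      case (elim \<epsilon>)
      have "Linf_norm lebesgue (\<lambda>x. max (v \<epsilon> x) 0) \<le> ereal \<delta>"
        unfolding Linf_norm_def using elim(2) \<delta>(1) by (intro esssup_I meas[OF elim(1)]) auto
      then show ?case using \<delta>(2) by (rule le_less_trans)
    qed
  qed
qed

end
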